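(* Consider the eigenvalues of the problem $$-i\varepsilon y''=(x-\lambda)y,\qquad x\in(-1,1),\qquad y(-1)=y(1)=0.$$ The number $N_\delta(\varepsilon)$ of eigenvalues in the disc of small (fixed) radius $\delta>0$ centered at the node $-\frac{i}{\sqrt3}$ equals, as $\varepsilon\to0+$, $$N_\delta(\varepsilon)=\frac{\varepsilon^{-1/2}}{\pi}\left(f\left(-\frac{i}{\sqrt3}-i\delta\right)-\frac43\left(\frac{2}{\sqrt3}-\delta\right)^{3/2}\right)+O(1).$$ In the disc of shrinking radius $\varepsilon^{1/2}\ln\varepsilon^{-\theta}$ with the same center, for fixed $\theta>\frac13\left(\frac34\right)^{3/4}$, the number of eigenvalues equals $$N_{\varepsilon^{1/2}\ln\varepsilon^{-\theta}}(\varepsilon)=\frac{2^{1/2}3^{3/4}}{\pi}\ln\varepsilon^{-\theta}+O(1),\qquad\varepsilon\to0+.$$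
   Context: $\lambda\in\mathbb C$ is the spectral parameter, $\varepsilon>0$ a small parameter. $\ln\varepsilon^{-\theta}=\theta\ln(1/\varepsilon)$. For $\operatorname{Im}\lambda<0$, $f(\lambda)=\int_{-1}^{1}e^{-i\pi/4}\sqrt{x-\lambda}\,dx$, with the branch of the square root such that $f(-i/\sqrt3)>0$ (the principal branch). *)

theory Defs
  imports "HOL-Analysis.Analysis" "HOL-Library.Landau_Symbols"
begin

(* Classical solutions: y is twice differentiable in the open interval and attains the
   boundary values continuously. As the coefficients are smooth, such a y is automatically
   smooth up to the boundary. *)
definition dirichlet_eigenfunction :: "real \<Rightarrow> complex \<Rightarrow> (real \<Rightarrow> complex) \<Rightarrow> bool" where
  "dirichlet_eigenfunction eps lam y \<longleftrightarrow>
     continuous_on {-1..1} y \<and> y (-1) = 0 \<and> y 1 = 0 \<and>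
     (\<exists>x\<in>{-1..1}. y x \<noteq> 0) \<and>
     (\<exists>y1 y2. \<forall>x\<in>{-1<..<1}.
        (y has_vector_derivative y1 x) (at x) \<and>
        (y1 has_vector_derivative y2 x) (at x) \<and>
        - \<i> * of_real eps * y2 x = (of_real x - lam) * y x)"

definition eigenvalues :: "real \<Rightarrow> complex set" where
  "eigenvalues eps = {lam. \<exists>y. dirichlet_eigenfunction eps lam y}"

definition node :: complex where
  "node = - \<i> / of_real (sqrt 3)"

(* Every eigenspace is one-dimensional, and each eigenvalue is counted once. *)
definition eigenvalue_count :: "real \<Rightarrow> real \<Rightarrow> nat" where
  "eigenvalue_count r eps = card (eigenvalues eps \<inter> ball node r)"

(* Used only for Im lam < 0: then x - lam stays in the open upper half-plane, so the
   principal root is continuous in x, and it is the branch for which f node > 0. *)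
definition f :: "complex \<Rightarrow> complex" where
  "f lam = integral {-1..1}
     (\<lambda>x::real. exp (- \<i> * of_real pi / 4) * csqrt (of_real x - lam))"

end

theory Submission
  imports Defs "HOL-Complex_Analysis.Complex_Analysis" "HOL-Probability.Sinc_Integral"
begin

text \<open>
  In the variable \<open>z = -i \<epsilon>\<^sup>-\<^sup>1\<^sup>/\<^sup>3 (x - \<lambda>)\<close> the equation becomes Airy's equation. Let \<open>A\<close> be its recessive
  solution and \<open>\<omega> = exp (2 \<pi> i / 3)\<close>. The rotations \<open>A (\<omega>\<^sup>k z)\<close> satisfy one linear relation; it expresses the
  Dirichlet determinant through values of \<open>A\<close> in \<open>Re z > 0\<close> only, and after division by one term the eigenvalue
  condition reads \<open>1 + e\<^sup>U + e\<^sup>V = 0\<close>. Here \<open>U, V\<close> are explicit phases times \<open>\<epsilon>\<^sup>-\<^sup>1\<^sup>/\<^sup>2\<close> up to bounded holomorphic terms,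
  and at the node the three exponents have an equilateral triangle of derivatives. At distance much larger than
  \<open>\<epsilon>\<^sup>1\<^sup>/\<^sup>2\<close> from the node every zero therefore lies near one of three rays at mutual angle 120 degrees, where one
  exponential is negligible; the condition becomes \<open>\<Psi> = 2 \<pi> \<epsilon>\<^sup>1\<^sup>/\<^sup>2 k\<close> with \<open>k\<close> an integer and \<open>\<Psi>\<close> injective, so zeros
  correspond to integers and are counted without multiplicity. The remaining zeros near the node are \<open>O(1)\<close> in number
  by a Jensen type estimate. Bounded errors in the exponents change the count by \<open>O(1)\<close> only, so no sharp Airy
  asymptotics are needed.
\<close>

text \<open>The endpoints 1 and -1 lie at distance \<open>arm\<close> from the node, in the
  directions pi/6 and 5 pi/6. For each endpoint the two Airy arguments that enter its quotient have
  square roots s at the node of argument +pi/6 and -pi/6, so the difference of their actions (2/3)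
  s^3 is purely imaginary there. Hence no exponential has a large or small modulus at the node, and
  this is what singles the point out. One function, \<open>phase\<close>, describes both endpoints
  through rotated arguments. Its increments along the three rays are phase 0 - phase r, twice, and
  phase (\<omega> r) + phase (\<omega>' r) - 2 phase 0. Their sum no longer contains phase 0, and it
  is the source of both formulas: for a fixed radius it is recognised as 2 (f - (4/3) (arm -
  r)^(3/2)), for a shrinking radius it is expanded to first order. This requires an error constant
  independent of both eps and the radius. It depends only on the slope of \<open>phase\<close> at 0
  and on the bound 8 for the slowly varying part of the exponent.\<close>

section \<open>Counting solutions near a line\<close>

lemma near_linear_surj:
  fixes g :: "complex \<Rightarrow> complex"
  assumes lip: "\<And>x y. x \<in> cball a \<rho> \<Longrightarrow> y \<in> cball a \<rho> \<Longrightarrow>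
      norm (g x - g y - q * (x - y)) \<le> norm q / 2 * norm (x - y)"
    and q: "q \<noteq> 0" and rho: "0 \<le> \<rho>" and t: "norm (t - g a) \<le> norm q * \<rho> / 2"
  shows "\<exists>x\<in>cball a \<rho>. g x = t"
proof -
  define T where "T x = x - (g x - t) / q" for x
  have contr: "norm (T x - T y) \<le> 1/2 * norm (x - y)" if "x \<in> cball a \<rho>" "y \<in> cball a \<rho>" for x y
  proof -
    have "T x - T y = - ((g x - g y - q * (x - y)) / q)"
      using q by (simp add: T_def field_simps)
    hence "norm (T x - T y) = norm (g x - g y - q * (x - y)) / norm q"
      by (simp add: norm_divide)
    also have "\<dots> \<le> (norm q / 2 * norm (x - y)) / norm q"
      using lip[OF that] by (intro divide_right_mono) auto
    finally show ?thesis using q by simp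
  qed
  have Ta: "norm (T a - a) \<le> \<rho> / 2"
  proof -
    have "norm (T a - a) = norm (t - g a) / norm q"
      by (simp add: T_def norm_divide norm_minus_commute)
    also have "\<dots> \<le> (norm q * \<rho> / 2) / norm q"
      using t by (intro divide_right_mono) auto
    finally show ?thesis using q by simp
  qed
  have self: "T ` cball a \<rho> \<subseteq> cball a \<rho>"
  proof safe
    fix x assume x: "x \<in> cball a \<rho>"
    have "norm (T x - a) \<le> norm (T x - T a) + norm (T a - a)"
      using norm_triangle_ineq[of "T x - T a" "T a - a"] by simp
    also have "\<dots> \<le> 1/2 * norm (x - a) + \<rho> / 2"
      using contr[OF x, of a] Ta rho by simp
    also have "\<dots> \<le> \<rho>" using x by (simp add: dist_norm norm_minus_commute)
    finally show "T x \<in> cball a \<rho>" by (simp add: dist_norm norm_minus_commute)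
  qed
  have "\<exists>!x\<in>cball a \<rho>. T x = x"
    by (rule Banach_fix[where c = "1/2"])
      (use contr self rho in \<open>auto simp: dist_norm compact_imp_complete\<close>)
  then obtain x where "x \<in> cball a \<rho>" "T x = x" by blast
  thus ?thesis using q by (auto simp: T_def)
qed

text \<open>Divide out one zero a at a time and multiply by 2 R. On the circle of radius 5 R one has
  |z - a| \<ge> 4 R, so the upper bound is halved, while at \<open>w\<close> one has |w - a| \<le> 2
  R, so the lower bound survives. Each zero thus costs a factor 2, and the maximum principle closes
  the induction.\<close>

lemma zeros_card_bound:
  assumes "finite S" "S \<subseteq> {z \<in> cball 0 R. H z = 0}" "H holomorphic_on ball 0 (6 * R)" "0 < R"
    "\<And>z. norm z = 5 * R \<Longrightarrow> norm (H z) \<le> M" "norm w \<le> R" "\<mu> \<le> norm (H w)" "0 < \<mu>"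
  shows "\<mu> * 2 ^ card S \<le> M"
  using assms
proof (induction S arbitrary: H M rule: finite_induct)
  case empty
  have "norm (H w) \<le> M"
  proof (rule maximum_modulus_frontier[of H "ball 0 (5 * R)"])
    show "H holomorphic_on interior (ball 0 (5 * R))"
      using empty by (auto intro!: holomorphic_on_subset[OF empty.prems(2)])
    show "continuous_on (closure (ball 0 (5 * R))) H"
      using empty by (auto intro!: continuous_on_subset[OF holomorphic_on_imp_continuous_on[OF empty.prems(2)]])
  qed (use empty in \<open>auto simp: frontier_ball\<close>)
  thus ?case using empty by simp
next
  case (insert a S)
  define G where "G z = 2 * R * (if z = a then deriv H a else (H z - H a) / (z - a))" for z
  have Ha: "H a = 0" and aR: "norm a \<le> R" using insert.prems by auto
  have "w \<noteq> a" using Ha insert.prems by auto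
  have "\<mu> * 2 ^ card S \<le> M / 2"
  proof (rule insert.IH)
    show "S \<subseteq> {z \<in> cball 0 R. G z = 0}"
    proof
      fix z assume "z \<in> S"
      moreover from this have "z \<noteq> a" using insert.hyps by auto
      ultimately show "z \<in> {z \<in> cball 0 R. G z = 0}"
        using insert.prems Ha by (auto simp: G_def)
    qed
    show "G holomorphic_on ball 0 (6 * R)"
      unfolding G_def using insert.prems(2,3) aR
      by (intro holomorphic_intros pole_lemma) auto
    show "norm (G z) \<le> M / 2" if z: "norm z = 5 * R" for z
    proof -
      have "4 * R \<le> norm (z - a)" using norm_triangle_ineq2[of z a] aR z by simp
      moreover have "z \<noteq> a" using z aR \<open>0 < R\<close> by auto
      ultimately have "norm (G z) \<le> 2 * R * (norm (H z) / (4 * R))"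
        using insert.prems(3) Ha unfolding G_def
        by (auto simp del: times_divide_eq_right simp: norm_mult norm_divide intro!: mult_left_mono divide_left_mono mult_pos_pos)
      also have "\<dots> \<le> M / 2" using insert.prems(3) insert.prems(4)[OF z] by simp
      finally show ?thesis .
    qed
    have "norm (w - a) \<le> 2 * R" using norm_triangle_ineq4[of w a] aR insert.prems(5) by simp
    hence "1 * norm (H w) \<le> 2 * R / norm (w - a) * norm (H w)"
      using \<open>w \<noteq> a\<close> by (intro mult_right_mono) auto
    also have "\<dots> = norm (G w)"
      using \<open>w \<noteq> a\<close> Ha insert.prems(3) by (simp add: G_def norm_mult norm_divide)
    finally show "\<mu> \<le> norm (G w)" using insert.prems(6) by simp
  qed (use insert in auto)
  thus ?case using insert.hyps by simp
qed

lemma card_int_interval_le: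
  fixes \<alpha> \<beta> :: real and S :: "int set"
  assumes "\<And>k. k \<in> S \<Longrightarrow> \<alpha> \<le> k \<and> k \<le> \<beta>" and "\<alpha> \<le> \<beta> + 1"
  shows "finite S \<and> card S \<le> \<beta> - \<alpha> + 1"
proof -
  have sub: "S \<subseteq> {\<lceil>\<alpha>\<rceil>..\<lfloor>\<beta>\<rfloor>}" using assms(1) by (auto simp: ceiling_le_iff le_floor_iff)
  hence "card S \<le> nat (\<lfloor>\<beta>\<rfloor> - \<lceil>\<alpha>\<rceil> + 1)" using card_mono[OF _ sub] by simp
  also have "real (nat (\<lfloor>\<beta>\<rfloor> - \<lceil>\<alpha>\<rceil> + 1)) \<le> \<beta> - \<alpha> + 1"
    using assms(2) by (cases "\<lfloor>\<beta>\<rfloor> - \<lceil>\<alpha>\<rceil> + 1 \<ge> 0") (simp add: of_nat_nat, linarith, simp)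
  finally show ?thesis using finite_subset[OF sub] by simp
qed

lemma card_int_interval_ge:
  fixes \<alpha> \<beta> :: real
  shows "\<beta> - \<alpha> - 1 \<le> card {k::int. \<alpha> \<le> k \<and> k \<le> \<beta>}"
proof -
  have "{k::int. \<alpha> \<le> k \<and> k \<le> \<beta>} = {\<lceil>\<alpha>\<rceil>..\<lfloor>\<beta>\<rfloor>}"
    by (auto simp: ceiling_le_iff le_floor_iff)
  thus ?thesis by simp linarith
qed

section \<open>Truncated sectors about the positive real axis and the solutions inside them\<close>

definition wedge :: "real \<Rightarrow> real \<Rightarrow> complex set" where
  "wedge c k = {w. k < Re w \<and> \<bar>Im w\<bar> < c * Re w}"

lemma convex_wedge: "convex (wedge c k)"
proof -
  have "wedge c k = {w. k < Re w} \<inter> {w. inner w (Complex (-c) 1) < 0} \<inter> {w. inner w (Complex (-c) (-1)) < 0}"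
    by (auto simp: wedge_def inner_complex_def algebra_simps abs_less_iff)
  moreover have "convex {w. inner w v < (0::real)}" for v :: complex
    using convex_halfspace_lt[of v 0] by (simp add: inner_commute)
  ultimately show ?thesis
    by (auto intro!: convex_Int convex_halfspace_Re_gt)
qed

lemma open_wedge: "open (wedge c k)"
  unfolding wedge_def by (intro open_Collect_conj open_Collect_less continuous_intros)

text \<open>Solutions are counted in the narrow sector, while the remainder is bounded on the wide
  one. The gap leaves a disc of radius proportional to Re w for Cauchy's estimate.\<close>

lemma cball_subset_wedge:
  assumes "w \<in> wedge (1/2) (2 * k)" "0 \<le> k"
  shows "cball w (Re w / 8) \<subseteq> wedge 1 k"
proof
  fix z assume "z \<in> cball w (Re w / 8)"
  hence "norm (z - w) \<le> Re w / 8" by (simp add: dist_norm norm_minus_commute)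
  hence "\<bar>Re (z - w)\<bar> \<le> Re w / 8" "\<bar>Im (z - w)\<bar> \<le> Re w / 8"
    using abs_Re_le_cmod[of "z - w"] abs_Im_le_cmod[of "z - w"] by linarith+
  moreover have "Re z = Re w + Re (z - w)" "Im z = Im w + Im (z - w)" by simp_all
  ultimately show "z \<in> wedge 1 k"
    using assms unfolding wedge_def mem_Collect_eq by linarith
qed


text \<open>\<phi> + h R is a small perturbation of a linear map of slope m, hence injective, so
  solutions correspond to the integers k that are hit. Up to O(1) many at the ends, these are the
  integers between \<phi> 0 / (2 pi h) and \<phi> r / (2 pi h).\<close>

lemma sector_count:
  fixes \<phi> R :: "complex \<Rightarrow> complex"
  assumes m: "0 < m" and C: "0 \<le> C" and h: "0 < h" and K: "0 < K" "64 * C \<le> K * m"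
    and \<phi>lin: "\<And>w w'. w \<in> ball 0 \<rho> \<Longrightarrow> w' \<in> ball 0 \<rho> \<Longrightarrow>
        norm (\<phi> w - \<phi> w' - m * (w - w')) \<le> m / 16 * norm (w - w')"
    and \<phi>real: "\<And>x::real. \<bar>x\<bar> < \<rho> \<Longrightarrow> \<phi> x \<in> \<real>"
    and Rhol: "R holomorphic_on wedge 1 (K * h) \<inter> ball 0 \<rho>"
    and Rb: "\<And>w. w \<in> wedge 1 (K * h) \<inter> ball 0 \<rho> \<Longrightarrow> norm (R w) \<le> C"
    and r: "0 < r" "r \<le> \<rho> / 2"
  defines "Z \<equiv> {w \<in> wedge (1/2) (2 * (K * h)) \<inter> ball 0 r. \<exists>k::int. \<phi> w / h + R w = of_real (2 * pi * k)}"
  shows "finite Z \<and> \<bar>card Z - Re (\<phi> r - \<phi> 0) / (2 * pi * h)\<bar> \<le> 4 * m * K + 13 * C + 2 * m + 2"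
proof -
  define V where "V = wedge (1/2) (2 * (K * h)) \<inter> ball 0 (\<rho> / 2)"
  define \<Psi> where "\<Psi> w = \<phi> w + h * R w" for w :: complex
  have rho: "0 < \<rho>" using r by simp
  have convV: "convex V" unfolding V_def by (intro convex_Int convex_wedge convex_ball)
  have Kh: "0 < K * h" using K h by simp
  have near: "cball w (Re w / 8) \<subseteq> wedge 1 (K * h) \<inter> ball 0 \<rho>" if "w \<in> V" for w
  proof
    fix z assume z: "z \<in> cball w (Re w / 8)"
    have "norm z \<le> norm w + norm (z - w)" using norm_triangle_ineq[of w "z - w"] by simp
    also have "\<dots> \<le> norm w + norm w / 8"
      using z abs_Re_le_cmod[of w] by (simp add: dist_norm norm_minus_commute)
    finally have "z \<in> ball 0 \<rho>" using that rho by (simp add: V_def)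
    thus "z \<in> wedge 1 (K * h) \<inter> ball 0 \<rho>"
      using cball_subset_wedge[of w "K * h"] z that Kh by (auto simp: V_def)
  qed
  have ReV: "2 * (K * h) < Re w" if "w \<in> V" for w using that by (simp add: V_def wedge_def)
  have V_sub: "V \<subseteq> wedge 1 (K * h) \<inter> ball 0 \<rho>"
  proof
    fix w assume w: "w \<in> V"
    hence "w \<in> cball w (Re w / 8)" using ReV[of w] Kh by simp
    thus "w \<in> wedge 1 (K * h) \<inter> ball 0 \<rho>" using near[OF w] by blast
  qed
  have RV: "norm (R w) \<le> C" if "w \<in> V" for w
    using Rb V_sub that by blast
  have openW: "open (wedge 1 (K * h) \<inter> ball 0 \<rho>)" by (intro open_Int open_wedge open_ball)
  \<comment> \<open>Cauchy's radius Re w / 8 exceeds K h / 4. With 64 C \<le> K m the resulting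
    bound makes \<open>h * R\<close> Lipschitz with constant m / 16, as small as the nonlinearity
    allowed for \<phi>.\<close>
  have Rder: "(R has_field_derivative deriv R w) (at w)" "norm (deriv R w) \<le> 4 * C / (K * h)"
    if w: "w \<in> V" for w
  proof -
    show "(R has_field_derivative deriv R w) (at w)"
      using holomorphic_derivI[OF Rhol openW] V_sub w by blast
    have pos: "0 < Re w / 8" using ReV[OF w] Kh by simp
    have "norm ((deriv ^^ 1) R w) \<le> fact 1 * C / (Re w / 8) ^ 1"
    proof (rule Cauchy_inequality)
      show "R holomorphic_on ball w (Re w / 8)"
        using near[OF w] ball_subset_cball by (blast intro: holomorphic_on_subset[OF Rhol])
      show "continuous_on (cball w (Re w / 8)) R"
        using near[OF w] by (blast intro: holomorphic_on_imp_continuous_on holomorphic_on_subset[OF Rhol])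
      show "norm (R x) \<le> C" if "norm (w - x) = Re w / 8" for x
        using that by (intro Rb subsetD[OF near[OF w]]) (simp add: dist_norm)
    qed (use pos in auto)
    also have "fact 1 * C / (Re w / 8) ^ 1 \<le> 4 * C / (K * h)"
      using ReV[OF w] Kh C by (simp add: field_simps mult_left_mono)
    finally show "norm (deriv R w) \<le> 4 * C / (K * h)" by simp
  qed
  have hRlip: "norm (h * R w - h * R w') \<le> m / 16 * norm (w - w')" if "w \<in> V" "w' \<in> V" for w w' :: complex
  proof -
    have "norm (R w - R w') \<le> 4 * C / (K * h) * norm (w - w')"
      by (rule field_differentiable_bound[OF convV, where f' = "deriv R"])
        (use Rder that in \<open>auto intro: has_field_derivative_at_within\<close>)
    hence "h * norm (R w - R w') \<le> h * (4 * C / (K * h) * norm (w - w'))"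
      using h by (intro mult_left_mono) auto
    also have "\<dots> = 4 * C / K * norm (w - w')" using h by simp
    also have "\<dots> \<le> m / 16 * norm (w - w')"
      using K by (intro mult_right_mono) (auto simp: field_simps)
    finally show ?thesis
      using h by (simp add: norm_mult flip: right_diff_distrib)
  qed
  have \<Psi>lin: "norm (\<Psi> w - \<Psi> w' - m * (w - w')) \<le> m / 8 * norm (w - w')" if "w \<in> V" "w' \<in> V" for w w' :: complex
  proof -
    have "norm (\<Psi> w - \<Psi> w' - m * (w - w')) \<le> norm (\<phi> w - \<phi> w' - m * (w - w')) + norm (h * R w - h * R w')"
      using norm_triangle_ineq[of "\<phi> w - \<phi> w' - m * (w - w')" "h * R w - h * R w'"]
      by (simp add: \<Psi>_def algebra_simps)
    also have "\<dots> \<le> m / 16 * norm (w - w') + m / 16 * norm (w - w')"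
      using V_sub that by (intro add_mono \<phi>lin hRlip) auto
    finally show ?thesis by simp
  qed
  have \<Psi>inj: "w = w'" if "w \<in> V" "w' \<in> V" "\<Psi> w = \<Psi> w'" for w w' :: complex
  proof (rule ccontr)
    assume "w \<noteq> w'"
    hence "m / 8 * norm (w - w') < m * norm (w - w')" using m by simp
    also have "\<dots> = norm (\<Psi> w - \<Psi> w' - m * (w - w'))"
      using that m by (simp add: norm_mult)
    finally show False using \<Psi>lin[OF that(1,2)] by simp
  qed
  define \<psi> where "\<psi> x = Re (\<phi> (of_real x))" for x :: real
  have \<psi>: "\<phi> (of_real x) = of_real (\<psi> x)" if "\<bar>x\<bar> < \<rho>" for x
    using \<phi>real[OF that] by (simp add: \<psi>_def)
  have \<psi>diff: "\<bar>\<psi> x - \<psi> y - m * (x - y)\<bar> \<le> m / 16 * \<bar>x - y\<bar>" if "\<bar>x\<bar> < \<rho>" "\<bar>y\<bar> < \<rho>" for x y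
  proof -
    have "norm (of_real (\<psi> x - \<psi> y - m * (x - y)) :: complex) \<le> m / 16 * norm (of_real (x - y) :: complex)"
      using \<phi>lin[of x y] that by (simp add: \<psi>)
    thus ?thesis unfolding norm_of_real .
  qed
  have \<psi>mono: "\<psi> x \<le> \<psi> y" if "x \<le> y" "\<bar>x\<bar> < \<rho>" "\<bar>y\<bar> < \<rho>" for x y
  proof -
    have "0 \<le> m * (y - x)" using m that by simp
    moreover have "\<bar>\<psi> y - \<psi> x - m * (y - x)\<bar> \<le> 1 / 16 * (m * (y - x))"
      using \<psi>diff[OF that(3,2)] that(1) by simp
    ultimately show ?thesis by linarith
  qed
  have Z_eq: "Z = {w \<in> V \<inter> ball 0 r. \<exists>k::int. \<Psi> w = of_real (2 * pi * h * k)}"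
  proof -
    have "\<phi> w / h + R w = of_real (2 * pi * k) \<longleftrightarrow> \<Psi> w = of_real (2 * pi * h * k)" for w :: complex and k :: int
      using h by (simp add: \<Psi>_def field_simps)
    thus ?thesis using r by (auto simp: Z_def V_def)
  qed
  define ix where "ix w = (THE k::int. \<Psi> w = of_real (2 * pi * h * k))" for w :: complex
  have ix_eq: "ix w = k" if "\<Psi> w = of_real (2 * pi * h * k)" for w :: complex and k :: int
    unfolding ix_def using that h by (intro the_equality) (auto simp: of_real_eq_iff)
  have ixZ: "\<Psi> w = of_real (2 * pi * h * ix w)" if "w \<in> Z" for w
    using that ix_eq by (auto simp: Z_eq)
  have inj: "inj_on ix Z"
  proof (rule inj_onI)
    fix u v assume uv: "u \<in> Z" "v \<in> Z" "ix u = ix v"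
    have "\<Psi> u = \<Psi> v" using ixZ[OF uv(1)] ixZ[OF uv(2)] uv(3) by simp
    moreover have "u \<in> V" "v \<in> V" using uv by (simp_all add: Z_eq)
    ultimately show "u = v" using \<Psi>inj by blast
  qed
  define \<alpha> where "\<alpha> = \<psi> 0 / (2 * pi * h)"
  define \<beta> where "\<beta> = \<psi> r / (2 * pi * h)"
  have r\<rho>: "r < \<rho>" using r by simp
  have \<alpha>\<beta>: "\<alpha> \<le> \<beta>" unfolding \<alpha>_def \<beta>_def using h \<psi>mono[of 0 r] r r\<rho> by (intro divide_right_mono) auto
  \<comment> \<open>\<Psi> is real at a solution w. Comparison with the real point x = Re w first
    bounds Im w by a multiple of h C / m, then puts 2 pi h k within 3 h C of \<psi> x, which moves k
    by at most C / 2.\<close>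
  have up: "\<alpha> - C / 2 \<le> k \<and> k \<le> \<beta> + C / 2" if "k \<in> ix ` Z" for k
  proof -
    from that obtain w where w: "w \<in> Z" "k = ix w" by blast
    have wV: "w \<in> V" "norm w < r" using w by (auto simp: Z_eq)
    define x where "x = Re w"
    define y where "y = Im w"
    have x: "0 < x" "x < r" using ReV[OF wV(1)] Kh abs_Re_le_cmod[of w] wV(2) by (auto simp: x_def)
    have xV: "of_real x \<in> V" using wV x r unfolding V_def wedge_def x_def by auto
    have wx: "w - of_real x = \<i> * of_real y" by (simp add: x_def y_def complex_eq_iff)
    have *: "norm (\<Psi> w - \<Psi> x - m * (\<i> * of_real y)) \<le> m / 8 * \<bar>y\<bar>"
      using \<Psi>lin[OF wV(1) xV] by (simp add: wx norm_mult)
    have hR: "norm (h * R x) \<le> h * C" using RV[OF xV] h by (simp add: norm_mult)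
    have \<Psi>x: "\<Psi> x = of_real (\<psi> x) + h * R x" using \<psi>[of x] x r\<rho> by (simp add: \<Psi>_def)
    have Psiw: "\<Psi> w = of_real (2 * pi * h * k)" using ixZ w by blast
    have imle: "\<bar>Im (\<Psi> w - \<Psi> x - m * (\<i> * of_real y))\<bar> \<le> m / 8 * \<bar>y\<bar>"
      using * abs_Im_le_cmod order_trans by blast
    have "\<bar>Im (h * R x) + m * y\<bar> \<le> m / 8 * \<bar>y\<bar>" 
    proof -
      have "Im (\<Psi> w - \<Psi> x - m * (\<i> * of_real y)) = - (Im (h * R x) + m * y)"
        by (simp add: \<Psi>x Psiw)
      thus ?thesis using imle by linarith
    qed
    moreover have "\<bar>Im (h * R x)\<bar> \<le> h * C" using hR abs_Im_le_cmod order_trans by blast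
    moreover have "\<bar>m * y\<bar> = m * \<bar>y\<bar>" using m by (simp add: abs_mult)
    ultimately have y: "m * \<bar>y\<bar> \<le> 8 / 7 * (h * C)" by linarith
    have rele: "\<bar>Re (\<Psi> w - \<Psi> x - m * (\<i> * of_real y))\<bar> \<le> m / 8 * \<bar>y\<bar>"
      using * abs_Re_le_cmod order_trans by blast
    have "\<bar>2 * pi * h * k - \<psi> x - Re (h * R x)\<bar> \<le> m / 8 * \<bar>y\<bar>"

    proof -
      have "Re (\<Psi> w - \<Psi> x - m * (\<i> * of_real y)) = 2 * pi * h * k - \<psi> x - Re (h * R x)"
        by (simp add: \<Psi>x Psiw)
      thus ?thesis using rele by linarith
    qed
    moreover have "\<bar>Re (h * R x)\<bar> \<le> h * C" using hR abs_Re_le_cmod order_trans by blast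
    ultimately have "\<bar>2 * pi * h * k - \<psi> x\<bar> \<le> 3 * (h * C)" using y mult_nonneg_nonneg[of h C] h C by linarith
    moreover have "3 * (h * C) \<le> pi * (h * C)" using h C pi_gt3 by (intro mult_right_mono) auto
    moreover have "\<psi> 0 \<le> \<psi> x" "\<psi> x \<le> \<psi> r" using x r\<rho> by (auto intro!: \<psi>mono)
    ultimately have "\<psi> 0 - pi * (h * C) \<le> 2 * pi * h * k" "2 * pi * h * k \<le> \<psi> r + pi * (h * C)"
      by linarith+
    thus ?thesis using h by (simp add: \<alpha>_def \<beta>_def field_simps)
  qed
  have fin: "finite Z" and upper: "card Z \<le> \<beta> - \<alpha> + C + 1"
  proof -
    have "finite (ix ` Z) \<and> card (ix ` Z) \<le> (\<beta> + C / 2) - (\<alpha> - C / 2) + 1"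
      by (rule card_int_interval_le[OF up]) (use \<alpha>\<beta> C in auto)
    thus "finite Z" "card Z \<le> \<beta> - \<alpha> + C + 1"
      using finite_imageD[OF _ inj] card_image[OF inj] by simp_all
  qed
  \<comment> \<open>In a disc of radius \<open>D\<close> the perturbation \<open>h * R\<close> can
    be compensated. \<open>L\<close> is made so that h L / (2 m) = 2 K h + 3 D + h: an integer that
    far from the ends has its real preimage x far enough inside for the whole disc to lie in the
    narrow sector and in the ball.\<close>
  define D where "D = 2 * (h * C) / m"
  define L where "L = 4 * m * K + 12 * C + 2 * m"
  have D: "0 \<le> D" using h C m by (simp add: D_def)
  have L: "0 < L" using m K C by (simp add: L_def add_pos_nonneg)
  have low: "k \<in> ix ` Z" if k: "\<alpha> + L / (2 * pi) \<le> k" "k \<le> \<beta> - L / (2 * pi)" for k :: int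
  proof -
    have k1: "\<psi> 0 + h * L \<le> 2 * pi * h * k" and k2: "2 * pi * h * k \<le> \<psi> r - h * L"
      using k h by (auto simp: \<alpha>_def \<beta>_def field_simps)
    have hL: "0 < h * L" using h L by simp
    have cont: "continuous_on {0..r} \<psi>"
    proof (rule continuous_on_subset[where s = "ball 0 \<rho>"])
      have "(2 * m)-lipschitz_on (ball 0 \<rho>) \<psi>"
      proof (rule lipschitz_onI)
        fix x y :: real assume "x \<in> ball 0 \<rho>" "y \<in> ball 0 \<rho>"
        hence "\<bar>\<psi> x - \<psi> y - m * (x - y)\<bar> \<le> 1 / 16 * (m * \<bar>x - y\<bar>)"
          using \<psi>diff[of x y] by simp
        moreover have "\<bar>m * (x - y)\<bar> = m * \<bar>x - y\<bar>" "0 \<le> m * \<bar>x - y\<bar>" using m by (simp_all add: abs_mult)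
        ultimately have "\<bar>\<psi> x - \<psi> y\<bar> \<le> 2 * (m * \<bar>x - y\<bar>)" by linarith
        thus "dist (\<psi> x) (\<psi> y) \<le> 2 * m * dist x y" by (simp add: dist_real_def)
      qed (use m in auto)
      thus "continuous_on (ball 0 \<rho>) \<psi>" by (rule lipschitz_on_continuous_on)
    qed (use r\<rho> in auto)
    obtain x where x: "0 \<le> x" "x \<le> r" "\<psi> x = 2 * pi * h * k"
      using IVT'[of \<psi> 0 "2 * pi * h * k" r] k1 k2 hL r cont by auto
    have lower: "h * L / (2 * m) < v - u" if "\<psi> u + h * L \<le> \<psi> v" "u \<le> v" "\<bar>u\<bar> < \<rho>" "\<bar>v\<bar> < \<rho>" for u v :: real
    proof -
      have "\<bar>\<psi> v - \<psi> u - m * (v - u)\<bar> \<le> 1 / 16 * (m * (v - u))"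
        using \<psi>diff[OF that(4,3)] that(2) by simp
      hence "h * L < 2 * (m * (v - u))" using that(1) hL by linarith
      thus ?thesis using m by (simp add: field_simps)
    qed
    have "h * L / (2 * m) = 2 * (K * h) + 3 * D + h" using m by (simp add: L_def D_def field_simps)
    hence x1: "2 * (K * h) + 3 * D + h < x" and x2: "3 * D + h < r - x"
      using lower[of 0 x] lower[of x r] x k1 k2 r\<rho> Kh by auto
    have sub: "cball (of_real x) D \<subseteq> V \<inter> ball 0 r"
    proof
      fix z :: complex assume "z \<in> cball (of_real x) D"
      hence z: "norm (z - of_real x) \<le> D" by (simp add: dist_norm norm_minus_commute)
      have "\<bar>Re z - x\<bar> \<le> D" "\<bar>Im z\<bar> \<le> D"
        using z abs_Re_le_cmod[of "z - of_real x"] abs_Im_le_cmod[of "z - of_real x"] by auto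
      moreover have "norm z \<le> x + D"
        using norm_triangle_ineq[of "of_real x" "z - of_real x"] z x(1) by simp
      ultimately show "z \<in> V \<inter> ball 0 r"
        using x1 x2 D Kh h r by (auto simp: V_def wedge_def abs_le_iff abs_less_iff)
    qed
    have xV: "of_real x \<in> V" using sub D by auto
    have "\<exists>w\<in>cball (of_real x) D. \<Psi> w = of_real (2 * pi * h * k)"
    proof (rule near_linear_surj[where q = "of_real m"])
      fix u v :: complex assume uv: "u \<in> cball (of_real x) D" "v \<in> cball (of_real x) D"
      have "norm (\<Psi> u - \<Psi> v - m * (u - v)) \<le> m / 8 * norm (u - v)" using uv sub by (intro \<Psi>lin) auto
      also have "\<dots> \<le> norm (of_real m :: complex) / 2 * norm (u - v)" using m by (intro mult_right_mono) auto
      finally show "norm (\<Psi> u - \<Psi> v - m * (u - v)) \<le> norm (of_real m :: complex) / 2 * norm (u - v)" .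
    next
      have "of_real (2 * pi * h * k) - \<Psi> x = - (h * R x)"
        using \<psi>[of x] x r\<rho> by (simp add: \<Psi>_def)
      hence "norm (of_real (2 * pi * h * k) - \<Psi> x) \<le> h * C"
        using RV[OF xV] h by (simp add: norm_mult)
      thus "norm (of_real (2 * pi * h * k) - \<Psi> x) \<le> norm (complex_of_real m) * D / 2"
        using m by (simp add: D_def)
    qed (use m D in auto)
    then obtain w where w: "w \<in> cball (of_real x) D" "\<Psi> w = of_real (2 * pi * h * k)" by blast
    hence "w \<in> Z" using sub unfolding Z_eq by blast
    thus ?thesis using ix_eq[OF w(2)] by blast
  qed
  have "(\<beta> - L / (2 * pi)) - (\<alpha> + L / (2 * pi)) - 1
      \<le> card {k::int. \<alpha> + L / (2 * pi) \<le> k \<and> k \<le> \<beta> - L / (2 * pi)}"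
    by (rule card_int_interval_ge)
  also have "\<dots> \<le> card (ix ` Z)" using fin low by (intro of_nat_mono card_mono) auto
  also have "\<dots> = card Z" using card_image[OF inj] by simp
  also have "(\<beta> - L / (2 * pi)) - (\<alpha> + L / (2 * pi)) - 1 = \<beta> - \<alpha> - L / pi - 1" by (simp add: field_simps)
  finally have "\<beta> - \<alpha> - L / pi - 1 \<le> card Z" .
  moreover have "L / pi \<le> L" using L pi_gt3 by (simp add: field_simps)
  moreover have "Re (\<phi> r - \<phi> 0) / (2 * pi * h) = \<beta> - \<alpha>"
    by (simp add: \<alpha>_def \<beta>_def \<psi>_def diff_divide_distrib)
  ultimately show ?thesis using fin upper C L by (simp add: L_def abs_le_iff)
qed

section \<open>Zeros of a sum of three exponentials\<close>

abbreviation \<omega> :: complex where "\<omega> \<equiv> cis (2 * pi / 3)"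
abbreviation \<omega>' :: complex where "\<omega>' \<equiv> cis (- 2 * pi / 3)"

lemma omega_eq: "\<omega> = Complex (-1/2) (sqrt 3 / 2)" "\<omega>' = Complex (-1/2) (- sqrt 3 / 2)"
  by (simp_all add: complex_eq_iff cos_120 sin_120)

lemma Re_Im_omega_mult:
  "Re (\<omega> * w) = - (Re w / 2) - sqrt 3 * Im w / 2" "Im (\<omega> * w) = sqrt 3 * Re w / 2 - Im w / 2"
  "Re (\<omega>' * w) = - (Re w / 2) + sqrt 3 * Im w / 2" "Im (\<omega>' * w) = - (sqrt 3 * Re w / 2) - Im w / 2"
  unfolding omega_eq by simp_all

lemma sqrt3_bounds: "43/25 < sqrt 3" "sqrt 3 < 87/50"
  by (rule real_less_rsqrt, simp add: power2_eq_square) (rule real_less_lsqrt; simp add: power2_eq_square)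

lemma cis_mult_left: "cis a * (cis b * w) = cis (a + b) * w"
  by (simp add: cis_mult flip: mult.assoc)

lemma wedge_omega_notin:
  assumes "w \<in> wedge (1/2) k" "0 \<le> k"
  shows "\<omega> * w \<notin> wedge (1/2) k" "\<omega>' * w \<notin> wedge (1/2) k"
proof -
  have w: "0 < Re w" "\<bar>Im w\<bar> < Re w / 2" using assms by (auto simp: wedge_def)
  have "\<bar>sqrt 3 * Im w\<bar> = sqrt 3 * \<bar>Im w\<bar>" by (simp add: abs_mult)
  also have "\<dots> \<le> 2 * \<bar>Im w\<bar>" using sqrt3_bounds by (intro mult_right_mono) auto
  finally have "\<bar>sqrt 3 * Im w\<bar> \<le> 2 * \<bar>Im w\<bar>" .
  hence "Re (\<omega> * w) < 0" "Re (\<omega>' * w) < 0" unfolding Re_Im_omega_mult using w by linarith+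
  thus "\<omega> * w \<notin> wedge (1/2) k" "\<omega>' * w \<notin> wedge (1/2) k"
    using assms(2) unfolding wedge_def by auto
qed

text \<open>A small imaginary part alone allows both half axes; the last assumption excludes the
  negative one.\<close>

lemma near_axis:
  assumes "norm w = l" "0 < l" "\<bar>Im w\<bar> \<le> l / 8" "- (l / 8) \<le> sqrt 3 * Re w / 2"
  shows "l / 2 < Re w" "\<bar>Im w\<bar> < 1/2 * Re w"
proof -
  have "(l / 8)\<^sup>2 = l\<^sup>2 / 64" "(l / 2)\<^sup>2 = l\<^sup>2 / 4" by (simp_all add: power_divide)
  have "(Re w)\<^sup>2 + (Im w)\<^sup>2 = l\<^sup>2" unfolding assms(1)[symmetric] by (rule cmod_power2[symmetric])
  moreover have "\<bar>Im w\<bar>\<^sup>2 \<le> (l / 8)\<^sup>2" using assms(3) by (intro power_mono) auto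
  moreover have "0 < l\<^sup>2" using \<open>0 < l\<close> by simp
  ultimately have "(l / 2)\<^sup>2 < (Re w)\<^sup>2" using \<open>(l / 8)\<^sup>2 = l\<^sup>2 / 64\<close> \<open>(l / 2)\<^sup>2 = l\<^sup>2 / 4\<close> power2_abs[of "Im w"] by linarith
  hence "l / 2 < \<bar>Re w\<bar>" using power2_less_imp_less[of "l / 2" "\<bar>Re w\<bar>"] by simp
  moreover have "\<not> Re w < - (l / 2)"
  proof
    assume "Re w < - (l / 2)"
    hence "sqrt 3 * Re w < sqrt 3 * (- (l / 2))" by (intro mult_strict_left_mono) auto
    moreover have "43/25 * l \<le> sqrt 3 * l" using sqrt3_bounds \<open>0 < l\<close> by (intro mult_right_mono) auto
    ultimately show False using assms(4) \<open>0 < l\<close> by simp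
  qed
  ultimately show "l / 2 < Re w" by linarith
  thus "\<bar>Im w\<bar> < 1/2 * Re w" using assms(3) by linarith
qed

lemma norm_Ln_1_plus_le: "norm (Ln (1 + g)) \<le> 1" if "norm g < 1/2"
  using norm_Ln_le[OF that] that by linarith

text \<open>To be used with \<open>F\<close> = \<open>phase\<close>, h = sqrt eps and
  \<open>b\<close> a logarithm of slowly varying factors. The tolerance m / 32 is half of what
  \<open>sector_count\<close> accepts, because the third ray adds two rotated copies of
  \<open>F\<close>. \<open>Freal\<close> and \<open>Fsym\<close> say that the leading phases are
  real along the rays.\<close>

locale three_exponentials =
  fixes F b :: "complex \<Rightarrow> complex" and m \<rho> C h :: real
  assumes m: "0 < m" and rho: "0 < \<rho>" and C: "0 \<le> C" and h: "0 < h"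
    and Flin: "\<And>w w' :: complex. w \<in> ball 0 \<rho> \<Longrightarrow> w' \<in> ball 0 \<rho> \<Longrightarrow>
        norm (F w - F w' + m * (w - w')) \<le> m / 32 * norm (w - w')"
    and Freal: "\<And>x::real. \<bar>x\<bar> < \<rho> \<Longrightarrow> F x \<in> \<real>"
    and Fsym: "\<And>x::real. \<bar>x\<bar> < \<rho> \<Longrightarrow> F (\<omega> * x) + F (\<omega>' * x) \<in> \<real>"
    and Fhol: "F holomorphic_on ball 0 \<rho>"
    and bhol: "b holomorphic_on ball 0 \<rho>"
    and bb: "\<And>w :: complex. w \<in> ball 0 \<rho> \<Longrightarrow> norm (b w) \<le> C"
begin

definition L :: "complex \<Rightarrow> complex" where "L w = - \<i> * F w / h + b w"

text \<open>The rotations send the directions from the node to the endpoints 1 and -1 to the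
  positive axis. To first order the three exponents have slopes 0, \<mu> cis (pi/3) and \<mu> cis (2
  pi/3) in \<zeta>.\<close>

definition H :: "complex \<Rightarrow> complex" where
  "H \<zeta> = 1 + exp (L (cis (- pi / 6) * \<zeta>)) + exp (- L (cis (- 5 * pi / 6) * \<zeta>))"

text \<open>On every ray the remainder passed to \<open>sector_count\<close> is at most 2 C + 5: 2 C
  from \<open>b\<close>, 1 from a logarithm, and 4 as a bound for pi. The factor 64 is the one
  required there.\<close>

definition K :: real where "K = 64 * (2 * C + 5) / m"

lemma K: "0 < K" "K * m = 64 * (2 * C + 5)"
  using m C by (auto simp: K_def)

lemma Lhol: "L holomorphic_on ball 0 \<rho>"
  unfolding L_def using h by (intro holomorphic_intros Fhol bhol) auto

definition \<mu> :: real where "\<mu> = m / h"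

lemma \<mu>_pos: "0 < \<mu>"
  using m h by (simp add: \<mu>_def)

text \<open>Since \<open>F 0\<close> is real, the real part of \<open>L\<close> has no constant term
  of order 1 / h; Im w alone decides which exponential dominates.\<close>

lemma Re_L:
  assumes "w \<in> ball 0 \<rho>"
  shows "\<bar>Re (L w) + \<mu> * Im w\<bar> \<le> \<mu> * (norm w / 32) + C"
proof -
  have "norm (F w - F 0 + m * w) \<le> m / 32 * norm w" using Flin[OF assms, of 0] rho by simp
  hence "\<bar>Im (F w - F 0 + m * w)\<bar> \<le> m / 32 * norm w" using abs_Im_le_cmod order_trans by blast
  moreover have "Im (F 0) = 0" using Freal[of 0] rho by (simp add: complex_is_Real_iff)
  ultimately have "\<bar>Im (F w) + m * Im w\<bar> \<le> m / 32 * norm w" by simp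
  hence "\<bar>Im (F w) + m * Im w\<bar> / h \<le> m / 32 * norm w / h" using h by (intro divide_right_mono) auto
  moreover have "Im (F w) / h + \<mu> * Im w = (Im (F w) + m * Im w) / h" by (simp add: \<mu>_def add_divide_distrib)
  ultimately have "\<bar>Im (F w) / h + \<mu> * Im w\<bar> \<le> \<mu> * (norm w / 32)"
    using h by (simp add: \<mu>_def abs_divide)
  moreover have "\<bar>Re (b w)\<bar> \<le> C" using bb[OF assms] abs_Re_le_cmod order_trans by blast
  moreover have "Re (L w) = Im (F w) / h + Re (b w)" by (simp add: L_def)
  ultimately show ?thesis by linarith
qed

lemma norm_exp_small:
  assumes "Re z \<le> -2"
  shows "norm (exp z) < 1/4"
proof -
  have "exp 2 \<ge> (1 + 2 + 2\<^sup>2 / 2 :: real)" using exp_lower_Taylor_quadratic[of 2] by simp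
  hence "inverse (exp (2::real)) \<le> inverse 5" by (intro le_imp_inverse_le) auto
  moreover have "norm (exp z) \<le> exp (-2)" using assms by simp
  ultimately show ?thesis by (simp add: exp_minus)
qed

text \<open>Rotation by \<omega> takes the wide sector into the upper half plane and rotation by
  \<omega>' into the lower one, with |Im| at least Re w / 4 + |w| / 32. The second part absorbs the
  nonlinearity of \<open>F\<close>; the first, with Re w > K h, beats \<open>C\<close>.\<close>

lemma third_small:
  assumes "w \<in> wedge 1 (K * h) \<inter> ball 0 \<rho>"
  shows "norm (exp (L (\<omega> * w))) < 1/4" "norm (exp (- L (\<omega>' * w))) < 1/4"
proof -
  have w: "K * h < Re w" "\<bar>Im w\<bar> < Re w" using assms by (auto simp: wedge_def)
  have pos: "0 < Re w" using w K h by (smt (verit) mult_pos_pos)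
  have nw: "norm w \<le> 2 * Re w" using cmod_le[of w] w pos by simp
  have q: "\<mu> * (1/4 * Re w) \<ge> 16 * (2 * C + 5)"
  proof -
    have "\<mu> * (1/4 * (K * h)) \<le> \<mu> * (1/4 * Re w)"
      using w \<mu>_pos by (intro mult_left_mono) auto
    moreover have "\<mu> * (1/4 * (K * h)) = 1/4 * (K * m)" using h by (simp add: \<mu>_def)
    ultimately show ?thesis unfolding K(2) by linarith
  qed
  have "43/25 * Re w \<le> sqrt 3 * Re w" using pos sqrt3_bounds by (intro mult_right_mono) auto
  hence s: "1/4 * Re w + norm w / 32 \<le> Im (\<omega> * w)" "Im (\<omega>' * w) \<le> - (1/4 * Re w + norm w / 32)"
    unfolding Re_Im_omega_mult using w nw pos by linarith+
  have mh: "0 \<le> \<mu>" using \<mu>_pos by simp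
  have "\<mu> * (1/4 * Re w + norm w / 32) \<le> \<mu> * Im (\<omega> * w)"
    "\<mu> * Im (\<omega>' * w) \<le> \<mu> * (- (1/4 * Re w + norm w / 32))"
    using mult_left_mono[OF s(1) mh] mult_left_mono[OF s(2) mh] by blast+
  hence t: "\<mu> * (1/4 * Re w) + \<mu> * (norm w / 32) \<le> \<mu> * Im (\<omega> * w)"
    "\<mu> * Im (\<omega>' * w) \<le> - (\<mu> * (1/4 * Re w) + \<mu> * (norm w / 32))"
    by (simp_all only: distrib_left mult_minus_right)
  have inb: "\<omega> * w \<in> ball 0 \<rho>" "\<omega>' * w \<in> ball 0 \<rho>" and nn: "norm (\<omega> * w) = norm w" "norm (\<omega>' * w) = norm w"
    using assms by (auto simp: norm_mult)
  have gen: "R \<le> -2" if "\<bar>R + I\<bar> \<le> n + C" "Q + n \<le> I" "16 * (2 * C + 5) \<le> Q" for R I n Q :: real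
    using that C by argo
  have gen': "- R \<le> -2" if "\<bar>R + I\<bar> \<le> n + C" "I \<le> - (Q + n)" "16 * (2 * C + 5) \<le> Q" for R I n Q :: real
    using that C by argo
  have A: "Re (L (\<omega> * w)) \<le> -2"
    by (rule gen[OF Re_L[OF inb(1), unfolded nn] t(1) q])
  have B: "Re (- L (\<omega>' * w)) \<le> -2"
    unfolding uminus_complex.sel by (rule gen'[OF Re_L[OF inb(2), unfolded nn] t(2) q])
  show "norm (exp (L (\<omega> * w))) < 1/4" "norm (exp (- L (\<omega>' * w))) < 1/4"
    by (rule norm_exp_small[OF A], rule norm_exp_small[OF B])
qed

text \<open>Writing -(1 + g) as exp (Ln (1 + g) + i pi) and comparing exponents modulo 2 pi i gives
  the form needed by \<open>sector_count\<close>, with remainder -i (\<beta> - Ln (1 + g)) -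
  pi.\<close>

lemma branch_count:
  assumes g: "g holomorphic_on wedge 1 (K * h) \<inter> ball 0 \<rho>" "\<And>w. w \<in> wedge 1 (K * h) \<inter> ball 0 \<rho> \<Longrightarrow> norm (g w) < 1/2"
    and \<beta>: "\<beta> holomorphic_on wedge 1 (K * h) \<inter> ball 0 \<rho>" "\<And>w. w \<in> wedge 1 (K * h) \<inter> ball 0 \<rho> \<Longrightarrow> norm (\<beta> w) \<le> 2 * C"
    and \<phi>lin: "\<And>w w' :: complex. w \<in> ball 0 \<rho> \<Longrightarrow> w' \<in> ball 0 \<rho> \<Longrightarrow>
        norm (\<phi> w - \<phi> w' - m * (w - w')) \<le> m / 16 * norm (w - w')"
    and \<phi>real: "\<And>x::real. \<bar>x\<bar> < \<rho> \<Longrightarrow> \<phi> x \<in> \<real>"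
    and P: "\<And>w. w \<in> wedge 1 (K * h) \<inter> ball 0 \<rho> \<Longrightarrow> P w \<longleftrightarrow> exp (\<i> * \<phi> w / h + \<beta> w) = - (1 + g w)"
    and r: "0 < r" "r \<le> \<rho> / 2"
  shows "finite {w \<in> wedge (1/2) (2 * (K * h)) \<inter> ball 0 r. P w} \<and>
    \<bar>card {w \<in> wedge (1/2) (2 * (K * h)) \<inter> ball 0 r. P w} - Re (\<phi> r - \<phi> 0) / (2 * pi * h)\<bar>
      \<le> 4 * m * K + 13 * (2 * C + 5) + 2 * m + 2"
proof -
  define R where "R w = - \<i> * (\<beta> w - Ln (1 + g w)) - pi" for w
  have g1: "1 + g w \<notin> \<real>\<^sub>\<le>\<^sub>0" "1 + g w \<noteq> 0" if "w \<in> wedge 1 (K * h) \<inter> ball 0 \<rho>" for w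
  proof -
    have "\<bar>Re (g w)\<bar> < 1/2" using g(2)[OF that] abs_Re_le_cmod[of "g w"] by linarith
    hence "0 < Re (1 + g w)" by (simp add: abs_less_iff)
    thus "1 + g w \<notin> \<real>\<^sub>\<le>\<^sub>0" by (simp add: complex_nonpos_Reals_iff)
    thus "1 + g w \<noteq> 0" by auto
  qed
  have sub: "w \<in> wedge 1 (K * h) \<inter> ball 0 \<rho>" if "w \<in> wedge (1/2) (2 * (K * h)) \<inter> ball 0 r" for w
  proof -
    have "0 < K * h" using K h by simp
    thus ?thesis using that r by (auto simp: wedge_def)
  qed
  have iff: "P w \<longleftrightarrow> (\<exists>k::int. \<phi> w / h + R w = of_real (2 * pi * k))"
    if w: "w \<in> wedge 1 (K * h) \<inter> ball 0 \<rho>" for w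
  proof -
    have "- (1 + g w) = exp (Ln (1 + g w) + \<i> * pi)" using g1[OF w] by (simp add: exp_add)
    hence "P w \<longleftrightarrow> (\<exists>k::int. \<i> * \<phi> w / h + \<beta> w = Ln (1 + g w) + \<i> * pi + of_real (2 * k * pi) * \<i>)"
      using P[OF w] exp_eq[of "\<i> * \<phi> w / h + \<beta> w" "Ln (1 + g w) + \<i> * pi"] by simp
    moreover have "\<i> * \<phi> w / h + \<beta> w = Ln (1 + g w) + \<i> * pi + of_real (2 * k * pi) * \<i>
        \<longleftrightarrow> \<phi> w / h + R w = of_real (2 * pi * k)" for k :: int
    proof -
      have "\<i> * \<phi> w / h + \<beta> w - (Ln (1 + g w) + \<i> * pi + of_real (2 * k * pi) * \<i>)
        = \<i> * (\<phi> w / h + R w - of_real (2 * pi * k))"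
        by (simp add: R_def algebra_simps)
      thus ?thesis by (metis complex_i_not_zero eq_iff_diff_eq_0 mult_eq_0_iff)
    qed
    ultimately show ?thesis by simp
  qed
  have eq: "{w \<in> wedge (1/2) (2 * (K * h)) \<inter> ball 0 r. P w} =
    {w \<in> wedge (1/2) (2 * (K * h)) \<inter> ball 0 r. \<exists>k::int. \<phi> w / h + R w = of_real (2 * pi * k)}"
    using iff sub by blast
  show ?thesis unfolding eq
  proof (rule sector_count[where C = "2 * C + 5", OF m _ h K(1) _ \<phi>lin \<phi>real _ _ r])
    show "R holomorphic_on wedge 1 (K * h) \<inter> ball 0 \<rho>"
      unfolding R_def using g1 by (intro holomorphic_intros g \<beta>) auto
    fix w assume w: "w \<in> wedge 1 (K * h) \<inter> ball 0 \<rho>"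
    have "norm (R w) \<le> norm (\<beta> w) + norm (Ln (1 + g w)) + pi"
      unfolding R_def
      by (rule order_trans[OF norm_triangle_ineq4]) (simp add: norm_mult norm_triangle_ineq4)
    thus "norm (R w) \<le> 2 * C + 5"
      using \<beta>(2)[OF w] norm_Ln_1_plus_le[OF g(2)[OF w]] pi_less_4 by linarith
  qed (use C K in auto)
qed


section \<open>Zeros along the three rays\<close>

lemma H_rotate:
  "H (cis (pi / 6) * w) = 1 + exp (L w) + exp (- L (\<omega>' * w))"
  "H (cis (5 * pi / 6) * w) = 1 + exp (L (\<omega> * w)) + exp (- L w)"
  "H (cis (- pi / 2) * w) = 1 + exp (L (\<omega>' * w)) + exp (- L (\<omega> * w))"
proof -
  have e: "- pi / 6 + pi / 6 = 0" "- 5 * pi / 6 + pi / 6 = - 2 * pi / 3"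
    "- pi / 6 + 5 * pi / 6 = 2 * pi / 3" "- 5 * pi / 6 + 5 * pi / 6 = 0"
    "- pi / 6 + - pi / 2 = - 2 * pi / 3" "- 5 * pi / 6 + - pi / 2 = 2 * pi / 3 - 2 * pi"
    by (simp_all add: field_simps)
  have "cis (2 * pi / 3 - 2 * pi) = \<omega>" by (simp only: cis_divide[symmetric] cis_2pi div_by_1)
  thus "H (cis (pi / 6) * w) = 1 + exp (L w) + exp (- L (\<omega>' * w))"
    "H (cis (5 * pi / 6) * w) = 1 + exp (L (\<omega> * w)) + exp (- L w)"
    "H (cis (- pi / 2) * w) = 1 + exp (L (\<omega>' * w)) + exp (- L (\<omega> * w))"
    unfolding H_def cis_mult_left e by simp_all
qed

lemma rot_hol:
  assumes "G holomorphic_on ball 0 \<rho>" "norm c = 1" "S \<subseteq> ball 0 \<rho>"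
  shows "(\<lambda>w. G (c * w)) holomorphic_on S"
proof -
  have "(G \<circ> (\<lambda>w. c * w)) holomorphic_on S"
    using assms(2,3) by (intro holomorphic_on_compose_gen[OF _ assms(1)] holomorphic_intros) (auto simp: norm_mult)
  thus ?thesis by (simp add: o_def)
qed

definition bound :: real where "bound = 4 * m * K + 13 * (2 * C + 5) + 2 * m + 2"

definition branch :: "real \<Rightarrow> real \<Rightarrow> complex set" where
  "branch r \<alpha> = {w \<in> wedge (1/2) (2 * (K * h)) \<inter> ball 0 r. H (cis \<alpha> * w) = 0}"

text \<open>On the ray towards the endpoint 1 the last exponential is the negligible one; it serves
  as \<open>g\<close>.\<close>

lemma branch_1:
  assumes r: "0 < r" "r \<le> \<rho> / 2"
  shows "finite (branch r (pi / 6)) \<and>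
    \<bar>card (branch r (pi / 6)) - Re (F 0 - F r) / (2 * pi * h)\<bar> \<le> bound"
proof -
  define g where "g w = exp (- L (\<omega>' * w))" for w
  have "finite (branch r (pi / 6)) \<and>
    \<bar>card (branch r (pi / 6)) - Re ((- F r) - (- F 0)) / (2 * pi * h)\<bar> \<le> bound"
    unfolding branch_def bound_def
  proof (rule branch_count[where g = g and \<beta> = b and \<phi> = "\<lambda>w. - F w"])
    show "g holomorphic_on wedge 1 (K * h) \<inter> ball 0 \<rho>"
      unfolding g_def by (intro holomorphic_intros rot_hol[OF Lhol]) auto
    show "norm (g w) < 1/2" if "w \<in> wedge 1 (K * h) \<inter> ball 0 \<rho>" for w
      using third_small(2)[OF that] by (simp only: g_def)
    show "b holomorphic_on wedge 1 (K * h) \<inter> ball 0 \<rho>" using holomorphic_on_subset[OF bhol] by blast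
    show "norm (b w) \<le> 2 * C" if "w \<in> wedge 1 (K * h) \<inter> ball 0 \<rho>" for w
      using bb[of w] that C by auto
    show "norm (- F w - - F w' - m * (w - w')) \<le> m / 16 * norm (w - w')"
      if "w \<in> ball 0 \<rho>" "w' \<in> ball 0 \<rho>" for w w' :: complex
    proof -
      have "- F w - - F w' - m * (w - w') = - (F w - F w' + m * (w - w'))" by simp
      hence "norm (- F w - - F w' - m * (w - w')) \<le> m / 32 * norm (w - w')"
        using Flin[OF that] by (simp only: norm_minus_cancel)
      also have "\<dots> \<le> m / 16 * norm (w - w')" using m by (intro mult_right_mono) auto
      finally show ?thesis .
    qed
    show "H (cis (pi / 6) * w) = 0 \<longleftrightarrow> exp (\<i> * - F w / h + b w) = - (1 + g w)" for w
    proof -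
      have "\<i> * - F w / h + b w = L w" by (simp add: L_def)
      moreover have "1 + u + v = 0 \<longleftrightarrow> u = - (1 + v)" for u v :: complex
        by (simp only: eq_neg_iff_add_eq_0 add_ac)
      ultimately show ?thesis unfolding H_rotate g_def by (simp only:)
    qed
  qed (use r Freal in auto)
  thus ?thesis by simp
qed

text \<open>On the ray towards -1 the first exponential e is negligible. Solving for exp L instead
  of exp (- L) keeps the slope of the phase positive, at the price of 1 + g = 1 / (1 + e).\<close>

lemma branch_2:
  assumes r: "0 < r" "r \<le> \<rho> / 2"
  shows "finite (branch r (5 * pi / 6)) \<and>
    \<bar>card (branch r (5 * pi / 6)) - Re (F 0 - F r) / (2 * pi * h)\<bar> \<le> bound"
proof -
  define e where "e w = exp (L (\<omega> * w))" for w
  define g where "g w = - e w / (1 + e w)" for w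
  have e: "norm (e w) < 1/4" "1 + e w \<noteq> 0" "3/4 \<le> norm (1 + e w)" if "w \<in> wedge 1 (K * h) \<inter> ball 0 \<rho>" for w
  proof -
    show *: "norm (e w) < 1/4" unfolding e_def by (rule third_small(1)[OF that])
    show "3/4 \<le> norm (1 + e w)" using norm_triangle_ineq2[of 1 "- e w"] * by simp
    thus "1 + e w \<noteq> 0" by auto
  qed
  have "finite (branch r (5 * pi / 6)) \<and>
    \<bar>card (branch r (5 * pi / 6)) - Re ((- F r) - (- F 0)) / (2 * pi * h)\<bar> \<le> bound"
    unfolding branch_def bound_def
  proof (rule branch_count[where g = g and \<beta> = b and \<phi> = "\<lambda>w. - F w"])
    have "e holomorphic_on wedge 1 (K * h) \<inter> ball 0 \<rho>"
      unfolding e_def by (intro holomorphic_intros rot_hol[OF Lhol]) auto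
    thus "g holomorphic_on wedge 1 (K * h) \<inter> ball 0 \<rho>"
      unfolding g_def using e(2) by (intro holomorphic_intros) auto
    show "norm (g w) < 1/2" if "w \<in> wedge 1 (K * h) \<inter> ball 0 \<rho>" for w
      using e[OF that] by (simp add: g_def norm_divide field_simps)
    show "b holomorphic_on wedge 1 (K * h) \<inter> ball 0 \<rho>" using holomorphic_on_subset[OF bhol] by blast
    show "norm (b w) \<le> 2 * C" if "w \<in> wedge 1 (K * h) \<inter> ball 0 \<rho>" for w
      using bb[of w] that C by auto
    show "norm (- F w - - F w' - m * (w - w')) \<le> m / 16 * norm (w - w')"
      if "w \<in> ball 0 \<rho>" "w' \<in> ball 0 \<rho>" for w w' :: complex
    proof -
      have "- F w - - F w' - m * (w - w') = - (F w - F w' + m * (w - w'))" by simp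
      hence "norm (- F w - - F w' - m * (w - w')) \<le> m / 32 * norm (w - w')"
        using Flin[OF that] by (simp only: norm_minus_cancel)
      also have "\<dots> \<le> m / 16 * norm (w - w')" using m by (intro mult_right_mono) auto
      finally show ?thesis .
    qed
    show "H (cis (5 * pi / 6) * w) = 0 \<longleftrightarrow> exp (\<i> * - F w / h + b w) = - (1 + g w)"
      if "w \<in> wedge 1 (K * h) \<inter> ball 0 \<rho>" for w
    proof -
      have "1 + g w = 1 / (1 + e w)" using e(2)[OF that] by (simp add: g_def field_simps)
      moreover have "\<i> * - F w / h + b w = - (- L w)" by (simp add: L_def)
      hence "exp (\<i> * - F w / h + b w) = 1 / exp (- L w)" by (simp only: exp_minus[of "- L w"] inverse_eq_divide)
      moreover have "H (cis (5 * pi / 6) * w) = 1 + e w + exp (- L w)" unfolding H_rotate e_def ..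
      moreover have "1 + u + v = 0 \<longleftrightarrow> 1 / v = - (1 / (1 + u))" if "1 + u \<noteq> 0" "v \<noteq> 0" for u v :: complex
      proof -
        have "1 / v + 1 / (1 + u) = (1 + u + v) / (v * (1 + u))" using that by (simp add: field_simps)
        thus ?thesis using that by (simp add: eq_neg_iff_add_eq_0)
      qed
      ultimately show ?thesis using e(2)[OF that] by simp
    qed
  qed (use r Freal in auto)
  thus ?thesis by simp
qed

text \<open>On the downward ray both exponentials are large and the term 1 is negligible.
  Multiplication by exp (- L (\<omega>' w)) makes it the small term and adds the two phases; their
  slope is - m (\<omega> + \<omega>') = m.\<close>

lemma branch_3:
  assumes r: "0 < r" "r \<le> \<rho> / 2"
  shows "finite (branch r (- pi / 2)) \<and>
    \<bar>card (branch r (- pi / 2)) - Re (F (\<omega> * r) + F (\<omega>' * r) - 2 * F 0) / (2 * pi * h)\<bar> \<le> bound"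
proof -
  define g where "g w = exp (- L (\<omega>' * w))" for w
  have "finite (branch r (- pi / 2)) \<and>
    \<bar>card (branch r (- pi / 2)) - Re ((F (\<omega> * r) + F (\<omega>' * r)) - (F (\<omega> * 0) + F (\<omega>' * 0))) / (2 * pi * h)\<bar> \<le> bound"
    unfolding branch_def bound_def
  proof (rule branch_count[where g = g and \<beta> = "\<lambda>w. - b (\<omega> * w) - b (\<omega>' * w)"
        and \<phi> = "\<lambda>w. F (\<omega> * w) + F (\<omega>' * w)"])
    show "g holomorphic_on wedge 1 (K * h) \<inter> ball 0 \<rho>"
      unfolding g_def by (intro holomorphic_intros rot_hol[OF Lhol]) auto
    show "norm (g w) < 1/2" if "w \<in> wedge 1 (K * h) \<inter> ball 0 \<rho>" for w
      using third_small(2)[OF that] by (simp only: g_def)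
    show "(\<lambda>w. - b (\<omega> * w) - b (\<omega>' * w)) holomorphic_on wedge 1 (K * h) \<inter> ball 0 \<rho>"
      by (intro holomorphic_intros rot_hol[OF bhol]) auto
    show "norm (- b (\<omega> * w) - b (\<omega>' * w)) \<le> 2 * C" if "w \<in> wedge 1 (K * h) \<inter> ball 0 \<rho>" for w
      using norm_triangle_ineq4[of "- b (\<omega> * w)" "b (\<omega>' * w)"] bb[of "\<omega> * w"] bb[of "\<omega>' * w"] that
      by (simp add: norm_mult del: cis_neq_zero)
    show "norm (F (\<omega> * w) + F (\<omega>' * w) - (F (\<omega> * w') + F (\<omega>' * w')) - m * (w - w')) \<le> m / 16 * norm (w - w')"
      if "w \<in> ball 0 \<rho>" "w' \<in> ball 0 \<rho>" for w w' :: complex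
    proof -
      have one: "- \<omega> - \<omega>' = 1" unfolding omega_eq by (simp add: complex_eq_iff)
      have gen: "A + B - (A' + B') - (- p - q) * (M * (w - w'))
          = (A - A' + M * (p * w - p * w')) + (B - B' + M * (q * w - q * w'))" for A B A' B' M p q :: complex
        by (simp add: algebra_simps)
      have "F (\<omega> * w) + F (\<omega>' * w) - (F (\<omega> * w') + F (\<omega>' * w')) - m * (w - w')
        = F (\<omega> * w) + F (\<omega>' * w) - (F (\<omega> * w') + F (\<omega>' * w')) - (- \<omega> - \<omega>') * (m * (w - w'))"
        unfolding one by simp
      also have "\<dots> = (F (\<omega> * w) - F (\<omega> * w') + m * (\<omega> * w - \<omega> * w')) + (F (\<omega>' * w) - F (\<omega>' * w') + m * (\<omega>' * w - \<omega>' * w'))"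
        by (rule gen)
      finally have eq: "F (\<omega> * w) + F (\<omega>' * w) - (F (\<omega> * w') + F (\<omega>' * w')) - m * (w - w')
        = (F (\<omega> * w) - F (\<omega> * w') + m * (\<omega> * w - \<omega> * w')) + (F (\<omega>' * w) - F (\<omega>' * w') + m * (\<omega>' * w - \<omega>' * w'))" .
      have "norm ((F (\<omega> * w) - F (\<omega> * w') + m * (\<omega> * w - \<omega> * w')) + (F (\<omega>' * w) - F (\<omega>' * w') + m * (\<omega>' * w - \<omega>' * w')))
          \<le> m / 32 * norm (\<omega> * w - \<omega> * w') + m / 32 * norm (\<omega>' * w - \<omega>' * w')"
        using that by (intro norm_triangle_mono Flin) (auto simp: norm_mult)
      also have "\<dots> = m / 16 * norm (w - w')"
      proof -
        have "norm (cis t * w - cis t * w') = norm (w - w')" for t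
          by (simp only: right_diff_distrib[symmetric] norm_mult norm_cis mult_1)
        thus ?thesis by (simp only:)
      qed
      finally show ?thesis unfolding eq .
    qed
    show "F (\<omega> * of_real x) + F (\<omega>' * of_real x) \<in> \<real>" if "\<bar>x\<bar> < \<rho>" for x by (rule Fsym[OF that])
    show "H (cis (- pi / 2) * w) = 0 \<longleftrightarrow>
        exp (\<i> * (F (\<omega> * w) + F (\<omega>' * w)) / h + (- b (\<omega> * w) - b (\<omega>' * w))) = - (1 + g w)" for w
    proof -
      have "\<i> * (F (\<omega> * w) + F (\<omega>' * w)) / h + (- b (\<omega> * w) - b (\<omega>' * w)) = - L (\<omega> * w) + - L (\<omega>' * w)"
        by (simp add: L_def add_divide_distrib algebra_simps del: cis_mult)
      hence "exp (\<i> * (F (\<omega> * w) + F (\<omega>' * w)) / h + (- b (\<omega> * w) - b (\<omega>' * w)))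
          = exp (- L (\<omega> * w)) * exp (- L (\<omega>' * w))"
        by (simp only: exp_add)
      moreover have "exp (L (\<omega>' * w)) = 1 / g w" by (simp add: g_def exp_minus field_simps)
      moreover have "1 + 1 / u + v = 0 \<longleftrightarrow> v * u = - (1 + u)" if "u \<noteq> 0" for u v :: complex
      proof -
        have "1 + 1 / u + v = (v * u + (1 + u)) / u" using that by (simp add: field_simps)
        thus ?thesis using that unfolding eq_neg_iff_add_eq_0 by simp
      qed
      moreover have "g w \<noteq> 0" by (simp add: g_def)
      ultimately show ?thesis unfolding H_rotate g_def by (simp only:)
    qed
  qed (use r in auto)
  thus ?thesis by simp
qed


text \<open>Three numbers with sum 0 have moduli satisfying the triangle inequalities, so the two
  largest of 1, A, B agree up to a factor 2. In logarithms this makes one of the coordinates y1, y2,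
  y3, whose sum is 0, small compared with l; the third term not being dominant fixes the sign along
  the axis.\<close>

lemma zero_location:
  assumes \<zeta>: "\<zeta> \<in> ball 0 \<rho>" "H \<zeta> = 0" "4 * (K * h) < norm \<zeta>"
  shows "cis (- pi / 6) * \<zeta> \<in> wedge (1/2) (2 * (K * h)) \<or> cis (- 5 * pi / 6) * \<zeta> \<in> wedge (1/2) (2 * (K * h))
    \<or> cis (pi / 2) * \<zeta> \<in> wedge (1/2) (2 * (K * h))"
proof -
  define w1 where "w1 = cis (- pi / 6) * \<zeta>"
  define w2 where "w2 = cis (- 5 * pi / 6) * \<zeta>"
  define w3 where "w3 = cis (pi / 2) * \<zeta>"
  define l where "l = norm \<zeta>"
  have ang: "- pi / 6 = 2 * pi / 3 + - 5 * pi / 6" "- 5 * pi / 6 = - 2 * pi / 3 + - pi / 6"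
    "pi / 2 = 2 * pi / 3 + - pi / 6" "- pi / 6 = - 2 * pi / 3 + pi / 2"
    by (simp_all add: field_simps)
  have rel: "w2 = \<omega>' * w1" "w1 = \<omega> * w2" "w3 = \<omega> * w1" "w1 = \<omega>' * w3"
    unfolding w1_def w2_def w3_def cis_mult_left by (simp_all only: ang[symmetric])
  have nw: "norm w1 = l" "norm w2 = l" "norm w3 = l" by (simp_all add: w1_def w2_def w3_def l_def norm_mult)
  have inb: "w1 \<in> ball 0 \<rho>" "w2 \<in> ball 0 \<rho>" using \<zeta>(1) nw by (simp_all add: l_def)
  have l0: "0 < l" and lK: "2 * (K * h) < l / 2" using \<zeta>(3) mult_pos_pos[OF K(1) h] unfolding l_def by linarith+
  define a where "a = Re (L w1)"
  define c where "c = - Re (L w2)"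
  define y1 where "y1 = Im w1"
  define y2 where "y2 = Im w2"
  define y3 where "y3 = Im w3"
  have y: "y2 = - (sqrt 3 * Re w1 / 2) - y1 / 2" "y1 = sqrt 3 * Re w2 / 2 - y2 / 2"
    "y1 = - (sqrt 3 * Re w3 / 2) - y3 / 2" "y3 = sqrt 3 * Re w1 / 2 - y1 / 2"
    unfolding y1_def y2_def y3_def using rel Re_Im_omega_mult by metis+
  have e1: "\<bar>a + \<mu> * y1\<bar> \<le> \<mu> * l / 32 + C" and e2: "\<bar>c - \<mu> * y2\<bar> \<le> \<mu> * l / 32 + C"
    using Re_L[OF inb(1)] Re_L[OF inb(2)] by (simp_all add: a_def c_def y1_def y2_def nw abs_minus_commute)
  \<comment> \<open>Beyond radius 4 K h the linear term \<mu> l dominates all errors of size C and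
    the logarithmic slack 1.\<close>
  have big: "2 * C + 2 \<le> \<mu> * l / 128"
  proof -
    have "\<mu> * (4 * (K * h)) \<le> \<mu> * l" using \<zeta>(3) \<mu>_pos by (intro mult_left_mono) (auto simp: l_def)
    moreover have "\<mu> * (4 * (K * h)) = 4 * (K * m)" using h by (simp add: \<mu>_def)
    moreover have "K * m = 128 * C + 320" using K(2) by simp
    ultimately show ?thesis using C by linarith
  qed
  have cancel: "y \<le> l / k" if "\<mu> * y \<le> \<mu> * l / k" for y k
    using that \<mu>_pos mult_le_cancel_left_pos[of \<mu> y "l / k"] by simp
  have cancel': "- (l / k) \<le> y" if "- (\<mu> * l / k) \<le> \<mu> * y" for y k
    using cancel[of "- y" k] that by simp
  define A where "A = exp a"
  define B where "B = exp c"
  have "exp (L w1) = - (1 + exp (- L w2))" "exp (- L w2) = - (1 + exp (L w1))" "1 = - (exp (L w1) + exp (- L w2))"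
  proof -
    have "1 + exp (L w1) + exp (- L w2) = 0" using \<zeta>(2) by (simp only: H_def w1_def w2_def)
    moreover have "u = - (1 + v) \<and> v = - (1 + u) \<and> 1 = - (u + v)" if "1 + u + v = 0" for u v :: complex
      using that by (simp only: eq_neg_iff_add_eq_0 add_ac simp_thms)
    ultimately show "exp (L w1) = - (1 + exp (- L w2))" "exp (- L w2) = - (1 + exp (L w1))"
      "1 = - (exp (L w1) + exp (- L w2))" by blast+
  qed
  hence "norm (exp (L w1)) \<le> 1 + norm (exp (- L w2))" "norm (exp (- L w2)) \<le> 1 + norm (exp (L w1))"
    "norm (1::complex) \<le> norm (exp (L w1)) + norm (exp (- L w2))"
    by (metis norm_minus_cancel norm_one norm_triangle_ineq)+
  hence tri: "A \<le> 1 + B" "B \<le> 1 + A" "1 \<le> A + B" by (simp_all add: A_def B_def a_def c_def)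
  have le1: "p \<le> q + 1" if "exp p \<le> 2 * exp q" for p q :: real
  proof -
    note that
    also have "2 * exp q \<le> exp 1 * exp q"
      using exp_ge_add_one_self[of "1::real"] by (intro mult_right_mono) auto
    finally show ?thesis by (simp flip: exp_add)
  qed
  \<comment> \<open>The cases say which of B, A, 1 is the smallest term.\<close>
  consider "c \<le> 0" "c \<le> a" | "a \<le> 0" "a \<le> c" | "0 \<le> a" "0 \<le> c" by linarith
  thus ?thesis
  proof cases
    case 1
    hence "B \<le> 1" "B \<le> A" by (simp_all add: A_def B_def)
    hence "a \<le> 1" "- 1 \<le> a" using tri le1[of a 0] le1[of 0 a] by (simp_all add: A_def)
    hence "- (\<mu> * l / 16) \<le> \<mu> * y1" "\<mu> * y1 \<le> \<mu> * l / 16" "\<mu> * y2 \<le> \<mu> * l / 16"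
      using e1 e2 big 1 C by argo+
    hence "- (l / 16) \<le> y1" "y1 \<le> l / 16" "y2 \<le> l / 16" using cancel cancel' by blast+
    hence "\<bar>y1\<bar> \<le> l / 8" "- (l / 8) \<le> sqrt 3 * Re w1 / 2" using y(1) l0 by linarith+
    note near_axis[OF nw(1) l0 this[unfolded y1_def]]
    thus ?thesis using lK by (simp add: wedge_def w1_def)
  next
    case 2
    hence "A \<le> 1" "A \<le> B" by (simp_all add: A_def B_def)
    hence "c \<le> 1" "- 1 \<le> c" using tri le1[of c 0] le1[of 0 c] by (simp_all add: B_def)
    hence "- (\<mu> * l / 16) \<le> \<mu> * y2" "\<mu> * y2 \<le> \<mu> * l / 16" "- (\<mu> * l / 16) \<le> \<mu> * y1"
      using e1 e2 big 2 C by argo+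
    hence "- (l / 16) \<le> y2" "y2 \<le> l / 16" "- (l / 16) \<le> y1" using cancel cancel' by blast+
    hence "\<bar>y2\<bar> \<le> l / 8" "- (l / 8) \<le> sqrt 3 * Re w2 / 2" using y(2) l0 by linarith+
    note near_axis[OF nw(2) l0 this[unfolded y2_def]]
    thus ?thesis using lK by (simp add: wedge_def w2_def)
  next
    case 3
    hence "1 \<le> A" "1 \<le> B" by (simp_all add: A_def B_def)
    hence "A \<le> 2 * B" "B \<le> 2 * A" using tri by linarith+
    hence "a \<le> c + 1" "c \<le> a + 1" unfolding A_def B_def using le1 by blast+
    hence "- (\<mu> * l / 8) \<le> \<mu> * (y1 + y2)" "\<mu> * (y1 + y2) \<le> \<mu> * l / 8" "\<mu> * y1 \<le> \<mu> * l / 16"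
      unfolding distrib_left using e1 e2 big 3 C by argo+
    hence "- (l / 8) \<le> y1 + y2" "y1 + y2 \<le> l / 8" "y1 \<le> l / 16" using cancel cancel' by blast+
    moreover have "y3 = - (y1 + y2)" using y by linarith
    ultimately have "\<bar>y3\<bar> \<le> l / 8" "- (l / 8) \<le> sqrt 3 * Re w3 / 2" using y(3) l0 by linarith+
    note near_axis[OF nw(3) l0 this[unfolded y3_def]]
    thus ?thesis using lK by (simp add: wedge_def w3_def)
  qed
qed

section \<open>Zeros close to the node and the total count\<close>

definition core_bound :: real where "core_bound = 4 * exp (48 * (K * m) + C) + 2"

text \<open>The radius 4 K h scales with h, so on the circle five times as large the exponents are
  bounded in terms of K m and \<open>C\<close> only, independently of h. Twice that bound on
  \<open>H\<close> appears because the lower bound at the test point is 1/2.\<close>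

lemma core_zeros:
  assumes S: "S \<subseteq> {\<zeta> \<in> cball 0 (4 * (K * h)). H \<zeta> = 0}" and small: "24 * (K * h) < \<rho>"
  shows "finite S \<and> card S \<le> core_bound"
proof -
  define R where "R = 4 * (K * h)"
  have R: "0 < R" "6 * R < \<rho>" using K h small by (auto simp: R_def)
  have \<mu>R: "\<mu> * R = 4 * (K * m)" using h by (simp add: \<mu>_def R_def)
  have bd: "norm (H z) \<le> core_bound / 2" if z: "norm z = 5 * R" for z
  proof -
    have 1: "\<bar>Re (L w)\<bar> \<le> 48 * (K * m) + C" if w: "norm w = 5 * R" for w
    proof -
      have "\<mu> * \<bar>Im w\<bar> \<le> \<mu> * (5 * R)" using abs_Im_le_cmod[of w] w \<mu>_pos by (intro mult_left_mono) auto
      moreover have "\<mu> * (5 * R) = 20 * (K * m)" unfolding mult.left_commute[of \<mu> 5] \<mu>R by simp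
      moreover have "\<bar>\<mu> * Im w\<bar> = \<mu> * \<bar>Im w\<bar>" using \<mu>_pos by (simp add: abs_mult)
      ultimately have "\<bar>\<mu> * Im w\<bar> \<le> 20 * (K * m)" by linarith
      moreover have "\<bar>Re (L w) + \<mu> * Im w\<bar> \<le> \<mu> * (5 * R / 32) + C" using Re_L[of w] w R by simp
      moreover have "\<mu> * (5 * R / 32) = 20 / 32 * (K * m)" unfolding times_divide_eq_right mult.left_commute[of \<mu> 5] \<mu>R by simp
      moreover have "0 < K * m" using K(1) m by (rule mult_pos_pos)
      ultimately show ?thesis by linarith
    qed
    have "norm (H z) \<le> 1 + norm (exp (L (cis (- pi / 6) * z))) + norm (exp (- L (cis (- 5 * pi / 6) * z)))"
      unfolding H_def by (intro order_trans[OF norm_triangle_ineq] add_mono) auto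
    also have "\<dots> \<le> 1 + exp (48 * (K * m) + C) + exp (48 * (K * m) + C)"
      using 1[of "cis (- pi / 6) * z"] 1[of "cis (- 5 * pi / 6) * z"] z
      by (intro add_mono) (auto simp: norm_mult)
    finally show ?thesis by (simp add: core_bound_def)
  qed
  \<comment> \<open>The upward direction lies midway between the rays at pi/6 and 5 pi/6, where the
    term 1 dominates both exponentials.\<close>
  define w where "w = \<i> * of_real R"
  have low: "1 / 2 \<le> norm (H w)"
  proof -
    have i: "w = cis (pi / 2) * of_real R" by (simp add: w_def)
    have ang: "- pi / 6 + pi / 2 = pi / 3" "- 5 * pi / 6 + pi / 2 = - (pi / 3)" by (simp_all add: field_simps)
    have "43 / 25 * (\<mu> * R) \<le> sqrt 3 * (\<mu> * R)" using sqrt3_bounds \<mu>_pos R by (intro mult_right_mono) auto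
    moreover have "320 + 2 * C \<le> \<mu> * R" using \<mu>R K(2) C by simp
    ultimately have "\<mu> * R / 32 + C + 2 \<le> sqrt 3 * (\<mu> * R) / 2" using C by linarith
    moreover have "\<mu> * (R / 32) = \<mu> * R / 32" "\<mu> * (sqrt 3 / 2 * R) = sqrt 3 * (\<mu> * R) / 2" by (simp_all add: field_simps)
    ultimately have s: "\<mu> * (R / 32) + C + 2 \<le> \<mu> * (sqrt 3 / 2 * R)" by linarith
    have gen: "a \<le> -2" if "\<bar>a + x\<bar> \<le> y + C" "y + C + 2 \<le> x" for a x y :: real using that by linarith
    have "\<bar>Re (L (cis (pi / 3) * R)) + \<mu> * (sqrt 3 / 2 * R)\<bar> \<le> \<mu> * (R / 32) + C"
      using Re_L[of "cis (pi / 3) * R"] R by (simp add: norm_mult sin_60)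
    hence 1: "Re (L (cis (pi / 3) * R)) \<le> -2" using s by (rule gen)
    have "\<bar>Re (- L (cis (- (pi / 3)) * R)) + \<mu> * (sqrt 3 / 2 * R)\<bar> \<le> \<mu> * (R / 32) + C"
      using Re_L[of "cis (- (pi / 3)) * R"] R by (simp add: norm_mult sin_60 abs_minus_commute)
    hence 2: "Re (- L (cis (- (pi / 3)) * R)) \<le> -2" using s by (rule gen)
    have "H w = 1 + exp (L (cis (pi / 3) * R)) + exp (- L (cis (- (pi / 3)) * R))"
      unfolding H_def i cis_mult_left ang ..
    moreover have "norm (1 + u + v) \<ge> 1 - norm u - norm v" for u v :: complex
      using norm_diff_ineq[of 1 u] norm_diff_ineq[of "1 + u" v] norm_one[where 'a = complex] by linarith
    ultimately have "norm (H w) \<ge> 1 - norm (exp (L (cis (pi / 3) * R))) - norm (exp (- L (cis (- (pi / 3)) * R)))"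
      by metis
    thus ?thesis using norm_exp_small[OF 1] norm_exp_small[OF 2] by linarith
  qed
  have hol: "H holomorphic_on ball 0 (6 * R)"
    unfolding H_def using R by (intro holomorphic_intros rot_hol[OF Lhol]) auto
  have "card T \<le> core_bound" if "finite T" "T \<subseteq> S" for T
  proof -
    have "1 / 2 * 2 ^ card T \<le> core_bound / 2"
      using that S by (intro zeros_card_bound[OF that(1) _ hol R(1) bd _ low]) (use R(1) in \<open>auto simp: R_def[symmetric] w_def norm_mult\<close>)
    hence "2 ^ card T \<le> core_bound" by simp
    moreover have "real (card T) \<le> 2 ^ card T" using of_nat_less_two_power[of "card T", where ?'a = real] by linarith
    ultimately show ?thesis by linarith
  qed
  note * = this
  have "finite S \<and> card S \<le> nat \<lceil>core_bound\<rceil>"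
  proof (rule finite_if_finite_subsets_card_bdd)
    fix T assume "T \<subseteq> S" "finite T"
    hence "real (card T) \<le> core_bound" using * by blast
    thus "card T \<le> nat \<lceil>core_bound\<rceil>" using real_nat_ceiling_ge[of core_bound] by linarith
  qed
  hence "finite S" by blast
  thus ?thesis using * by blast
qed

text \<open>Rotating the narrow sector by 120 degrees takes it off itself, so the sets on the three
  rays are disjoint. What they leave over lies in the core, by \<open>zero_location\<close>.\<close>

lemma zero_count:
  assumes small: "24 * (K * h) < \<rho>" and r: "0 < r" "r \<le> \<rho> / 2"
  shows "finite {\<zeta> \<in> ball 0 r. H \<zeta> = 0} \<and>
    \<bar>card {\<zeta> \<in> ball 0 r. H \<zeta> = 0} - Re (F (\<omega> * r) + F (\<omega>' * r) - 2 * F r) / (2 * pi * h)\<bar>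
      \<le> 3 * bound + core_bound"
proof -
  define Z where "Z = {\<zeta> \<in> ball 0 r. H \<zeta> = 0}"
  define B where "B \<alpha> = (\<lambda>w. cis \<alpha> * w) ` branch r \<alpha>" for \<alpha>
  define S where "S = Z - (B (pi / 6) \<union> B (5 * pi / 6) \<union> B (- pi / 2))"
  have Kh: "0 \<le> 2 * (K * h)" using K h by simp
  have cardB: "card (B \<alpha>) = card (branch r \<alpha>)" for \<alpha>
    unfolding B_def by (intro card_image inj_onI) simp
  have finB: "finite (B \<alpha>)" if "finite (branch r \<alpha>)" for \<alpha>
    using that by (simp add: B_def)
  have BZ: "B \<alpha> \<subseteq> Z" for \<alpha> by (auto simp: B_def branch_def Z_def norm_mult)
  have B_iff: "\<zeta> \<in> B \<alpha> \<longleftrightarrow> \<zeta> \<in> Z \<and> cis (- \<alpha>) * \<zeta> \<in> wedge (1/2) (2 * (K * h))" for \<zeta> \<alpha>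
  proof
    assume "\<zeta> \<in> B \<alpha>"
    thus "\<zeta> \<in> Z \<and> cis (- \<alpha>) * \<zeta> \<in> wedge (1/2) (2 * (K * h))"
      using BZ by (auto simp: B_def branch_def cis_mult_left)
  next
    assume "\<zeta> \<in> Z \<and> cis (- \<alpha>) * \<zeta> \<in> wedge (1/2) (2 * (K * h))"
    hence "cis (- \<alpha>) * \<zeta> \<in> branch r \<alpha>" by (simp add: branch_def Z_def norm_mult cis_mult_left)
    hence "cis \<alpha> * (cis (- \<alpha>) * \<zeta>) \<in> B \<alpha>" unfolding B_def by (rule imageI)
    thus "\<zeta> \<in> B \<alpha>" by (simp add: cis_mult_left)
  qed
  have disj: "B (pi / 6) \<inter> B (5 * pi / 6) = {}" "B (pi / 6) \<inter> B (- pi / 2) = {}" "B (5 * pi / 6) \<inter> B (- pi / 2) = {}"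
  proof -
    have no: "B \<alpha> \<inter> B \<beta> = {}" if "- \<beta> = 2 * pi / 3 + - \<alpha>" for \<alpha> \<beta>
    proof -
      have "cis (- \<beta>) * \<zeta> = \<omega> * (cis (- \<alpha>) * \<zeta>)" for \<zeta> unfolding cis_mult_left that ..
      note eqn = this
      have "\<zeta> \<notin> B \<beta>" if "\<zeta> \<in> B \<alpha>" for \<zeta>
        using that wedge_omega_notin(1)[OF _ Kh, of "cis (- \<alpha>) * \<zeta>"] unfolding B_iff eqn by blast
      thus ?thesis by blast
    qed
    have no': "B \<alpha> \<inter> B \<beta> = {}" if "- \<beta> = 4 * pi / 3 + - \<alpha>" for \<alpha> \<beta>
    proof -
      have "4 * pi / 3 = 2 * pi + - 2 * pi / 3" by simp
      hence "cis (4 * pi / 3) = \<omega>'" by (simp only: cis_mult[symmetric] cis_2pi mult_1)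
      hence eqn: "cis (- \<beta>) * \<zeta> = \<omega>' * (cis (- \<alpha>) * \<zeta>)" for \<zeta>
        unfolding that cis_mult[symmetric] by (simp only: mult.assoc)
      have "\<zeta> \<notin> B \<beta>" if "\<zeta> \<in> B \<alpha>" for \<zeta>
        using that wedge_omega_notin(2)[OF _ Kh, of "cis (- \<alpha>) * \<zeta>"] unfolding B_iff eqn by blast
      thus ?thesis by blast
    qed
    have "B (5 * pi / 6) \<inter> B (pi / 6) = {}" by (rule no) (simp add: field_simps)
    thus "B (pi / 6) \<inter> B (5 * pi / 6) = {}" by blast
    show "B (pi / 6) \<inter> B (- pi / 2) = {}" by (rule no) (simp add: field_simps)
    show "B (5 * pi / 6) \<inter> B (- pi / 2) = {}" by (rule no') (simp add: field_simps)
  qed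
  have "S \<subseteq> {\<zeta> \<in> cball 0 (4 * (K * h)). H \<zeta> = 0}"
  proof
    fix \<zeta> assume \<zeta>: "\<zeta> \<in> S"
    have in\<rho>: "\<zeta> \<in> ball 0 \<rho>" and H0: "H \<zeta> = 0" using \<zeta> r by (auto simp: S_def Z_def)
    have "\<not> 4 * (K * h) < norm \<zeta>"
    proof
      assume "4 * (K * h) < norm \<zeta>"
      from zero_location[OF in\<rho> H0 this] show False
        using \<zeta> B_iff[of \<zeta> "pi / 6"] B_iff[of \<zeta> "5 * pi / 6"] B_iff[of \<zeta> "- pi / 2"] by (auto simp: S_def)
    qed
    thus "\<zeta> \<in> {\<zeta> \<in> cball 0 (4 * (K * h)). H \<zeta> = 0}" using H0 by simp
  qed
  hence S: "finite S" "card S \<le> core_bound" using core_zeros[OF _ small] by blast+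
  note b = branch_1[OF r] branch_2[OF r] branch_3[OF r]
  have fin: "finite (B (pi / 6))" "finite (B (5 * pi / 6))" "finite (B (- pi / 2))" using b finB by blast+
  have Zdec: "Z = S \<union> (B (pi / 6) \<union> (B (5 * pi / 6) \<union> B (- pi / 2)))" using BZ by (auto simp: S_def)
  hence finZ: "finite Z" using S fin by simp
  have "card Z = card S + (card (B (pi / 6)) + (card (B (5 * pi / 6)) + card (B (- pi / 2))))"
  proof -
    have "card Z = card S + card (B (pi / 6) \<union> (B (5 * pi / 6) \<union> B (- pi / 2)))"
      unfolding Zdec using S fin by (intro card_Un_disjoint) (auto simp: S_def)
    also have "card (B (pi / 6) \<union> (B (5 * pi / 6) \<union> B (- pi / 2))) = card (B (pi / 6)) + card (B (5 * pi / 6) \<union> B (- pi / 2))"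
      using fin disj by (intro card_Un_disjoint) auto
    also have "card (B (5 * pi / 6) \<union> B (- pi / 2)) = card (B (5 * pi / 6)) + card (B (- pi / 2))"
      using fin disj by (intro card_Un_disjoint) auto
    finally show ?thesis .
  qed
  hence cardZ: "real (card Z) = card S + card (branch r (pi / 6)) + card (branch r (5 * pi / 6)) + card (branch r (- pi / 2))"
    by (simp add: cardB)
  have gen: "\<bar>z - d\<bar> \<le> 3 * k + c" if "d = q1 + q2 + q3" "\<bar>n1 - q1\<bar> \<le> k" "\<bar>n2 - q2\<bar> \<le> k" "\<bar>n3 - q3\<bar> \<le> k"
    "s \<le> c" "0 \<le> s" "z = s + n1 + n2 + n3" for z d k c q1 q2 q3 n1 n2 n3 s :: real
    using that by linarith
  \<comment> \<open>The contributions of \<open>F 0\<close> from the three rays cancel.\<close>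
  have "Re (F (\<omega> * r) + F (\<omega>' * r) - 2 * F r) / (2 * pi * h) =
      Re (F 0 - F r) / (2 * pi * h) + Re (F 0 - F r) / (2 * pi * h) + Re (F (\<omega> * r) + F (\<omega>' * r) - 2 * F 0) / (2 * pi * h)"
    unfolding add_divide_distrib[symmetric] by simp
  hence "\<bar>card Z - Re (F (\<omega> * r) + F (\<omega>' * r) - 2 * F r) / (2 * pi * h)\<bar> \<le> 3 * bound + core_bound"
    using b S(2) cardZ[unfolded of_nat_add] gen[OF _ _ _ _ _ of_nat_0_le_iff] by blast
  thus ?thesis using finZ by (simp add: Z_def)
qed

end

section \<open>Entire solutions of Airy's equation\<close>

text \<open>Taylor coefficients at 0 of the solution of y'' = z y with y 0 = p and y' 0 = q.\<close>

fun airy_coeff :: "complex \<Rightarrow> complex \<Rightarrow> nat \<Rightarrow> complex" where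
  "airy_coeff p q 0 = p"
| "airy_coeff p q (Suc 0) = q"
| "airy_coeff p q (Suc (Suc 0)) = 0"
| "airy_coeff p q (Suc (Suc (Suc n))) = airy_coeff p q n / (of_nat (n + 3) * of_nat (n + 2))"

definition airy :: "complex \<Rightarrow> complex \<Rightarrow> complex \<Rightarrow> complex" where
  "airy p q z = (\<Sum>n. airy_coeff p q n * z ^ n)"

definition airy' :: "complex \<Rightarrow> complex \<Rightarrow> complex \<Rightarrow> complex" where
  "airy' p q z = (\<Sum>n. diffs (airy_coeff p q) n * z ^ n)"

text \<open>With the weight S^n the coefficients are nonincreasing along steps of three beyond N,
  hence bounded. As S is at least 2 |z|, the series is dominated by a geometric one of ratio
  1/2.\<close>

lemma summable_airy: "summable (\<lambda>n. airy_coeff p q n * z ^ n)"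
proof -
  define S where "S = 2 * (norm z + 1)"
  define x where "x n = norm (airy_coeff p q n) * S ^ n" for n
  obtain N :: nat where N: "S ^ 3 \<le> N" using real_arch_simple by blast
  have S: "0 < S" by (simp add: S_def add_nonneg_pos)
  have step: "x (Suc (Suc (Suc n))) \<le> x n" if "N \<le> n" for n
  proof -
    have "S ^ 3 \<le> (real n + 3) * 1" using N that by simp
    also have "\<dots> \<le> (real n + 3) * (real n + 2)" by (intro mult_mono) auto
    finally have le: "S ^ 3 \<le> (real n + 3) * (real n + 2)" .
    have "norm (of_nat (n + 3) * of_nat (n + 2) :: complex) = (real n + 3) * (real n + 2)"
      unfolding norm_mult norm_of_nat by simp
    hence "x (Suc (Suc (Suc n))) = x n * (S ^ 3 / ((real n + 3) * (real n + 2)))"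
      by (simp add: x_def norm_divide power3_eq_cube)
    also have "\<dots> \<le> x n * 1" using le S by (intro mult_left_mono) (auto simp: x_def)
    finally show ?thesis by simp
  qed
  define M where "M = sum x {..<N + 3}"
  have bd: "x n \<le> M" for n
  proof (induction n rule: less_induct)
    case (less n)
    show ?case
    proof (cases "n < N + 3")
      case True
      thus ?thesis unfolding M_def using S by (intro member_le_sum) (auto simp: x_def)
    next
      case False
      define k where "k = n - 3"
      have k: "n = Suc (Suc (Suc k))" "N \<le> k" using False by (simp_all add: k_def)
      thus ?thesis using step[OF k(2)] less.IH[of k] by simp
    qed
  qed
  show ?thesis
  proof (rule summable_comparison_test')
    show "summable (\<lambda>n. M * (1 / 2) ^ n)" by (intro summable_mult summable_geometric) simp
    fix n :: nat
    have "norm z \<le> S / 2" by (simp add: S_def)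
    hence "norm z ^ n \<le> (S / 2) ^ n" by (intro power_mono) auto
    hence "norm (airy_coeff p q n * z ^ n) \<le> norm (airy_coeff p q n) * (S / 2) ^ n"
      by (simp add: norm_mult norm_power mult_left_mono)
    also have "\<dots> = x n * (1 / 2) ^ n" by (simp add: x_def power_divide)
    also have "\<dots> \<le> M * (1 / 2) ^ n" by (intro mult_right_mono bd) auto
    finally show "norm (airy_coeff p q n * z ^ n) \<le> M * (1 / 2) ^ n" .
  qed
qed

lemma airy_has_derivative: "(airy p q has_field_derivative airy' p q z) (at z)"
  unfolding airy_def[abs_def] airy'_def
  by (rule termdiffs_strong_converges_everywhere) (rule summable_airy)

lemma airy'_has_derivative: "(airy' p q has_field_derivative z * airy p q z) (at z)"
proof -
  have sm: "summable (\<lambda>n. diffs (airy_coeff p q) n * y ^ n)" for y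
    by (rule termdiff_converges_all) (rule summable_airy)
  have sm2: "summable (\<lambda>n. diffs (diffs (airy_coeff p q)) n * y ^ n)" for y
    by (rule termdiff_converges_all) (rule sm)
  have "(airy' p q has_field_derivative (\<Sum>n. diffs (diffs (airy_coeff p q)) n * z ^ n)) (at z)"
    unfolding airy'_def[abs_def] by (rule termdiffs_strong_converges_everywhere) (rule sm)
  moreover have "diffs (diffs (airy_coeff p q)) (Suc n) = airy_coeff p q n" for n
  proof -
    have "of_nat (n + 3) \<noteq> (0::complex)" "of_nat (n + 2) \<noteq> (0::complex)"
      unfolding of_nat_eq_0_iff by simp_all
    moreover have "diffs (diffs (airy_coeff p q)) (Suc n) = of_nat (n + 2) * (of_nat (n + 3) * airy_coeff p q (Suc (Suc (Suc n))))"
      by (simp add: diffs_def numeral_3_eq_3)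
    ultimately show ?thesis by (simp del: of_nat_add)
  qed
  hence "(\<Sum>n. diffs (diffs (airy_coeff p q)) n * z ^ n) = z * airy p q z"
    using suminf_split_head[OF sm2[of z]] suminf_mult[OF summable_airy[of p q z], of z]
    by (simp add: airy_def diffs_def mult.left_commute)
  ultimately show ?thesis by simp
qed

lemma airy_0: "airy p q 0 = p" "airy' p q 0 = q"
  by (simp_all add: airy_def airy'_def powser_zero diffs_def)

lemma airy_linear: "airy p q z = p * airy 1 0 z + q * airy 0 1 z"
proof -
  have "airy_coeff p q n = p * airy_coeff 1 0 n + q * airy_coeff 0 1 n" for n
    by (induction p q n rule: airy_coeff.induct) (simp_all add: add_divide_distrib del: of_nat_add)
  thus ?thesis
    unfolding airy_def
    by (simp add: distrib_right mult.assoc suminf_add[symmetric] suminf_mult[symmetric] summable_airy summable_mult)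
qed

text \<open>The recurrence has step three and the class n = 2 mod 3 vanishes, so the factor w^n acts
  only on the coefficients that come from \<open>q\<close>, as multiplication by w.\<close>

lemma airy_rotate:
  assumes "w ^ 3 = 1"
  shows "airy p q (w * z) = airy p (w * q) z"
proof -
  have "airy_coeff p q n * w ^ n = airy_coeff p (w * q) n" for n
  proof (induction p q n rule: airy_coeff.induct)
    case (4 p q n)
    have "w ^ Suc (Suc (Suc n)) = w ^ n * w ^ 3" by (simp add: power3_eq_cube)
    thus ?case using 4 assms by (simp del: of_nat_add power_Suc)
  qed simp_all
  thus ?thesis unfolding airy_def by (simp add: power_mult_distrib mult.assoc[symmetric])
qed

lemma airy_wronskian: "airy 1 0 z * airy' 0 1 z - airy' 1 0 z * airy 0 1 z = 1"
proof -
  define W where "W z = airy 1 0 z * airy' 0 1 z - airy' 1 0 z * airy 0 1 z" for z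
  have "(W has_field_derivative 0) (at z)" for z
    unfolding W_def
    by (rule derivative_eq_intros airy_has_derivative airy'_has_derivative refl)+ (simp add: algebra_simps)
  hence "\<exists>c. \<forall>z\<in>UNIV. W z = c" by (intro has_field_derivative_zero_constant) auto
  hence "W z = W 0" by (metis UNIV_I)
  thus ?thesis by (simp add: W_def airy_0)
qed

text \<open>After rotation each of the two coordinates of the solution is multiplied by a sum of the
  three cube roots of unity.\<close>

lemma airy_connection:
  fixes w :: complex
  assumes "1 + w + w\<^sup>2 = 0"
  shows "airy p q z + w * airy p q (w * z) + w\<^sup>2 * airy p q (w\<^sup>2 * z) = 0"
proof -
  have w3: "w ^ 3 = 1"
  proof -
    have "w ^ 3 - 1 = (w - 1) * (1 + w + w\<^sup>2)" by (simp add: algebra_simps power2_eq_square power3_eq_cube)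
    thus ?thesis using assms by simp
  qed
  have w4: "w\<^sup>2 * w\<^sup>2 = w" using w3 by (simp add: power2_eq_square power3_eq_cube mult.assoc)
  have w6: "(w\<^sup>2) ^ 3 = 1" using w3 by (metis mult.commute power_mult power_one)
  have "airy p q z + w * airy p q (w * z) + w\<^sup>2 * airy p q (w\<^sup>2 * z)
    = p * (1 + w + w\<^sup>2) * airy 1 0 z + q * (1 + w\<^sup>2 + w\<^sup>2 * w\<^sup>2) * airy 0 1 z"
    unfolding airy_rotate[OF w3] airy_rotate[OF w6] airy_linear[of p] airy_linear[of p "w * q"] airy_linear[of p "w\<^sup>2 * q"]
    by (simp add: algebra_simps power2_eq_square)
  also have "1 + w\<^sup>2 + w\<^sup>2 * w\<^sup>2 = 1 + w + w\<^sup>2" unfolding w4 by simp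
  finally show ?thesis unfolding assms by simp
qed

section \<open>Gaussian moments with a bounded weight\<close>

lemma power_exp_bound:
  fixes c y :: real
  assumes "0 < c" "0 \<le> y"
  shows "y ^ n * exp (- c * y) \<le> fact n / c ^ n"
proof -
  have "(c * y) ^ n / fact n \<le> exp (c * y)"
  proof -
    have "(\<Sum>k\<in>{n}. inverse (fact k) * (c * y) ^ k) \<le> (\<Sum>k. inverse (fact k) * (c * y) ^ k)"
      using assms summable_exp[of "c * y"] by (intro sum_le_suminf) auto
    thus ?thesis by (simp add: exp_def divide_inverse mult.commute scaleR_conv_of_real)
  qed
  thus ?thesis using assms by (simp add: exp_minus field_simps power_mult_distrib)
qed

text \<open>In the Airy integral of exp (i (t^3/3 + z t)) put z = s^2 and move the line of
  integration to Im t = s, through the saddle point i s (for real s > 0). The exponent becomes -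
  (2/3) s^3 - s t^2 + i t^3/3, so the integral is exp (- (2/3) s^3) times the moment with k = 0 and
  weight \<open>cubic_phase\<close>. The weight 1 gives the Gaussian for comparison.\<close>

definition moment :: "(real \<Rightarrow> complex) \<Rightarrow> nat \<Rightarrow> complex \<Rightarrow> complex" where
  "moment u k s = (LBINT t. of_real t ^ k * exp (- s * of_real t ^ 2) * u t)"

definition gauss_const :: "real \<Rightarrow> nat \<Rightarrow> real" where
  "gauss_const c k = fact (Suc k) / c ^ Suc k * exp c"

lemma abs_le_one_plus_square: "\<bar>t\<bar> \<le> 1 + t ^ 2" for t :: real
proof -
  have "0 \<le> (\<bar>t\<bar> - 1)\<^sup>2" by simp
  hence "2 * \<bar>t\<bar> \<le> 1 + t\<^sup>2" by (simp add: power2_diff)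
  thus ?thesis by simp
qed

text \<open>\<open>power_exp_bound\<close> at y = 1 + t^2 with exponent k + 1: one power supplies
  the integrable factor, the others dominate |t|^k. The factor exp c in \<open>gauss_const\<close>
  undoes the shift by 1.\<close>

lemma gauss_bound:
  fixes c t :: real
  assumes "0 < c"
  shows "\<bar>t\<bar> ^ k * exp (- c * t ^ 2) \<le> gauss_const c k * inverse (1 + t ^ 2)"
proof -
  have "\<bar>t\<bar> ^ k \<le> (1 + t ^ 2) ^ k" by (intro power_mono abs_le_one_plus_square) auto
  hence "\<bar>t\<bar> ^ k * (1 + t ^ 2) \<le> (1 + t ^ 2) ^ Suc k"
    unfolding power_Suc2 by (rule mult_right_mono) simp
  hence "\<bar>t\<bar> ^ k * (1 + t ^ 2) * exp (- c * (1 + t\<^sup>2)) \<le> (1 + t ^ 2) ^ Suc k * exp (- c * (1 + t\<^sup>2))"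
    by (intro mult_right_mono) auto
  also have "\<dots> \<le> fact (Suc k) / c ^ Suc k" by (rule power_exp_bound[OF assms]) simp
  finally have "\<bar>t\<bar> ^ k * (1 + t ^ 2) * exp (- c * (1 + t\<^sup>2)) * exp c \<le> gauss_const c k"
    unfolding gauss_const_def by (intro mult_right_mono) auto
  moreover have "exp (- c * (1 + t\<^sup>2)) * exp c = exp (- c * t\<^sup>2)" by (simp add: algebra_simps flip: exp_add)
  ultimately have "\<bar>t\<bar> ^ k * (1 + t ^ 2) * exp (- c * t\<^sup>2) \<le> gauss_const c k" by (simp only: mult.assoc)
  moreover have "0 < 1 + t ^ 2" by (simp add: add_pos_nonneg)
  ultimately show ?thesis by (simp add: field_simps)
qed

lemma integrable_inverse_square: "integrable lborel (\<lambda>t::real. inverse (1 + t ^ 2))"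
  using integrable_inverse_1_plus_square by (simp add: set_integrable_def)

lemma integrable_gauss:
  fixes c :: real
  assumes "0 < c"
  shows "integrable lborel (\<lambda>t. \<bar>t\<bar> ^ k * exp (- c * t ^ 2))"
proof (rule Bochner_Integration.integrable_bound)
  show "integrable lborel (\<lambda>t. gauss_const c k * inverse (1 + t ^ 2))"
    using integrable_inverse_square by simp
  show "AE t in lborel. norm (\<bar>t\<bar> ^ k * exp (- c * t ^ 2)) \<le> norm (gauss_const c k * inverse (1 + t ^ 2))"
  proof (rule AE_I2)
    fix t :: real
    have "norm (\<bar>t\<bar> ^ k * exp (- c * t ^ 2)) = \<bar>t\<bar> ^ k * exp (- c * t ^ 2)" by (simp add: abs_mult)
    thus "norm (\<bar>t\<bar> ^ k * exp (- c * t ^ 2)) \<le> norm (gauss_const c k * inverse (1 + t ^ 2))"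
      using gauss_bound[OF assms, of t k] abs_ge_self[of "gauss_const c k * inverse (1 + t ^ 2)"]
      unfolding real_norm_def by linarith
  qed
qed simp

locale bounded_weight =
  fixes u :: "real \<Rightarrow> complex"
  assumes u_meas [measurable]: "u \<in> borel_measurable borel" and u_bound: "\<And>t. norm (u t) \<le> 1"
begin

lemma norm_moment_integrand:
  "norm (of_real t ^ k * exp (- s * of_real t ^ 2) * u t) \<le> \<bar>t\<bar> ^ k * exp (- Re s * t ^ 2)"
proof -
  have "norm (of_real t ^ k * exp (- s * of_real t ^ 2) * u t) = \<bar>t\<bar> ^ k * exp (- Re s * t ^ 2) * norm (u t)"
    by (simp add: norm_mult norm_power power_abs flip: of_real_power)
  also have "\<dots> \<le> \<bar>t\<bar> ^ k * exp (- Re s * t ^ 2) * 1" by (intro mult_left_mono u_bound) auto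
  finally show ?thesis by simp
qed

lemma integrable_moment:
  assumes "0 < Re s"
  shows "integrable lborel (\<lambda>t. of_real t ^ k * exp (- s * of_real t ^ 2) * u t)"
proof (rule Bochner_Integration.integrable_bound[OF integrable_gauss[OF assms, of k]])
  show "AE t in lborel. norm (of_real t ^ k * exp (- s * of_real t ^ 2) * u t) \<le> norm (\<bar>t\<bar> ^ k * exp (- Re s * t ^ 2))"
    using norm_moment_integrand by (intro AE_I2) (auto simp: abs_mult)
qed simp

text \<open>The error of the difference quotient is the integral of a second order Taylor remainder
  of exp (- h t^2), divided by h. For |h| < Re s / 2 this remainder uses up at most half of the
  Gaussian decay, so the error is at most |h| times a fixed convergent integral.\<close>

lemma moment_has_derivative:
  assumes s: "0 < Re s"
  shows "(moment u k has_field_derivative - moment u (k + 2) s) (at s)"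
proof -
  define c where "c = Re s / 2"
  define Q where "Q = (LBINT t. \<bar>t\<bar> ^ (k + 4) * exp (- c * t ^ 2))"
  have c: "0 < c" using s by (simp add: c_def)
  have bd: "norm ((moment u k (s + h) - moment u k s) / h - - moment u (k + 2) s) \<le> norm h * Q"
    if h: "h \<noteq> 0" "norm h < c" for h
  proof -
    have Re: "0 < Re (s + h)" using h c abs_Re_le_cmod[of h] by (simp add: c_def abs_le_iff)
    define g where "g t = of_real t ^ k * exp (- (s + h) * of_real t ^ 2) * u t - of_real t ^ k * exp (- s * of_real t ^ 2) * u t
        + h * (of_real t ^ (k + 2) * exp (- s * of_real t ^ 2) * u t)" for t
    note i = integrable_moment[OF Re, of k] integrable_moment[OF s, of k]
      integrable_mult_right[OF integrable_moment[OF s, of "k + 2"], of h]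
    have int_g: "integrable lborel g" unfolding g_def
      by (rule Bochner_Integration.integrable_add[OF Bochner_Integration.integrable_diff[OF i(1,2)] i(3)])
    have eq: "integral\<^sup>L lborel g = moment u k (s + h) - moment u k s + h * moment u (k + 2) s"
      unfolding g_def moment_def
        Bochner_Integration.integral_add[OF Bochner_Integration.integrable_diff[OF i(1,2)] i(3)]
        Bochner_Integration.integral_diff[OF i(1,2)] integral_mult_right_zero ..
    have gb: "norm (g t) \<le> (norm h)\<^sup>2 * (\<bar>t\<bar> ^ (k + 4) * exp (- c * t ^ 2))" for t
    proof -
      define x where "x = - h * of_real t ^ 2"
      have "norm (exp x - (\<Sum>i\<le>1. x ^ i / fact i)) \<le> exp \<bar>Re x\<bar> * norm x ^ Suc 1 / fact 1" by (rule Taylor_exp)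
      hence e: "norm (exp x - 1 - x) \<le> exp \<bar>Re x\<bar> * (norm x)\<^sup>2" by (simp add: algebra_simps power2_eq_square)
      have "g t = of_real t ^ k * exp (- s * of_real t ^ 2) * u t * (exp x - 1 - x)"
        by (simp add: g_def x_def algebra_simps power_add flip: exp_add) (simp add: power2_eq_square)
      also have "norm \<dots> \<le> (\<bar>t\<bar> ^ k * exp (- Re s * t ^ 2)) * (exp \<bar>Re x\<bar> * (norm x)\<^sup>2)"
        unfolding norm_mult[of _ "exp x - 1 - x"] by (intro mult_mono norm_moment_integrand e) auto
      also have "norm x = norm h * t\<^sup>2" by (simp add: x_def norm_mult norm_power)
      finally have A: "norm (g t) \<le> \<bar>t\<bar> ^ k * exp (- Re s * t ^ 2) * (exp \<bar>Re x\<bar> * (norm h * t\<^sup>2)\<^sup>2)" .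
      have "\<bar>Re x\<bar> \<le> c * t\<^sup>2"
      proof -
        have "\<bar>Re x\<bar> \<le> norm h * t\<^sup>2" using abs_Re_le_cmod[of x] by (simp add: x_def norm_mult norm_power)
        also have "\<dots> \<le> c * t\<^sup>2" using h by (intro mult_right_mono) auto
        finally show ?thesis .
      qed
      hence "\<bar>t\<bar> ^ k * exp (- Re s * t ^ 2) * (exp \<bar>Re x\<bar> * (norm h * t\<^sup>2)\<^sup>2)
          \<le> \<bar>t\<bar> ^ k * exp (- Re s * t ^ 2) * (exp (c * t\<^sup>2) * (norm h * t\<^sup>2)\<^sup>2)"
        by (intro mult_left_mono mult_right_mono) auto
      also have "\<dots> = (norm h)\<^sup>2 * (\<bar>t\<bar> ^ (k + 4) * (exp (- Re s * t ^ 2) * exp (c * t\<^sup>2)))"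
      proof -
        have "(norm h * t\<^sup>2)\<^sup>2 = (norm h)\<^sup>2 * \<bar>t\<bar> ^ 4"
          by (simp add: power_mult_distrib power4_eq_xxxx power2_eq_square)
        thus ?thesis by (simp add: power_add algebra_simps)
      qed
      also have "exp (- Re s * t ^ 2) * exp (c * t\<^sup>2) = exp (- c * t ^ 2)"
        by (simp add: c_def flip: exp_add)
      finally have "\<bar>t\<bar> ^ k * exp (- Re s * t ^ 2) * (exp \<bar>Re x\<bar> * (norm h * t\<^sup>2)\<^sup>2)
          \<le> (norm h)\<^sup>2 * (\<bar>t\<bar> ^ (k + 4) * exp (- c * t ^ 2))" .
      thus ?thesis using A by (rule order_trans[rotated])
    qed
    have "norm (integral\<^sup>L lborel g) \<le> (LBINT t. (norm h)\<^sup>2 * (\<bar>t\<bar> ^ (k + 4) * exp (- c * t ^ 2)))"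
      by (rule Bochner_Integration.integral_norm_bound_integral[OF int_g _ gb])
        (use integrable_gauss[OF c, of "k + 4"] in simp)
    also have "\<dots> = (norm h)\<^sup>2 * Q" by (simp add: Q_def)
    finally have "norm (integral\<^sup>L lborel g) \<le> (norm h)\<^sup>2 * Q" .
    moreover have "(moment u k (s + h) - moment u k s) / h - - moment u (k + 2) s = integral\<^sup>L lborel g / h"
      using h by (simp add: eq field_simps)
    ultimately have "norm ((moment u k (s + h) - moment u k s) / h - - moment u (k + 2) s) \<le> (norm h)\<^sup>2 * Q / norm h"
      by (simp add: norm_divide divide_right_mono)
    also have "\<dots> = norm h * Q" using h by (simp add: power2_eq_square)
    finally show ?thesis .
  qed
  show ?thesis unfolding DERIV_def
  proof (rule LIM_zero_cancel, rule Lim_null_comparison)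
    show "\<forall>\<^sub>F h in at 0. norm ((moment u k (s + h) - moment u k s) / h - - moment u (k + 2) s) \<le> norm h * Q"
      using bd c unfolding eventually_at by (auto simp: dist_norm intro!: exI[of _ c])
    show "((\<lambda>h. norm h * Q) \<longlongrightarrow> 0) (at 0)" by (auto intro!: tendsto_eq_intros)
  qed
qed

lemma moment_tendsto:
  assumes "0 < Re s"
  shows "((\<lambda>t. of_real t ^ k * exp (- s * of_real t ^ 2) * u t) \<longlongrightarrow> 0) at_top"
    "((\<lambda>t. of_real t ^ k * exp (- s * of_real t ^ 2) * u t) \<longlongrightarrow> 0) at_bot"
proof -
  have bd: "norm (of_real t ^ k * exp (- s * of_real t ^ 2) * u t) \<le> gauss_const (Re s) k * inverse (1 + t ^ 2)" for t
    by (rule order_trans[OF norm_moment_integrand gauss_bound[OF assms]])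
  have "((\<lambda>t::real. inverse (1 + t ^ 2)) \<longlongrightarrow> 0) at_top" "((\<lambda>t::real. inverse (1 + t ^ 2)) \<longlongrightarrow> 0) at_bot"
    by real_asymp+
  hence "((\<lambda>t::real. gauss_const (Re s) k * inverse (1 + t ^ 2)) \<longlongrightarrow> 0) at_top"
    "((\<lambda>t::real. gauss_const (Re s) k * inverse (1 + t ^ 2)) \<longlongrightarrow> 0) at_bot"
    by (auto intro: tendsto_mult_right_zero)
  note lim = this
  show "((\<lambda>t. of_real t ^ k * exp (- s * of_real t ^ 2) * u t) \<longlongrightarrow> 0) at_top"
    "((\<lambda>t. of_real t ^ k * exp (- s * of_real t ^ 2) * u t) \<longlongrightarrow> 0) at_bot"
    by (rule Lim_null_comparison[OF always_eventually[OF allI[OF bd]] lim(1)],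
        rule Lim_null_comparison[OF always_eventually[OF allI[OF bd]] lim(2)])
qed

end

lemma integral_derivative_zero:
  fixes G g :: "real \<Rightarrow> complex"
  assumes "\<And>t. (G has_vector_derivative g t) (at t)" "\<And>t. isCont g t" "integrable lborel g"
    "(G \<longlongrightarrow> 0) at_top" "(G \<longlongrightarrow> 0) at_bot"
  shows "integral\<^sup>L lborel g = 0"
proof -
  have "(LBINT t=-\<infinity>..\<infinity>. g t) = 0 - 0"
    by (rule interval_integral_FTC_integrable[where F = G])
      (use assms in \<open>auto simp: ereal_tendsto_simps set_integrable_def\<close>)
  thus ?thesis by (simp add: interval_lebesgue_integral_def set_lebesgue_integral_def)
qed

section \<open>The recessive solution\<close>

definition cubic_phase :: "real \<Rightarrow> complex" where
  "cubic_phase t = exp (\<i> * of_real t ^ 3 / 3)"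

lemma bounded_weight_cubic_phase: "bounded_weight cubic_phase"
proof
  show "cubic_phase \<in> borel_measurable borel" unfolding cubic_phase_def by simp
  show "norm (cubic_phase t) \<le> 1" for t by (simp add: cubic_phase_def flip: of_real_power)
qed

lemma bounded_weight_one: "bounded_weight (\<lambda>_. 1)"
  by unfold_locales auto

interpretation cubic: bounded_weight cubic_phase by (rule bounded_weight_cubic_phase)
interpretation const: bounded_weight "\<lambda>_. 1" by (rule bounded_weight_one)

text \<open>Integrates the total derivative of \<open>P(t) exp (-s t\<^sup>2 + i t\<^sup>3/3)\<close> with \<open>P(t) = -i t\<^sup>2 - 2 s t - i/s\<close>.\<close>
lemma moment_cubic_recurrence:
  assumes s: "0 < Re s"
  shows "moment cubic_phase 4 s + (4 * s\<^sup>2 + 1 / s) * moment cubic_phase 2 s = 2 * s * moment cubic_phase 0 s"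
proof -
  have s0: "s \<noteq> 0" using s by auto
  define m where "m k t = of_real t ^ k * exp (- s * of_real t ^ 2) * cubic_phase t" for k t
  define G where "G t = - \<i> * m 2 t - 2 * s * m 1 t - \<i> / s * m 0 t" for t
  define g where "g t = m 4 t + (4 * s\<^sup>2 + 1 / s) * m 2 t - 2 * s * m 0 t" for t
  have int: "integrable lborel (m k)" for k unfolding m_def by (rule cubic.integrable_moment[OF s])
  have mom: "integral\<^sup>L lborel (m k) = moment cubic_phase k s" for k by (simp add: m_def[abs_def] moment_def)
  have "integral\<^sup>L lborel g = 0"
  proof (rule integral_derivative_zero)
    show "(G has_vector_derivative g t) (at t)" for t
    proof -
      have "((\<lambda>z. (- \<i> * z\<^sup>2 - 2 * s * z - \<i> / s) * exp (- s * z\<^sup>2 + \<i> / 3 * z ^ 3)) has_field_derivative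
          (z ^ 4 + (4 * s\<^sup>2 + 1 / s) * z\<^sup>2 - 2 * s) * exp (- s * z\<^sup>2 + \<i> / 3 * z ^ 3)) (at z)" for z
        by (rule derivative_eq_intros refl)+ (use s0 in \<open>simp add: field_simps power2_eq_square power3_eq_cube power4_eq_xxxx\<close>)
      note der = has_vector_derivative_real_field[OF this, of t UNIV]
      have ex: "exp (- s * (of_real x)\<^sup>2 + \<i> / 3 * of_real x ^ 3) = exp (- s * (of_real x)\<^sup>2) * cubic_phase x" for x
        unfolding cubic_phase_def exp_add[symmetric] by simp
      have "(\<lambda>x. (- \<i> * (of_real x)\<^sup>2 - 2 * s * of_real x - \<i> / s) * exp (- s * (of_real x)\<^sup>2 + \<i> / 3 * of_real x ^ 3)) = G"
        unfolding ex by (rule ext) (simp add: G_def m_def algebra_simps)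
      moreover have "(of_real t ^ 4 + (4 * s\<^sup>2 + 1 / s) * (of_real t)\<^sup>2 - 2 * s) * exp (- s * (of_real t)\<^sup>2 + \<i> / 3 * of_real t ^ 3) = g t"
        unfolding ex by (simp add: g_def m_def algebra_simps)
      ultimately show ?thesis using der by (simp only:)
    qed
    show "isCont g t" for t unfolding g_def m_def cubic_phase_def by (intro continuous_intros) auto
    show "integrable lborel g" unfolding g_def using int by simp
    have "(m k \<longlongrightarrow> 0) at_top" "(m k \<longlongrightarrow> 0) at_bot" for k
      unfolding m_def by (rule cubic.moment_tendsto[OF s])+
    thus "(G \<longlongrightarrow> 0) at_top" "(G \<longlongrightarrow> 0) at_bot"
      unfolding G_def using s0 by (auto intro!: tendsto_eq_intros)
  qed
  moreover have "integral\<^sup>L lborel g = moment cubic_phase 4 s + (4 * s\<^sup>2 + 1 / s) * moment cubic_phase 2 s - 2 * s * moment cubic_phase 0 s"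
    unfolding g_def using int by (simp add: mom)
  ultimately show ?thesis by simp
qed

lemma moment_gauss_recurrence:
  assumes s: "0 < Re s"
  shows "moment (\<lambda>_. 1) 0 s = 2 * s * moment (\<lambda>_. 1) 2 s"
proof -
  define m where "m k t = of_real t ^ k * exp (- s * of_real t ^ 2) * 1" for k t
  define g where "g t = m 0 t - 2 * s * m 2 t" for t
  have int: "integrable lborel (m k)" for k unfolding m_def by (rule const.integrable_moment[OF s])
  have mom: "integral\<^sup>L lborel (m k) = moment (\<lambda>_. 1) k s" for k by (simp add: m_def[abs_def] moment_def)
  have "integral\<^sup>L lborel g = 0"
  proof (rule integral_derivative_zero)
    show "(m 1 has_vector_derivative g t) (at t)" for t
    proof -
      have "((\<lambda>z. z * exp (- s * z\<^sup>2)) has_field_derivative (1 - 2 * s * z\<^sup>2) * exp (- s * z\<^sup>2)) (at z)" for z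
        by (rule derivative_eq_intros refl)+ (simp add: algebra_simps power2_eq_square)
      note der = has_vector_derivative_real_field[OF this, of t UNIV]
      have "(\<lambda>x. of_real x * exp (- s * (of_real x)\<^sup>2)) = m 1" by (rule ext) (simp add: m_def)
      moreover have "(1 - 2 * s * (of_real t)\<^sup>2) * exp (- s * (of_real t)\<^sup>2) = g t"
        by (simp add: g_def m_def algebra_simps)
      ultimately show ?thesis using der by (simp only:)
    qed
    show "isCont g t" for t unfolding g_def m_def by (intro continuous_intros)
    show "integrable lborel g" unfolding g_def using int by simp
    show "(m 1 \<longlongrightarrow> 0) at_top" "(m 1 \<longlongrightarrow> 0) at_bot"
      unfolding m_def by (rule const.moment_tendsto[OF s])+
  qed
  moreover have "integral\<^sup>L lborel g = moment (\<lambda>_. 1) 0 s - 2 * s * moment (\<lambda>_. 1) 2 s"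
    unfolding g_def using int by (simp add: mom)
  ultimately show ?thesis by simp
qed

section \<open>Comparison of the recessive integral with the Gaussian\<close>

definition gauss_integral :: complex where "gauss_integral = moment (\<lambda>_. 1) 0 1"

lemma convex_right_half_plane: "convex {s. 0 < Re s}"
  by (rule convex_halfspace_Re_gt)

text \<open>The product has derivative 0 by the recurrence, which replaces a rotation of the contour
  for complex s.\<close>

lemma gauss_moment_eq:
  assumes s: "0 < Re s"
  shows "moment (\<lambda>_. 1) 0 s * csqrt s = gauss_integral"
proof -
  define W where "W s = moment (\<lambda>_. 1) 0 s * csqrt s" for s
  have "\<exists>c. \<forall>s\<in>{s. 0 < Re s}. W s = c"
  proof (rule has_field_derivative_zero_constant[OF convex_right_half_plane])
    fix s :: complex assume "s \<in> {s. 0 < Re s}"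
    hence s: "0 < Re s" by simp
    hence s0: "s \<notin> \<real>\<^sub>\<le>\<^sub>0" "s \<noteq> 0" by (auto simp: complex_nonpos_Reals_iff)
    have "(W has_field_derivative - moment (\<lambda>_. 1) 2 s * csqrt s + moment (\<lambda>_. 1) 0 s * inverse (2 * csqrt s)) (at s)"
      unfolding W_def by (rule derivative_eq_intros const.moment_has_derivative[OF s, of 0, unfolded add_0] has_field_derivative_csqrt[OF s0(1)] refl)+ simp
    moreover have "csqrt s * csqrt s = s" using power2_csqrt[of s] by (simp add: power2_eq_square)
    hence "moment (\<lambda>_. 1) 0 s * inverse (2 * csqrt s) = moment (\<lambda>_. 1) 2 s * csqrt s"
      unfolding moment_gauss_recurrence[OF s] using s0 by (simp add: field_simps)
    ultimately show "(W has_field_derivative 0) (at s within {s. 0 < Re s})"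
      by (auto intro: has_field_derivative_at_within)
  qed
  hence "W s = W 1" using s by force
  thus ?thesis by (simp add: W_def gauss_integral_def)
qed

lemma gauss_integral_nonzero: "gauss_integral \<noteq> 0"
proof -
  have "has_bochner_integral lborel (\<lambda>x::real. exp (- x\<^sup>2)) (2 *\<^sub>R (sqrt pi / 2))"
    using has_bochner_integral_even_function[OF gaussian_moment_0] by simp
  hence "(LBINT x::real. exp (- x\<^sup>2)) = sqrt pi" by (auto simp: has_bochner_integral_iff)
  moreover have "gauss_integral = of_real (LBINT x::real. exp (- x\<^sup>2))"
    unfolding gauss_integral_def moment_def
    by (subst integral_complex_of_real[symmetric]) (simp flip: exp_of_real of_real_power of_real_minus)
  ultimately show ?thesis by (metis of_real_eq_0_iff real_sqrt_eq_zero_cancel_iff pi_neq_zero)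
qed

text \<open>The weights differ by at most |t|^3 \<le> t^2 (1 + t^2). One half of the Gaussian turns
  t^2 into 2 / Re s, the other half keeps the factor 1 + t^2 integrable.\<close>

lemma moment_cubic_minus_gauss:
  "\<exists>B>0. \<forall>s. 1 \<le> Re s \<longrightarrow> norm (moment cubic_phase 0 s - moment (\<lambda>_. 1) 0 s) \<le> B / Re s"
proof -
  define Q where "Q = (LBINT t::real. inverse (1 + t ^ 2))"
  define D where "D = gauss_const (1/2) 0 + gauss_const (1/2) 2"
  have D: "0 \<le> D" by (simp add: D_def gauss_const_def)
  have Q: "0 \<le> Q" unfolding Q_def by (intro Bochner_Integration.integral_nonneg) (simp add: add_nonneg_nonneg)
  have main: "norm (moment cubic_phase 0 s - moment (\<lambda>_. 1) 0 s) \<le> (2 * D * Q + 1) / Re s" if s: "1 \<le> Re s" for s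
  proof -
    define c where "c = Re s"
    have c: "1 \<le> c" "0 < Re s" using s by (simp_all add: c_def)
    define g where "g t = of_real t ^ 0 * exp (- s * of_real t ^ 2) * cubic_phase t - of_real t ^ 0 * exp (- s * of_real t ^ 2) * 1" for t
    have int: "integrable lborel g" and eq: "integral\<^sup>L lborel g = moment cubic_phase 0 s - moment (\<lambda>_. 1) 0 s"
      unfolding g_def moment_def
      using Bochner_Integration.integrable_diff[OF cubic.integrable_moment[OF c(2), of 0] const.integrable_moment[OF c(2), of 0]]
        Bochner_Integration.integral_diff[OF cubic.integrable_moment[OF c(2), of 0] const.integrable_moment[OF c(2), of 0]]
      by blast+
    have gb: "norm (g t) \<le> 2 * D / c * inverse (1 + t ^ 2)" for t
    proof -
      have "norm (exp (\<i> * of_real t ^ 3 / 3) - (\<Sum>i\<le>0. (\<i> * of_real t ^ 3 / 3) ^ i / fact i))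
          \<le> exp \<bar>Re (\<i> * of_real t ^ 3 / 3)\<bar> * norm (\<i> * of_real t ^ 3 / 3 :: complex) ^ Suc 0 / fact 0"
        by (rule Taylor_exp)
      hence "norm (cubic_phase t - 1) \<le> \<bar>t\<bar> ^ 3 / 3"
        by (simp add: cubic_phase_def norm_mult norm_divide norm_power power_abs flip: of_real_power)
      hence e: "norm (cubic_phase t - 1) \<le> \<bar>t\<bar> ^ 3" using zero_le_power[of "\<bar>t\<bar>" 3] by linarith
      have "\<bar>t\<bar> \<le> 1 + t ^ 2" by (rule abs_le_one_plus_square)
      hence "\<bar>t\<bar> ^ 3 \<le> t\<^sup>2 * (1 + t\<^sup>2)" by (simp add: power3_eq_cube power2_eq_square mult_left_mono abs_mult_self_eq flip: abs_mult)
      hence "norm (cubic_phase t - 1) \<le> t\<^sup>2 * (1 + t\<^sup>2)" using e by linarith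
      hence "exp (- c * t\<^sup>2) * norm (cubic_phase t - 1) \<le> exp (- c * t\<^sup>2) * (t\<^sup>2 * (1 + t\<^sup>2))" by (intro mult_left_mono) auto
      also have "\<dots> = ((t\<^sup>2) ^ 1 * exp (- (c / 2) * t\<^sup>2)) * ((1 + t\<^sup>2) * exp (- (c / 2) * t\<^sup>2))"
      proof -
        have "exp (- c * t\<^sup>2) = exp (- (c / 2) * t\<^sup>2) * exp (- (c / 2) * t\<^sup>2)" by (simp flip: exp_add)
        thus ?thesis by (simp only: power_one_right mult_ac)
      qed
      also have "\<dots> \<le> (2 / c) * (D * inverse (1 + t\<^sup>2))"
      proof (rule mult_mono)
        show "(t\<^sup>2) ^ 1 * exp (- (c / 2) * t\<^sup>2) \<le> 2 / c" using power_exp_bound[of "c / 2" "t\<^sup>2" 1] c by simp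
        have "1/2 * t\<^sup>2 \<le> c / 2 * t\<^sup>2" using c by (intro mult_right_mono) auto
        hence "(1 + t\<^sup>2) * exp (- (c / 2) * t\<^sup>2) \<le> (1 + t\<^sup>2) * exp (- (1/2) * t\<^sup>2)" by (intro mult_left_mono) auto
        also have "\<dots> \<le> D * inverse (1 + t\<^sup>2)"
          using gauss_bound[of "1/2" t 0] gauss_bound[of "1/2" t 2] by (simp add: D_def distrib_right)
        finally show "(1 + t\<^sup>2) * exp (- (c / 2) * t\<^sup>2) \<le> D * inverse (1 + t\<^sup>2)" .
      qed (use c D in auto)
      finally have "exp (- c * t\<^sup>2) * norm (cubic_phase t - 1) \<le> 2 * D / c * inverse (1 + t ^ 2)" by simp
      moreover have "g t = exp (- s * of_real t ^ 2) * (cubic_phase t - 1)" by (simp add: g_def algebra_simps)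
      hence "norm (g t) = exp (- c * t\<^sup>2) * norm (cubic_phase t - 1)"
        by (simp add: norm_mult c_def flip: of_real_power)
      ultimately show ?thesis by simp
    qed
    have "norm (integral\<^sup>L lborel g) \<le> (LBINT t. 2 * D / c * inverse (1 + t ^ 2))"
      by (rule Bochner_Integration.integral_norm_bound_integral[OF int _ gb]) (use integrable_inverse_square in simp)
    also have "\<dots> = 2 * D * Q / c" by (simp add: Q_def)
    also have "\<dots> \<le> (2 * D * Q + 1) / c" using c by (intro divide_right_mono) auto
    finally show ?thesis unfolding eq c_def .
  qed
  have "0 < 2 * D * Q + 1" using D Q by (simp add: add_nonneg_pos)
  thus ?thesis using main by blast
qed

text \<open>The Gaussian moment has size |s|^(-1/2) and the error is O(1 / Re s), so in the sector
  |s| \<le> 2 Re s the relative error tends to 0. The bound 1/4 suffices for a principal logarithm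
  of bounded size.\<close>

lemma moment_cubic_asymp:
  "\<exists>S>0. \<forall>s. S \<le> Re s \<and> norm s \<le> 2 * Re s \<longrightarrow>
     norm (moment cubic_phase 0 s * csqrt s / gauss_integral - 1) \<le> 1 / 4"
proof -
  obtain B where B: "0 < B" "\<And>s. 1 \<le> Re s \<Longrightarrow> norm (moment cubic_phase 0 s - moment (\<lambda>_. 1) 0 s) \<le> B / Re s"
    using moment_cubic_minus_gauss by blast
  define A where "A = norm gauss_integral"
  have A: "0 < A" using gauss_integral_nonzero by (simp add: A_def)
  \<comment> \<open>Chosen so that (B / c) sqrt (2 c) / A \<le> 1/4 for c \<ge> S.\<close>
  define S where "S = max 1 (32 * B\<^sup>2 / A\<^sup>2)"
  have "norm (moment cubic_phase 0 s * csqrt s / gauss_integral - 1) \<le> 1 / 4"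
    if s: "S \<le> Re s" "norm s \<le> 2 * Re s" for s
  proof -
    define c where "c = Re s"
    have c: "1 \<le> c" "32 * B\<^sup>2 / A\<^sup>2 \<le> c" using s by (auto simp: S_def c_def)
    have "moment cubic_phase 0 s * csqrt s / gauss_integral - 1 =
        (moment cubic_phase 0 s - moment (\<lambda>_. 1) 0 s) * csqrt s / gauss_integral"
      using gauss_moment_eq[of s] c gauss_integral_nonzero by (simp add: c_def field_simps)
    hence n: "norm (moment cubic_phase 0 s * csqrt s / gauss_integral - 1) =
        norm (moment cubic_phase 0 s - moment (\<lambda>_. 1) 0 s) * sqrt (norm s) / A"
      by (simp add: norm_mult norm_divide A_def)
    also have "\<dots> \<le> B / c * sqrt (2 * c) / A"
    proof -
      have "norm (moment cubic_phase 0 s - moment (\<lambda>_. 1) 0 s) \<le> B / c" using B(2)[of s] c(1) by (simp add: c_def)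
      moreover have "sqrt (norm s) \<le> sqrt (2 * c)" using s(2) by (simp add: c_def)
      ultimately show ?thesis using A B(1) c(1) by (intro divide_right_mono mult_mono) auto
    qed
    also have "\<dots> \<le> 1 / 4"
    proof -
      have "32 * B\<^sup>2 \<le> c * A\<^sup>2" using c(2) A by (simp add: field_simps)
      hence "(4 * B)\<^sup>2 * (2 * c) \<le> (c * A)\<^sup>2" using c(1) by (simp add: power2_eq_square algebra_simps)
      hence "sqrt ((4 * B)\<^sup>2 * (2 * c)) \<le> sqrt ((c * A)\<^sup>2)" by (rule real_sqrt_le_mono)
      hence "\<bar>4 * B\<bar> * sqrt (2 * c) \<le> \<bar>c * A\<bar>" unfolding real_sqrt_mult[of "(4 * B)\<^sup>2"] real_sqrt_abs .
      moreover have "\<bar>4 * B\<bar> = 4 * B" "\<bar>c * A\<bar> = c * A" using B(1) c(1) A by simp_all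
      moreover define r where "r = sqrt (2 * c)"
      ultimately have "4 * B * r \<le> c * A" by simp
      thus ?thesis unfolding r_def[symmetric] using c(1) A by (simp add: field_simps)
    qed
    finally show ?thesis .
  qed
  moreover have "0 < S" by (simp add: S_def)
  ultimately show ?thesis by blast
qed

text \<open>The Airy equation in the variable \<open>s = sqrt z\<close> turns the slit plane into the convex half plane \<open>Re s > 0\<close>.\<close>
lemma airy_recessive:
  "\<exists>p q. \<forall>s. 0 < Re s \<longrightarrow> airy p q (s\<^sup>2) = exp (- 2 / 3 * s ^ 3) * moment cubic_phase 0 s"
proof -
  define M where "M k s = moment cubic_phase k s" for k s
  define Y where "Y s = exp (- 2 / 3 * s ^ 3) * M 0 s" for s
  \<comment> \<open>The derivative of \<open>Y\<close> with respect to z = s^2, which is why factors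
    2 s appear in the derivatives with respect to s.\<close>
  define Y' where "Y' s = exp (- 2 / 3 * s ^ 3) * (- M 2 s / (2 * s) - s * M 0 s)" for s
  have dM: "(M k has_field_derivative - M (k + 2) s) (at s)" if "0 < Re s" for k s
    unfolding M_def using cubic.moment_has_derivative[OF that] .
  have d0: "(M 0 has_field_derivative - M 2 s) (at s)" and d2: "(M 2 has_field_derivative - M 4 s) (at s)"
    if "0 < Re s" for s
    using dM[OF that, of 0] dM[OF that, of 2] by (simp_all add: numeral_2_eq_2[symmetric])
  have dY: "(Y has_field_derivative 2 * s * Y' s) (at s)" if "0 < Re s" for s
  proof -
    have "s \<noteq> 0" using that by auto
    thus ?thesis unfolding Y_def[abs_def] Y'_def
      by (auto intro!: derivative_eq_intros d0[OF that] simp: field_simps power2_eq_square power3_eq_cube)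
  qed
  have dY': "(Y' has_field_derivative 2 * s ^ 3 * Y s) (at s)" if s: "0 < Re s" for s
  proof -
    have s0: "s \<noteq> 0" using s by auto
    have rec: "M 4 s = 2 * s * M 0 s - (4 * s\<^sup>2 + 1 / s) * M 2 s"
      using moment_cubic_recurrence[OF s] by (simp add: M_def eq_diff_eq)
    have "(Y' has_field_derivative (exp (- 2 / 3 * s ^ 3) * (- 2 / 3 * (3 * s\<^sup>2))) * (- M 2 s / (2 * s) - s * M 0 s)
        + exp (- 2 / 3 * s ^ 3) * ((M 4 s * (2 * s) + M 2 s * 2) / (2 * s)\<^sup>2 - (M 0 s + s * - M 2 s))) (at s)"
      unfolding Y'_def[abs_def] using s0
      by (auto intro!: derivative_eq_intros d2[OF s] d0[OF s] simp: field_simps power2_eq_square)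
    also have "(exp (- 2 / 3 * s ^ 3) * (- 2 / 3 * (3 * s\<^sup>2))) * (- M 2 s / (2 * s) - s * M 0 s)
        + exp (- 2 / 3 * s ^ 3) * ((M 4 s * (2 * s) + M 2 s * 2) / (2 * s)\<^sup>2 - (M 0 s + s * - M 2 s))
        = exp (- 2 / 3 * s ^ 3) * (2 * s ^ 3 * M 0 s)"
      unfolding rec using s0 by (simp add: field_simps power2_eq_square power3_eq_cube)
    finally show ?thesis by (simp add: Y_def mult_ac)
  qed
  have dsq: "((\<lambda>s. G (s\<^sup>2)) has_field_derivative 2 * s * G' (s\<^sup>2)) (at s)"
    if "\<And>z. (G has_field_derivative G' z) (at z)" for G G' :: "complex \<Rightarrow> complex" and s
    by (rule DERIV_chain2[where g = "\<lambda>s. s\<^sup>2", OF that, THEN DERIV_cong]) (auto intro!: derivative_eq_intros)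
  note du = dsq[OF airy_has_derivative] and du' = dsq[OF airy'_has_derivative]
  have const: "\<exists>c. \<forall>s\<in>{s. 0 < Re s}. Y s * airy' p q (s\<^sup>2) - Y' s * airy p q (s\<^sup>2) = c" for p q
  proof (rule has_field_derivative_zero_constant[OF convex_right_half_plane])
    fix s :: complex assume "s \<in> {s. 0 < Re s}"
    hence s: "0 < Re s" by simp
    have "((\<lambda>s. Y s * airy' p q (s\<^sup>2) - Y' s * airy p q (s\<^sup>2)) has_field_derivative 0) (at s)"
      by (rule derivative_eq_intros dY[OF s] dY'[OF s] du du' refl)+ (simp add: algebra_simps power2_eq_square power3_eq_cube)
    thus "((\<lambda>s. Y s * airy' p q (s\<^sup>2) - Y' s * airy p q (s\<^sup>2)) has_field_derivative 0) (at s within {s. 0 < Re s})"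
      by (rule has_field_derivative_at_within)
  qed
  \<comment> \<open>The Wronskians of \<open>Y\<close> with the two basic solutions are constant. By
    Cramer's rule they are, up to sign, the coordinates of \<open>Y\<close> in that basis, although
    \<open>Y\<close> is not considered at s = 0.\<close>
  obtain c where c: "\<And>s. 0 < Re s \<Longrightarrow> Y s * airy' 0 1 (s\<^sup>2) - Y' s * airy 0 1 (s\<^sup>2) = c" using const[of 0 1] by auto
  obtain d where d: "\<And>s. 0 < Re s \<Longrightarrow> Y s * airy' 1 0 (s\<^sup>2) - Y' s * airy 1 0 (s\<^sup>2) = d" using const[of 1 0] by auto
  have "airy c (- d) (s\<^sup>2) = Y s" if s: "0 < Re s" for s
  proof -
    have "airy c (- d) (s\<^sup>2) = c * airy 1 0 (s\<^sup>2) - d * airy 0 1 (s\<^sup>2)" by (subst airy_linear) simp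
    also have "\<dots> = Y s * (airy 1 0 (s\<^sup>2) * airy' 0 1 (s\<^sup>2) - airy' 1 0 (s\<^sup>2) * airy 0 1 (s\<^sup>2))"
      unfolding c[OF s, symmetric] d[OF s, symmetric] by (simp add: algebra_simps)
    finally show ?thesis unfolding airy_wronskian by simp
  qed
  thus ?thesis unfolding Y_def M_def by blast
qed

section \<open>The eigenvalue condition\<close>

lemma airy'_linear: "airy' p q z = p * airy' 1 0 z + q * airy' 0 1 z"
proof (rule DERIV_unique)
  show "(airy p q has_field_derivative airy' p q z) (at z)" by (rule airy_has_derivative)
  have "((\<lambda>z. p * airy 1 0 z + q * airy 0 1 z) has_field_derivative p * airy' 1 0 z + q * airy' 0 1 z) (at z)"
    by (auto intro!: derivative_eq_intros airy_has_derivative)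
  thus "(airy p q has_field_derivative p * airy' 1 0 z + q * airy' 0 1 z) (at z)"
    by (simp add: airy_linear[symmetric])
qed

text \<open>\<open>k\<close> is eps^(-1/3), the scale that turns the equation into Airy's. The
  condition is the vanishing of the determinant of boundary values of a fundamental system.\<close>

lemma eigenvalues_iff:
  fixes k eps :: real
  assumes k: "k ^ 3 * eps = 1" "0 < eps"
  defines "Z \<equiv> \<lambda>lam x. - \<i> * of_real k * (x - lam)"
  shows "lam \<in> eigenvalues eps \<longleftrightarrow>
    airy 1 0 (Z lam 1) * airy 0 1 (Z lam (- 1)) = airy 1 0 (Z lam (- 1)) * airy 0 1 (Z lam 1)"
proof -
  define \<kappa> where "\<kappa> = - \<i> * complex_of_real k"
  define z where "z x = \<kappa> * (of_real x - lam)" for x :: real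
  have k0: "k \<noteq> 0" using k by auto
  have \<kappa>0: "\<kappa> \<noteq> 0" using k0 by (simp add: \<kappa>_def)
  have \<kappa>3: "- \<i> * of_real eps * (\<kappa> * \<kappa> * z x) = of_real x - lam" for x
  proof -
    have "- \<i> * of_real eps * (\<kappa> * \<kappa> * z x) = of_real (k ^ 3 * eps) * (of_real x - lam)"
      by (simp add: \<kappa>_def z_def power3_eq_cube algebra_simps)
    thus ?thesis unfolding k(1) by simp
  qed
  have Z: "Z lam 1 = z 1" "Z lam (- 1) = z (- 1)" by (simp_all add: Z_def z_def \<kappa>_def)
  have dz: "((\<lambda>x. airy p q (z x)) has_vector_derivative \<kappa> * airy' p q (z x)) (at x)" for p q x
  proof -
    have "((\<lambda>w. airy p q (\<kappa> * (w - lam))) has_field_derivative airy' p q (\<kappa> * (w - lam)) * \<kappa>) (at w)" for w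
      by (rule DERIV_chain2[OF airy_has_derivative]) (auto intro!: derivative_eq_intros)
    from has_vector_derivative_real_field[OF this, of x UNIV] show ?thesis by (simp add: z_def mult.commute)
  qed
  have dz': "((\<lambda>x. \<kappa> * airy' p q (z x)) has_vector_derivative \<kappa> * \<kappa> * z x * airy p q (z x)) (at x)" for p q x
  proof -
    have "((\<lambda>w. \<kappa> * airy' p q (\<kappa> * (w - lam))) has_field_derivative
        \<kappa> * (\<kappa> * (w - lam) * airy p q (\<kappa> * (w - lam)) * \<kappa>)) (at w)" for w
      by (rule DERIV_cmult, rule DERIV_chain2[OF airy'_has_derivative]) (auto intro!: derivative_eq_intros)
    from has_vector_derivative_real_field[OF this, of x UNIV] show ?thesis by (simp add: z_def mult_ac)
  qed
  have cont: "continuous_on A (\<lambda>x. airy p q (z x))" for p q A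
    by (rule continuous_at_imp_continuous_on) (use dz has_vector_derivative_continuous in blast)
  show ?thesis unfolding Z
  proof
    assume "lam \<in> eigenvalues eps"
    then obtain y where "dirichlet_eigenfunction eps lam y" by (auto simp: eigenvalues_def)
    then obtain y1 y2 where y: "continuous_on {-1..1} y" "y (- 1) = 0" "y 1 = 0" "\<exists>x\<in>{-1..1}. y x \<noteq> 0"
      and d: "\<And>x. x \<in> {-1<..<1} \<Longrightarrow> (y has_vector_derivative y1 x) (at x)"
        "\<And>x. x \<in> {-1<..<1} \<Longrightarrow> (y1 has_vector_derivative y2 x) (at x)"
        "\<And>x. x \<in> {-1<..<1} \<Longrightarrow> - \<i> * of_real eps * y2 x = (of_real x - lam) * y x"
      unfolding dirichlet_eigenfunction_def by blast
    have y2: "y2 x = \<kappa> * \<kappa> * z x * y x" if "x \<in> {-1<..<1}" for x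
    proof -
      have "- \<i> * of_real eps * y2 x = - \<i> * of_real eps * (\<kappa> * \<kappa> * z x * y x)"
        using d(3)[OF that] \<kappa>3[of x] by (simp add: mult.assoc[symmetric])
      thus ?thesis using k(2) by simp
    qed
    have const: "\<exists>c. \<forall>x\<in>{-1<..<1}. y x * (\<kappa> * airy' p q (z x)) - y1 x * airy p q (z x) = c" for p q
    proof -
      have "((\<lambda>x. y x * (\<kappa> * airy' p q (z x)) - y1 x * airy p q (z x)) has_vector_derivative 0) (at x within {-1<..<1})"
        if x: "x \<in> {-1<..<1}" for x
      proof -
        have "((\<lambda>x. y x * (\<kappa> * airy' p q (z x)) - y1 x * airy p q (z x)) has_vector_derivative
          (y x * (\<kappa> * \<kappa> * z x * airy p q (z x)) + y1 x * (\<kappa> * airy' p q (z x)))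
          - (y1 x * (\<kappa> * airy' p q (z x)) + y2 x * airy p q (z x))) (at x)"
          by (intro has_vector_derivative_diff has_vector_derivative_mult d(1,2)[OF x] dz dz')
        moreover have "(y x * (\<kappa> * \<kappa> * z x * airy p q (z x)) + y1 x * (\<kappa> * airy' p q (z x)))
          - (y1 x * (\<kappa> * airy' p q (z x)) + y2 x * airy p q (z x)) = 0"
          unfolding y2[OF x] by (simp add: algebra_simps)
        ultimately show ?thesis by (simp only: has_vector_derivative_at_within)
      qed
      from has_vector_derivative_zero_constant[OF convex_real_interval(8) this] show ?thesis by metis
    qed
    obtain c where c: "\<And>x. x \<in> {-1<..<1} \<Longrightarrow> y x * (\<kappa> * airy' 0 1 (z x)) - y1 x * airy 0 1 (z x) = c"
      using const[of 0 1] by blast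
    obtain e where e: "\<And>x. x \<in> {-1<..<1} \<Longrightarrow> y x * (\<kappa> * airy' 1 0 (z x)) - y1 x * airy 1 0 (z x) = e"
      using const[of 1 0] by blast
    have "\<kappa> * y x - (c * airy 1 0 (z x) - e * airy 0 1 (z x)) = 0" if "x \<in> {-1<..<1}" for x
    proof -
      have "c * airy 1 0 (z x) - e * airy 0 1 (z x) =
          \<kappa> * y x * (airy 1 0 (z x) * airy' 0 1 (z x) - airy' 1 0 (z x) * airy 0 1 (z x))"
        unfolding c[OF that, symmetric] e[OF that, symmetric] by (simp add: algebra_simps)
      thus ?thesis unfolding airy_wronskian by simp
    qed
    \<comment> \<open>The Wronskian identity holds in the open interval only, as y is not assumed
      differentiable at the endpoints; continuity carries the resulting relation to the
      boundary.\<close>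
    hence eq: "\<kappa> * y x - (c * airy 1 0 (z x) - e * airy 0 1 (z x)) = 0" if "x \<in> {-1..1}" for x
      using continuous_constant_on_closure[of "{-1<..<1}" "\<lambda>x. \<kappa> * y x - (c * airy 1 0 (z x) - e * airy 0 1 (z x))" 0 x] that
      by (simp add: cont y(1) continuous_intros)
    from eq[of 1] eq[of "- 1"] y have E: "c * airy 1 0 (z 1) = e * airy 0 1 (z 1)" "c * airy 1 0 (z (- 1)) = e * airy 0 1 (z (- 1))"
      by simp_all
    have "c \<noteq> 0 \<or> e \<noteq> 0"
    proof (rule ccontr)
      assume "\<not> (c \<noteq> 0 \<or> e \<noteq> 0)"
      hence "\<kappa> * y x = 0" if "x \<in> {-1..1}" for x using eq[OF that] by simp
      thus False using y(4) \<kappa>0 by auto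
    qed
    thus "airy 1 0 (z 1) * airy 0 1 (z (- 1)) = airy 1 0 (z (- 1)) * airy 0 1 (z 1)"
    proof
      assume "c \<noteq> 0"
      have "c * (airy 1 0 (z 1) * airy 0 1 (z (- 1))) = (c * airy 1 0 (z 1)) * airy 0 1 (z (- 1))" by simp
      also have "\<dots> = (e * airy 0 1 (z (- 1))) * airy 0 1 (z 1)" unfolding E(1) by simp
      also have "\<dots> = c * (airy 1 0 (z (- 1)) * airy 0 1 (z 1))" unfolding E(2)[symmetric] by simp
      finally show ?thesis using \<open>c \<noteq> 0\<close> by simp
    next
      assume "e \<noteq> 0"
      have "e * (airy 1 0 (z 1) * airy 0 1 (z (- 1))) = (e * airy 0 1 (z (- 1))) * airy 1 0 (z 1)" by simp
      also have "\<dots> = (c * airy 1 0 (z 1)) * airy 1 0 (z (- 1))" unfolding E(2)[symmetric] by simp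
      also have "\<dots> = e * (airy 1 0 (z (- 1)) * airy 0 1 (z 1))" unfolding E(1) by simp
      finally show ?thesis using \<open>e \<noteq> 0\<close> by simp
    qed
  next
    assume det: "airy 1 0 (z 1) * airy 0 1 (z (- 1)) = airy 1 0 (z (- 1)) * airy 0 1 (z 1)"
    \<comment> \<open>The combination that vanishes at x = 1; the determinant condition makes it
      vanish at x = -1 as well. It is not the zero function, since otherwise value and derivative at
      x = 0 would force p = q = 0 by the Wronskian.\<close>
    define p where "p = airy 0 1 (z 1)"
    define q where "q = - airy 1 0 (z 1)"
    define y where "y x = airy p q (z x)" for x
    have pq: "p \<noteq> 0 \<or> q \<noteq> 0" using airy_wronskian[of "z 1"] by (auto simp: p_def q_def)
    have "\<exists>x\<in>{-1..1}. y x \<noteq> 0"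
    proof (rule ccontr)
      assume "\<not> (\<exists>x\<in>{-1..1}. y x \<noteq> 0)"
      hence y0: "y x = 0" if "x \<in> {-1..1}" for x using that by blast
      have "(y has_vector_derivative 0) (at 0)"
      proof (rule has_vector_derivative_transform_within_open)
        show "((\<lambda>x. 0) has_vector_derivative (0::complex)) (at 0)" by simp
        show "open {-1<..<1::real}" by simp
      qed (use y0 in auto)
      moreover have "(y has_vector_derivative \<kappa> * airy' p q (z 0)) (at 0)" unfolding y_def[abs_def] by (rule dz)
      ultimately have "\<kappa> * airy' p q (z 0) = 0" using vector_derivative_unique_at by blast
      hence a': "p * airy' 1 0 (z 0) + q * airy' 0 1 (z 0) = 0" using \<kappa>0 airy'_linear[of p q "z 0"] by simp
      have a: "p * airy 1 0 (z 0) + q * airy 0 1 (z 0) = 0" using y0[of 0] airy_linear[of p q "z 0"] by (simp add: y_def)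
      have "p * (airy 1 0 (z 0) * airy' 0 1 (z 0) - airy' 1 0 (z 0) * airy 0 1 (z 0))
          = (p * airy 1 0 (z 0) + q * airy 0 1 (z 0)) * airy' 0 1 (z 0) - (p * airy' 1 0 (z 0) + q * airy' 0 1 (z 0)) * airy 0 1 (z 0)"
        "q * (airy 1 0 (z 0) * airy' 0 1 (z 0) - airy' 1 0 (z 0) * airy 0 1 (z 0))
          = (p * airy' 1 0 (z 0) + q * airy' 0 1 (z 0)) * airy 1 0 (z 0) - (p * airy 1 0 (z 0) + q * airy 0 1 (z 0)) * airy' 1 0 (z 0)"
        by (simp_all add: algebra_simps)
      hence "p = 0" "q = 0" unfolding a a' airy_wronskian by simp_all
      thus False using pq by blast
    qed
    moreover have "y (- 1) = 0" "y 1 = 0"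
      using det airy_linear[of p q "z 1"] airy_linear[of p q "z (- 1)"] by (simp_all add: y_def p_def q_def mult.commute)
    moreover have "- \<i> * of_real eps * (\<kappa> * \<kappa> * z x * y x) = (of_real x - lam) * y x" for x
      using \<kappa>3[of x] by (simp add: mult.assoc[symmetric])
    ultimately have "dirichlet_eigenfunction eps lam y"
      unfolding dirichlet_eigenfunction_def
      using cont[of _ p q] dz[of p q] dz'[of p q]
      by (intro conjI exI[of _ "\<lambda>x. \<kappa> * airy' p q (z x)"] exI[of _ "\<lambda>x. \<kappa> * \<kappa> * z x * y x"]) (auto simp: y_def[abs_def])
    thus "lam \<in> eigenvalues eps" by (auto simp: eigenvalues_def)
  qed
qed

section \<open>The phase function\<close>

text \<open>The distance from the node to each of the endpoints 1 and -1.\<close>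

definition arm :: real where "arm = 2 / sqrt 3"

text \<open>The function (4/3) (arm - w)^(3/2). The recessive solution carries exp (- (2/3) s^3),
  and at its two rotated arguments s^3 equals plus or minus i (arm - w)^(3/2) / sqrt eps, so the
  quotient doubles the factor 2/3.\<close>

definition phase :: "complex \<Rightarrow> complex" where
  "phase w = 4 / 3 * ((of_real arm - w) * csqrt (of_real arm - w))"

lemma arm_bounds: "11/10 < arm" "arm < 12/10"
  using sqrt3_bounds by (simp_all add: arm_def field_simps)

text \<open>The square root stays so close to the positive axis that rotating it by pi/6 either way
  keeps it in the sector |s| \<le> 2 Re s of \<open>moment_cubic_asymp\<close>.\<close>

lemma csqrt_sector:
  assumes "norm w < arm / 4"
  defines "\<sigma> \<equiv> csqrt (of_real arm - w)"
  shows "9/10 < Re \<sigma>" "\<bar>Im \<sigma>\<bar> < Re \<sigma> / 6"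
proof -
  define x where "x = Re \<sigma>"
  define y where "y = Im \<sigma>"
  have sq: "\<sigma>\<^sup>2 = of_real arm - w" by (simp add: \<sigma>_def)
  have re: "x\<^sup>2 - y\<^sup>2 = arm - Re w" and im: "2 * x * y = - Im w"
    using arg_cong[OF sq, of Re] arg_cong[OF sq, of Im] by (simp_all add: x_def y_def Re_power2 Im_power2)
  have wb: "\<bar>Re w\<bar> < arm / 4" "\<bar>Im w\<bar> < arm / 4"
    using abs_Re_le_cmod[of w] abs_Im_le_cmod[of w] assms(1) by linarith+
  have x2: "3 / 4 * arm < x\<^sup>2" using re wb zero_le_power2[of y] by linarith
  hence "(9/10)\<^sup>2 < x\<^sup>2" using arm_bounds by (simp add: power2_eq_square)
  moreover have "0 \<le> x" unfolding x_def \<sigma>_def by (rule Re_csqrt)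
  ultimately have x: "9/10 < x" using power2_less_imp_less by blast
  have "\<bar>2 * x * y\<bar> = \<bar>Im w\<bar>" unfolding im by simp
  moreover have "\<bar>2 * x * y\<bar> = 2 * x * \<bar>y\<bar>" using x by (simp add: abs_mult)
  ultimately have "6 * (x * \<bar>y\<bar>) < x * x" using wb(2) x2 by (simp add: power2_eq_square)
  hence "x * (6 * \<bar>y\<bar>) < x * x" by (simp add: mult_ac)
  hence "6 * \<bar>y\<bar> < x" using x by simp
  thus "9/10 < Re \<sigma>" "\<bar>Im \<sigma>\<bar> < Re \<sigma> / 6" using x by (simp_all add: x_def y_def)
qed

lemma arm_minus_slit:
  fixes w :: complex
  assumes "norm w < arm / 4"
  shows "of_real arm - w \<notin> \<real>\<^sub>\<le>\<^sub>0"
proof -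
  have "Re w < arm" using abs_Re_le_cmod[of w] assms arm_bounds by linarith
  thus ?thesis by (simp add: complex_nonpos_Reals_iff)
qed

lemma phase_has_derivative:
  assumes "norm w < arm / 4"
  shows "(phase has_field_derivative - 2 * csqrt (of_real arm - w)) (at w)"
proof -
  note slit = arm_minus_slit[OF assms]
  have n: "csqrt (of_real arm - w) \<noteq> 0" using slit by auto
  have sq: "csqrt (of_real arm - w) * csqrt (of_real arm - w) = of_real arm - w"
    using power2_csqrt[of "of_real arm - w"] by (simp add: power2_eq_square)
  have "(phase has_field_derivative 4 / 3 * (- csqrt (of_real arm - w)
      + (of_real arm - w) * (- 1 / (2 * csqrt (of_real arm - w))))) (at w)"
    unfolding phase_def[abs_def] using slit by (auto intro!: derivative_eq_intros)
  moreover have "(of_real arm - w) * (- 1 / (2 * csqrt (of_real arm - w))) = - csqrt (of_real arm - w) / 2"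
  proof -
    have "u * (- 1 / (2 * v)) = - v / 2" if "v \<noteq> 0" "v * v = u" for u v :: complex
      using that(1) unfolding that(2)[symmetric] by simp
    thus ?thesis using n sq by blast
  qed
  moreover have "4 / 3 * (- v + - v / 2) = - 2 * v" for v :: complex by simp
  ultimately show ?thesis by (simp only:)
qed

lemma phase_near_linear:
  "\<exists>\<rho>>0. \<rho> \<le> arm / 4 \<and> (\<forall>w\<in>ball 0 \<rho>. \<forall>w'\<in>ball 0 \<rho>.
     norm (phase w - phase w' + of_real (2 * sqrt arm) * (w - w')) \<le> 2 * sqrt arm / 32 * norm (w - w'))"
proof -
  have arm0: "0 < arm" using arm_bounds by simp
  have "isCont (\<lambda>w. - 2 * csqrt (of_real arm - w)) 0"
    using arm_minus_slit[of 0] arm0 by (intro continuous_intros) auto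
  moreover have "0 < 2 * sqrt arm / 32" using arm0 by simp
  ultimately have "\<exists>d>0. \<forall>w. dist w 0 < d \<longrightarrow> dist (- 2 * csqrt (of_real arm - w)) (- 2 * csqrt (of_real arm - 0)) < 2 * sqrt arm / 32"
    unfolding continuous_at_eps_delta by blast
  then obtain d where d: "0 < d"
    "\<And>w. norm w < d \<Longrightarrow> norm (- 2 * csqrt (of_real arm - w) - (- 2 * csqrt (of_real arm - 0))) < 2 * sqrt arm / 32"
    unfolding dist_norm diff_0_right by blast
  have c0: "csqrt (of_real arm) = of_real (sqrt arm)" by (rule of_real_sqrt[symmetric]) (use arm0 in simp)
  define \<rho> where "\<rho> = min d (arm / 4)"
  show ?thesis
  proof (intro exI[of _ \<rho>] conjI ballI)
    show "0 < \<rho>" "\<rho> \<le> arm / 4" using d arm0 by (auto simp: \<rho>_def)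
    fix w w' :: complex assume w: "w \<in> ball 0 \<rho>" "w' \<in> ball 0 \<rho>"
    have "norm ((phase w + of_real (2 * sqrt arm) * w) - (phase w' + of_real (2 * sqrt arm) * w'))
        \<le> 2 * sqrt arm / 32 * norm (w - w')"
    proof (rule field_differentiable_bound[OF convex_ball])
      show "w \<in> ball 0 \<rho>" "w' \<in> ball 0 \<rho>" by fact+
      fix z :: complex assume z: "z \<in> ball 0 \<rho>"
      have "((\<lambda>w. phase w + of_real (2 * sqrt arm) * w) has_field_derivative
          - 2 * csqrt (of_real arm - z) + of_real (2 * sqrt arm)) (at z)"
        using phase_has_derivative[of z] z by (auto intro!: derivative_eq_intros simp: \<rho>_def)
      thus "((\<lambda>w. phase w + of_real (2 * sqrt arm) * w) has_field_derivative
          - 2 * csqrt (of_real arm - z) + of_real (2 * sqrt arm)) (at z within ball 0 \<rho>)"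
        by (rule has_field_derivative_at_within)
      have "norm (- 2 * csqrt (of_real arm - z) - (- 2 * csqrt (of_real arm - 0))) \<le> 2 * sqrt arm / 32"
        using d(2)[of z] z by (simp add: \<rho>_def less_imp_le)
      thus "norm (- 2 * csqrt (of_real arm - z) + of_real (2 * sqrt arm)) \<le> 2 * sqrt arm / 32"
        unfolding diff_zero c0 by simp
    qed
    thus "norm (phase w - phase w' + of_real (2 * sqrt arm) * (w - w')) \<le> 2 * sqrt arm / 32 * norm (w - w')"
      by (simp add: algebra_simps)
  qed
qed

lemma phase_real:
  assumes "\<bar>x\<bar> < arm / 4"
  shows "phase (of_real x) \<in> \<real>"
proof -
  have "0 \<le> arm - x" using assms arm_bounds by linarith
  hence "csqrt (of_real (arm - x)) = of_real (sqrt (arm - x))" by (rule of_real_sqrt[symmetric])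
  hence "phase (of_real x) = of_real (4 / 3 * ((arm - x) * sqrt (arm - x)))"
    by (simp add: phase_def)
  thus ?thesis by (simp only: Reals_of_real)
qed

lemma phase_cnj:
  assumes "norm w < arm / 4"
  shows "phase (cnj w) = cnj (phase w)"
proof -
  have "cnj (csqrt (of_real arm - w)) = csqrt (cnj (of_real arm - w))"
    using arm_minus_slit[OF assms] by (intro cnj_csqrt) auto
  thus ?thesis by (simp add: phase_def)
qed

lemma phase_sym:
  assumes "\<bar>x\<bar> < arm / 4"
  shows "phase (\<omega> * of_real x) + phase (\<omega>' * of_real x) \<in> \<real>"
proof -
  have c: "\<omega>' * of_real x = cnj (\<omega> * of_real x)" by (simp add: cis_cnj)
  have "phase (\<omega>' * of_real x) = cnj (phase (\<omega> * of_real x))"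
    unfolding c by (rule phase_cnj) (use assms in \<open>simp add: norm_mult\<close>)
  thus ?thesis by (simp only: complex_add_cnj Reals_of_real)
qed

lemma exp_half_Ln_ratio:
  assumes "s \<noteq> 0" "t \<noteq> 0"
  shows "exp ((Ln s - Ln t) / 2) = csqrt s / csqrt t"
  using assms by (simp add: csqrt_exp_Ln exp_diff diff_divide_distrib)

text \<open>The two arguments have square roots in the right half plane, so the integral
  representation applies to both. The exponential factors give the phase, the quotient of the
  moments goes into \<open>b\<close>. The parameter \<open>g\<close> stands for eps^(-1/6), and 1 /
  g^3 for h.\<close>

lemma airy_ratio:
  fixes g S :: real
  assumes rec: "\<And>s. 0 < Re s \<Longrightarrow> airy p q (s\<^sup>2) = exp (- 2 / 3 * s ^ 3) * moment cubic_phase 0 s"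
    and asymp: "\<And>s. S \<le> Re s \<Longrightarrow> norm s \<le> 2 * Re s \<Longrightarrow>
      norm (moment cubic_phase 0 s * csqrt s / gauss_integral - 1) \<le> 1 / 4"
    and g: "0 < g" "2 * S \<le> g"
  shows "\<exists>b. b holomorphic_on ball 0 (arm / 4) \<and> (\<forall>w\<in>ball 0 (arm / 4). norm (b w) \<le> 8 \<and>
    airy p q (of_real (g\<^sup>2) * cis (pi / 3) * (of_real arm - w)) \<noteq> 0 \<and>
    airy p q (of_real (g\<^sup>2) * cis (- (pi / 3)) * (of_real arm - w)) \<noteq> 0 \<and>
    \<omega> * airy p q (of_real (g\<^sup>2) * cis (pi / 3) * (of_real arm - w))
      / airy p q (of_real (g\<^sup>2) * cis (- (pi / 3)) * (of_real arm - w))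
      = exp (- \<i> * phase w / of_real (1 / g ^ 3) + b w))"
proof -
  define s where "s \<alpha> w = of_real g * cis \<alpha> * csqrt (of_real arm - w)" for \<alpha> w
  define Q where "Q s = moment cubic_phase 0 s * csqrt s / gauss_integral" for s
  define T where "T = {- (pi / 6), pi / 6}"
  define U :: "complex set" where "U = ball 0 (arm / 4)"
  have sec: "S \<le> Re (s \<alpha> w)" "norm (s \<alpha> w) \<le> 2 * Re (s \<alpha> w)" "0 < Re (s \<alpha> w)" "norm (s \<alpha> w) = g * norm (csqrt (of_real arm - w))"
    if "w \<in> U" "\<alpha> \<in> T" for w \<alpha>
  proof -
    define x where "x = Re (csqrt (of_real arm - w))"
    define y where "y = Im (csqrt (of_real arm - w))"
    have xy: "9/10 < x" "\<bar>y\<bar> < x / 6" using csqrt_sector[of w] that(1) by (auto simp: x_def y_def U_def)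
    have "Re (cis \<alpha> * csqrt (of_real arm - w)) = sqrt 3 * x / 2 - y / 2 \<or> Re (cis \<alpha> * csqrt (of_real arm - w)) = sqrt 3 * x / 2 + y / 2"
    proof -
      have c: "cos \<alpha> = sqrt 3 / 2" "sin \<alpha> = 1 / 2 \<or> sin \<alpha> = - (1 / 2)"
      proof -
        have "\<alpha> = - (pi / 6) \<or> \<alpha> = pi / 6" using that(2) unfolding T_def by blast
        thus "cos \<alpha> = sqrt 3 / 2" "sin \<alpha> = 1 / 2 \<or> sin \<alpha> = - (1 / 2)"
          by (metis cos_minus cos_30, metis sin_minus sin_30)
      qed
      have r: "Re (cis \<alpha> * csqrt (of_real arm - w)) = cos \<alpha> * x - sin \<alpha> * y"
        unfolding times_complex.sel cis.sel x_def y_def ..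
      from c(2) show ?thesis
      proof
        assume s: "sin \<alpha> = 1 / 2"
        show ?thesis unfolding r c(1) s by simp
      next
        assume s: "sin \<alpha> = - (1 / 2)"
        show ?thesis unfolding r c(1) s by simp
      qed
    qed
    moreover have "43/25 * x \<le> sqrt 3 * x" using xy sqrt3_bounds by (intro mult_right_mono) auto
    ultimately have R: "6/10 * x \<le> Re (cis \<alpha> * csqrt (of_real arm - w))" using xy by linarith
    have Re: "Re (s \<alpha> w) = g * Re (cis \<alpha> * csqrt (of_real arm - w))" by (simp add: s_def mult.assoc)
    have "g * (1/2) \<le> Re (s \<alpha> w)" unfolding Re using R xy g by (intro mult_left_mono) auto
    thus "S \<le> Re (s \<alpha> w)" "0 < Re (s \<alpha> w)" using g by linarith+
    show n: "norm (s \<alpha> w) = g * norm (csqrt (of_real arm - w))" using g by (simp add: s_def norm_mult)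
    have "norm (csqrt (of_real arm - w)) \<le> 12/10 * x"
      using cmod_le[of "csqrt (of_real arm - w)"] xy unfolding x_def[symmetric] y_def[symmetric] by linarith
    hence "norm (csqrt (of_real arm - w)) \<le> 2 * Re (cis \<alpha> * csqrt (of_real arm - w))" using R by linarith
    thus "norm (s \<alpha> w) \<le> 2 * Re (s \<alpha> w)" unfolding n Re using g by (simp add: mult.left_commute)
  qed
  have Q1: "norm (Q (s \<alpha> w) - 1) \<le> 1 / 4" if "w \<in> U" "\<alpha> \<in> T" for w \<alpha>
    unfolding Q_def using sec[OF that] by (intro asymp) auto
  have Qne: "Q (s \<alpha> w) \<notin> \<real>\<^sub>\<le>\<^sub>0" "Q (s \<alpha> w) \<noteq> 0" if "w \<in> U" "\<alpha> \<in> T" for w \<alpha>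
  proof -
    have "\<bar>Re (Q (s \<alpha> w) - 1)\<bar> \<le> 1 / 4" using Q1[OF that] abs_Re_le_cmod order_trans by blast
    hence "0 < Re (Q (s \<alpha> w))" unfolding minus_complex.sel one_complex.sel by linarith
    thus "Q (s \<alpha> w) \<notin> \<real>\<^sub>\<le>\<^sub>0" by (simp add: complex_nonpos_Reals_iff)
    thus "Q (s \<alpha> w) \<noteq> 0" by auto
  qed
  have sne: "s \<alpha> w \<noteq> 0" "s \<alpha> w \<notin> \<real>\<^sub>\<le>\<^sub>0" if "w \<in> U" "\<alpha> \<in> T" for w \<alpha>
    using sec(3)[OF that] by (auto simp: complex_nonpos_Reals_iff)
  have shol: "s \<alpha> holomorphic_on U" for \<alpha>
    unfolding s_def[abs_def] using arm_minus_slit by (intro holomorphic_intros) (auto simp: U_def)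
  have mhol: "moment cubic_phase 0 holomorphic_on {s. 0 < Re s}"
    using cubic.moment_has_derivative[of _ 0] by (auto simp: holomorphic_on_open open_halfspace_Re_gt)
  have Qhol: "(\<lambda>w. Q (s \<alpha> w)) holomorphic_on U" if "\<alpha> \<in> T" for \<alpha>
  proof -
    have "(moment cubic_phase 0 \<circ> s \<alpha>) holomorphic_on U"
      using sec(3)[OF _ that] by (intro holomorphic_on_compose_gen[OF shol mhol]) auto
    thus ?thesis
      unfolding Q_def o_def using gauss_integral_nonzero sne(2)[OF _ that] by (intro holomorphic_intros shol) auto
  qed
  have mom: "moment cubic_phase 0 (s \<alpha> w) = Q (s \<alpha> w) * gauss_integral / csqrt (s \<alpha> w)" if "w \<in> U" "\<alpha> \<in> T" for w \<alpha>
    using sne[OF that] gauss_integral_nonzero by (simp add: Q_def)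
  have sq: "(s \<alpha> w)\<^sup>2 = of_real (g\<^sup>2) * cis (2 * \<alpha>) * (of_real arm - w)" for \<alpha> w
    by (simp add: s_def power_mult_distrib Complex.DeMoivre)
  have cube: "(s \<alpha> w) ^ 3 = of_real (g ^ 3) * cis (3 * \<alpha>) * ((of_real arm - w) * csqrt (of_real arm - w))" for \<alpha> w
  proof -
    have "csqrt (of_real arm - w) ^ 3 = (csqrt (of_real arm - w))\<^sup>2 * csqrt (of_real arm - w)"
      by (simp only: power3_eq_cube power2_eq_square)
    thus ?thesis by (simp add: s_def power_mult_distrib Complex.DeMoivre)
  qed
  have val: "airy p q (of_real (g\<^sup>2) * cis (2 * \<alpha>) * (of_real arm - w)) = exp (- 2 / 3 * s \<alpha> w ^ 3) * (Q (s \<alpha> w) * gauss_integral / csqrt (s \<alpha> w))"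
    if "w \<in> U" "\<alpha> \<in> T" for w \<alpha>
    using rec[OF sec(3)[OF that]] mom[OF that] by (simp only: sq)
  \<comment> \<open>The summands are the logarithm of \<omega>, the quotient of the normalised
    moments, and the quotient of the square roots of s. The two values of s have equal modulus, so
    the last part is imaginary; in all |b| \<le> 2 pi/3 + 1/2 + 1/2 + pi < 8.\<close>
  define b where "b w = 2 * pi / 3 * \<i> + Ln (Q (s (pi / 6) w)) - Ln (Q (s (- (pi / 6)) w))
      - (Ln (s (pi / 6) w) - Ln (s (- (pi / 6)) w)) / 2" for w
  have T: "pi / 6 \<in> T" "- (pi / 6) \<in> T" by (auto simp: T_def)
  show ?thesis unfolding U_def[symmetric]
  proof (intro exI[of _ b] conjI ballI)
    show "b holomorphic_on U" unfolding b_def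
      using Qne T sne by (intro holomorphic_intros Qhol shol) auto
    fix w assume w: "w \<in> U"
    have lnQ: "norm (Ln (Q (s \<alpha> w))) \<le> 1 / 2" if "\<alpha> \<in> T" for \<alpha>
      using norm_Ln_le[of "Q (s \<alpha> w) - 1"] Q1[OF w that] by simp
    have lns: "norm (Ln (s (pi / 6) w) - Ln (s (- (pi / 6)) w)) \<le> 2 * pi"
    proof -
      have "Re (Ln (s (pi / 6) w) - Ln (s (- (pi / 6)) w)) = 0"
        using sne[OF w T(1)] sne[OF w T(2)] sec(4)[OF w T(1)] sec(4)[OF w T(2)] by simp
      moreover have "\<bar>Im (Ln (s \<alpha> w))\<bar> \<le> pi" if "\<alpha> \<in> T" for \<alpha>
        using mpi_less_Im_Ln[OF sne(1)[OF w that]] Im_Ln_le_pi[OF sne(1)[OF w that]] by (simp add: abs_le_iff)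
      hence "\<bar>Im (Ln (s (pi / 6) w) - Ln (s (- (pi / 6)) w))\<bar> \<le> 2 * pi"
        using T unfolding minus_complex.sel by (smt (verit))
      ultimately show ?thesis using cmod_le[of "Ln (s (pi / 6) w) - Ln (s (- (pi / 6)) w)"] by linarith
    qed
    have n4: "norm (a1 + a2 - a3 - a4 / 2) \<le> norm a1 + norm a2 + norm a3 + norm a4 / 2" for a1 a2 a3 a4 :: complex
      using norm_triangle_ineq4[of "a1 + a2 - a3" "a4 / 2"] norm_triangle_ineq4[of "a1 + a2" a3] norm_triangle_ineq[of a1 a2]
      by (simp add: norm_divide)
    have "norm (b w) \<le> norm (2 * pi / 3 * \<i>) + norm (Ln (Q (s (pi / 6) w))) + norm (Ln (Q (s (- (pi / 6)) w)))
        + norm (Ln (s (pi / 6) w) - Ln (s (- (pi / 6)) w)) / 2"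
      unfolding b_def by (rule n4)
    also have "norm (2 * pi / 3 * \<i>) = 2 * pi / 3" by (simp add: norm_mult)
    finally show "norm (b w) \<le> 8" using lnQ[OF T(1)] lnQ[OF T(2)] lns pi_less_4 by linarith
    have "exp z * (Q (s \<alpha> w) * gauss_integral / csqrt (s \<alpha> w)) \<noteq> 0" if "\<alpha> \<in> T" for z \<alpha>
      using Qne[OF w that] sne[OF w that] gauss_integral_nonzero by simp
    thus ne: "airy p q (of_real (g\<^sup>2) * cis (pi / 3) * (of_real arm - w)) \<noteq> 0"
      "airy p q (of_real (g\<^sup>2) * cis (- (pi / 3)) * (of_real arm - w)) \<noteq> 0"
      using val[OF w T(1)] val[OF w T(2)] T by simp_all
    have "exp (b w) = \<omega> * (Q (s (pi / 6) w) / Q (s (- (pi / 6)) w)) / (csqrt (s (pi / 6) w) / csqrt (s (- (pi / 6)) w))"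
    proof -
      have "exp (2 * pi / 3 * \<i>) = \<omega>" by (simp add: cis_conv_exp mult.commute)
      thus ?thesis
        unfolding b_def exp_diff exp_add exp_half_Ln_ratio[OF sne(1)[OF w T(1)] sne(1)[OF w T(2)]]
        using Qne(2)[OF w T(1)] Qne(2)[OF w T(2)] by simp
    qed
    moreover have "exp (- 2 / 3 * s (pi / 6) w ^ 3) / exp (- 2 / 3 * s (- (pi / 6)) w ^ 3) = exp (- \<i> * phase w / of_real (1 / g ^ 3))"
    proof -
      have "cis (3 * (pi / 6)) = \<i>" "cis (3 * - (pi / 6)) = - \<i>" by (simp_all add: complex_eq_iff cos_diff)
      hence "- 2 / 3 * s (pi / 6) w ^ 3 - - 2 / 3 * s (- (pi / 6)) w ^ 3 = - \<i> * phase w / of_real (1 / g ^ 3)"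
        unfolding cube by (simp add: phase_def)
      thus ?thesis by (simp only: exp_diff[symmetric])
    qed
    moreover have "2 * (pi / 6) = pi / 3" "2 * - (pi / 6) = - (pi / 3)" by simp_all
    note v = val[OF w T(1), unfolded this(1)] val[OF w T(2), unfolded this(2)]
    have gen: "\<omega> * (e1 * (q1 * k / r1)) / (e2 * (q2 * k / r2)) = (e1 / e2) * (\<omega> * (q1 / q2) / (r1 / r2))"
      if "e2 \<noteq> 0" "k \<noteq> 0" "r1 \<noteq> 0" "r2 \<noteq> 0" for e1 e2 q1 q2 k r1 r2 :: complex
      using that by (simp add: field_simps)
    have "\<omega> * airy p q (of_real (g\<^sup>2) * cis (pi / 3) * (of_real arm - w))
      / airy p q (of_real (g\<^sup>2) * cis (- (pi / 3)) * (of_real arm - w))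
      = (exp (- 2 / 3 * s (pi / 6) w ^ 3) / exp (- 2 / 3 * s (- (pi / 6)) w ^ 3)) *
        (\<omega> * (Q (s (pi / 6) w) / Q (s (- (pi / 6)) w)) / (csqrt (s (pi / 6) w) / csqrt (s (- (pi / 6)) w)))"
      unfolding v using gauss_integral_nonzero sne(1)[OF w T(1)] sne(1)[OF w T(2)]
      by (intro gen) (auto simp del: csqrt.simps)
    ultimately show "\<omega> * airy p q (of_real (g\<^sup>2) * cis (pi / 3) * (of_real arm - w))
      / airy p q (of_real (g\<^sup>2) * cis (- (pi / 3)) * (of_real arm - w))
      = exp (- \<i> * phase w / of_real (1 / g ^ 3) + b w)"
      unfolding exp_add by (simp only:)
  qed
qed

section \<open>Uniform eigenvalue count\<close>

text \<open>These are the Airy variables at the two endpoints for lam = node + \<zeta>. Near the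
  node their arguments are close to - pi/3 and pi/3, inside the right half plane.\<close>

lemma wave_points:
  fixes k :: real
  shows "- \<i> * of_real k * (1 - (node + \<zeta>)) = of_real k * cis (- (pi / 3)) * (of_real arm - cis (- pi / 6) * \<zeta>)"
    "- \<i> * of_real k * (- 1 - (node + \<zeta>)) = of_real k * cis (pi / 3) * (of_real arm - cis (- 5 * pi / 6) * \<zeta>)"
proof -
  have inv: "arm / 2 = 1 / sqrt 3" "arm * (sqrt 3 / 2) = 1" by (simp_all add: arm_def)
  have ang: "- (pi / 3) + - pi / 6 = - (pi / 2)" "pi / 3 + - 5 * pi / 6 = - (pi / 2)" by (simp_all add: field_simps)
  have "cis (- (pi / 3)) * of_real arm = Complex (1 / sqrt 3) (- 1)" "cis (pi / 3) * of_real arm = Complex (1 / sqrt 3) 1"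
    using inv by (simp_all add: complex_eq_iff cos_60 sin_60 mult.commute)
  moreover have "node = Complex 0 (- 1 / sqrt 3)" by (simp add: node_def complex_eq_iff Re_divide_of_real Im_divide_of_real)
  moreover have "cis (- (pi / 3)) * (cis (- pi / 6) * \<zeta>) = - \<i> * \<zeta>" "cis (pi / 3) * (cis (- 5 * pi / 6) * \<zeta>) = - \<i> * \<zeta>"
    unfolding cis_mult_left ang by simp_all
  ultimately have "cis (- (pi / 3)) * (of_real arm - cis (- pi / 6) * \<zeta>) = - \<i> * (1 - (node + \<zeta>))"
    "cis (pi / 3) * (of_real arm - cis (- 5 * pi / 6) * \<zeta>) = - \<i> * (- 1 - (node + \<zeta>))"
    unfolding right_diff_distrib by (simp_all add: complex_eq_iff)
  thus "- \<i> * of_real k * (1 - (node + \<zeta>)) = of_real k * cis (- (pi / 3)) * (of_real arm - cis (- pi / 6) * \<zeta>)"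
    "- \<i> * of_real k * (- 1 - (node + \<zeta>)) = of_real k * cis (pi / 3) * (of_real arm - cis (- 5 * pi / 6) * \<zeta>)"
    unfolding mult.assoc by (simp_all add: mult.left_commute)
qed

lemma omega_cube: "\<omega> ^ 3 = 1" "\<omega>\<^sup>2 = \<omega>'" "\<omega> * \<omega>' = 1" "1 + \<omega> + \<omega>\<^sup>2 = 0" "\<omega>' \<noteq> 1"
proof -
  show sq: "\<omega>\<^sup>2 = \<omega>'" unfolding omega_eq by (simp add: complex_eq_iff power2_eq_square)
  show inv: "\<omega> * \<omega>' = 1" unfolding omega_eq by (simp add: complex_eq_iff)
  have "\<omega> ^ 3 = \<omega> * \<omega>\<^sup>2" by (simp only: power3_eq_cube power2_eq_square mult.assoc)
  thus "\<omega> ^ 3 = 1" unfolding sq inv .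
  show "1 + \<omega> + \<omega>\<^sup>2 = 0" unfolding sq unfolding omega_eq by (simp add: complex_eq_iff)
  show "\<omega>' \<noteq> 1" unfolding omega_eq by (simp add: complex_eq_iff)
qed

text \<open>The Dirichlet determinant of the pair A z, A (\<omega>' z) would contain A (\<omega>'
  z1), whose argument is near the negative axis in the application. The connection formula trades it
  for A z1 and A (\<omega> z1), so every remaining argument lies in Re z > 0. The factor p q
  (\<omega>' - 1) is the change of basis.\<close>

lemma airy_determinant:
  "\<omega> * airy p q z1 * airy p q z2 + airy p q z1 * airy p q (\<omega>' * z2) + \<omega>' * airy p q (\<omega> * z1) * airy p q z2
    = p * q * (\<omega>' - 1) * (airy 1 0 z1 * airy 0 1 z2 - airy 1 0 z2 * airy 0 1 z1)"
proof -
  have w': "\<omega>' ^ 3 = 1" using omega_cube(1,2) by (metis mult.commute power_mult power_one)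
  have con: "airy p q (\<omega>' * z1) = - \<omega> * airy p q z1 - \<omega>' * airy p q (\<omega> * z1)"
  proof -
    have "\<omega> * (airy p q z1 + \<omega> * airy p q (\<omega> * z1) + \<omega>' * airy p q (\<omega>' * z1)) = 0"
      using airy_connection[OF omega_cube(4), of p q z1] unfolding omega_cube(2) by simp
    hence "\<omega> * airy p q z1 + \<omega>\<^sup>2 * airy p q (\<omega> * z1) + (\<omega> * \<omega>') * airy p q (\<omega>' * z1) = 0"
      by (simp only: distrib_left power2_eq_square mult.assoc)
    hence "airy p q (\<omega>' * z1) + (\<omega> * airy p q z1 + \<omega>' * airy p q (\<omega> * z1)) = 0"
      unfolding omega_cube(2,3) by (simp only: mult_1 add_ac)
    thus ?thesis by (simp only: add_eq_0_iff2 minus_add_distrib mult_minus_left diff_conv_add_uminus)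
  qed
  have rot: "airy p q (\<omega>' * z) = p * airy 1 0 z + \<omega>' * q * airy 0 1 z" for z
    unfolding airy_rotate[OF w'] by (subst airy_linear) simp
  have "\<omega> * airy p q z1 * airy p q z2 + airy p q z1 * airy p q (\<omega>' * z2) + \<omega>' * airy p q (\<omega> * z1) * airy p q z2
    = airy p q z1 * airy p q (\<omega>' * z2) - (- \<omega> * airy p q z1 - \<omega>' * airy p q (\<omega> * z1)) * airy p q z2"
  proof -
    have "u * a * c + a * d + v * e * c = a * d - (- u * a - v * e) * c" for a c d e u v :: complex
      by (simp add: algebra_simps)
    thus ?thesis .
  qed
  also have "\<dots> = airy p q z1 * airy p q (\<omega>' * z2) - airy p q (\<omega>' * z1) * airy p q z2"
    unfolding con ..
  also have "\<dots> = (p * airy 1 0 z1 + q * airy 0 1 z1) * (p * airy 1 0 z2 + \<omega>' * q * airy 0 1 z2)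
      - (p * airy 1 0 z1 + \<omega>' * q * airy 0 1 z1) * (p * airy 1 0 z2 + q * airy 0 1 z2)"
    unfolding rot by (subst (1 2) airy_linear) (rule refl)
  also have "\<dots> = p * q * (\<omega>' - 1) * (airy 1 0 z1 * airy 0 1 z2 - airy 1 0 z2 * airy 0 1 z1)"
  proof -
    have "(p * a + q * b) * (p * c + w * q * d) - (p * a + w * q * b) * (p * c + q * d) = p * q * (w - 1) * (a * d - c * b)"
      for a b c d w :: complex by (simp add: algebra_simps)
    thus ?thesis .
  qed
  finally show ?thesis .
qed

text \<open>\<rho>, C and e0 are fixed before eps and r, so the radius may later depend on
  eps.\<close>

lemma eigenvalue_count_uniform:
  "\<exists>\<rho>>0. \<exists>C e0. 0 < e0 \<and> \<rho> \<le> arm / 4 \<and> (\<forall>eps r. 0 < eps \<and> eps < e0 \<and> 0 < r \<and> r \<le> \<rho> / 2 \<longrightarrow>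
    \<bar>eigenvalue_count r eps - Re (phase (\<omega> * r) + phase (\<omega>' * r) - 2 * phase r) / (2 * pi * sqrt eps)\<bar> \<le> C)"
proof -
  obtain p q where rec: "\<And>s. 0 < Re s \<Longrightarrow> airy p q (s\<^sup>2) = exp (- 2 / 3 * s ^ 3) * moment cubic_phase 0 s"
    using airy_recessive by blast
  obtain S where S: "0 < S" "\<And>s. S \<le> Re s \<Longrightarrow> norm s \<le> 2 * Re s \<Longrightarrow>
      norm (moment cubic_phase 0 s * csqrt s / gauss_integral - 1) \<le> 1 / 4"
    using moment_cubic_asymp by blast
  obtain \<rho> where \<rho>: "0 < \<rho>" "\<rho> \<le> arm / 4" "\<And>w w'. w \<in> ball 0 \<rho> \<Longrightarrow> w' \<in> ball 0 \<rho> \<Longrightarrow>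
     norm (phase w - phase w' + of_real (2 * sqrt arm) * (w - w')) \<le> 2 * sqrt arm / 32 * norm (w - w')"
    using phase_near_linear by blast
  define m where "m = 2 * sqrt arm"
  have m: "0 < m" using arm_bounds by (simp add: m_def)
  have ball: "norm w < arm / 4" if "w \<in> ball 0 \<rho>" for w :: complex using that \<rho>(2) by simp
  define A where "A = airy p q"
  define zp where "zp g w = of_real (g\<^sup>2) * cis (pi / 3) * (of_real arm - w)" for g w
  define zm where "zm g w = of_real (g\<^sup>2) * cis (- (pi / 3)) * (of_real arm - w)" for g w
  have zpm: "zp g w = \<omega> * zm g w" "zm g w = \<omega>' * zp g w" for g w
  proof -
    have "pi / 3 = 2 * pi / 3 + - (pi / 3)" "- (pi / 3) = - 2 * pi / 3 + pi / 3" by simp_all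
    hence c: "cis (pi / 3) = \<omega> * cis (- (pi / 3))" and c': "cis (- (pi / 3)) = \<omega>' * cis (pi / 3)"
      unfolding cis_mult by metis+
    show "zp g w = \<omega> * zm g w" unfolding zp_def zm_def c by (simp only: mult_ac)
    show "zm g w = \<omega>' * zp g w" unfolding zp_def zm_def c' by (simp only: mult_ac)
  qed
  have ex: "\<exists>b. three_exponentials phase b m \<rho> 8 (1 / g ^ 3) \<and> (\<forall>w\<in>ball 0 \<rho>. A (zp g w) \<noteq> 0 \<and> A (zm g w) \<noteq> 0 \<and>
      \<omega> * A (zp g w) / A (zm g w) = exp (three_exponentials.L phase b (1 / g ^ 3) w))"
    if g: "0 < g" "2 * S \<le> g" for g
  proof -
    obtain b where b: "b holomorphic_on ball 0 (arm / 4)"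
      "\<And>w. w \<in> ball 0 (arm / 4) \<Longrightarrow> norm (b w) \<le> 8 \<and> A (zp g w) \<noteq> 0 \<and> A (zm g w) \<noteq> 0 \<and>
        \<omega> * A (zp g w) / A (zm g w) = exp (- \<i> * phase w / of_real (1 / g ^ 3) + b w)"
      using airy_ratio[OF rec S(2) g] unfolding A_def zp_def zm_def by blast
    have te: "three_exponentials phase b m \<rho> 8 (1 / g ^ 3)"
    proof
      show "phase holomorphic_on ball 0 \<rho>"
        unfolding holomorphic_on_open[OF open_ball] using phase_has_derivative[OF ball] by blast
      show "b holomorphic_on ball 0 \<rho>" using b(1) \<rho>(2) by (auto intro: holomorphic_on_subset)
      show "norm (b w) \<le> 8" if "w \<in> ball 0 \<rho>" for w using b(2)[of w] ball[OF that] by simp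
      show "phase (of_real x) \<in> \<real>" "phase (\<omega> * of_real x) + phase (\<omega>' * of_real x) \<in> \<real>" if "\<bar>x\<bar> < \<rho>" for x
        using phase_real[of x] phase_sym[of x] that \<rho>(2) by linarith+
      show "norm (phase w - phase w' + of_real m * (w - w')) \<le> m / 32 * norm (w - w')"
        if "w \<in> ball 0 \<rho>" "w' \<in> ball 0 \<rho>" for w w' using \<rho>(3)[OF that] by (simp only: m_def)
    qed (use m \<rho> g in auto)
    show ?thesis
      using te b(2) ball by (intro exI[of _ b]) (auto simp: three_exponentials.L_def[OF te])
  qed
  define K where "K = 64 * (2 * 8 + 5) / m"
  have K: "0 < K" using m by (simp add: K_def)
  \<comment> \<open>The entries serve, in order: g \<le> g^3; the range of
    \<open>airy_ratio\<close>; 24 K h < \<rho> for \<open>zero_count\<close>; and a large enough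
    exponent to refute p q = 0.\<close>
  define g0 where "g0 = max 1 (max (2 * S) (max (25 * K / \<rho>) (64 / (m * \<rho>))))"
  have g0: "1 \<le> g0" "2 * S \<le> g0" "25 * K / \<rho> \<le> g0" "64 / (m * \<rho>) \<le> g0" by (simp_all add: g0_def)
  have cube: "g0 \<le> g ^ 3" if "g0 \<le> g" for g
  proof -
    have "g * 1 \<le> g * g\<^sup>2" using that g0(1) by (intro mult_left_mono) (auto simp: power_le_one_iff one_le_power)
    thus ?thesis using that by (simp add: power3_eq_cube power2_eq_square)
  qed
  \<comment> \<open>If \<open>p = 0\<close> or \<open>q = 0\<close>, rotating the argument by \<open>\<omega>\<close> does not change the modulus of the solution,
    which contradicts the exponential behaviour of the ratio.\<close>
  have pq: "p * q \<noteq> 0"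
  proof
    assume "p * q = 0"
    define w where "w = \<i> * of_real (\<rho> / 2)"
    have w: "w \<in> ball 0 \<rho>" "norm w = \<rho> / 2" "Im w = \<rho> / 2" using \<rho>(1) by (simp_all add: w_def norm_mult)
    obtain b where te: "three_exponentials phase b m \<rho> 8 (1 / g0 ^ 3)" and
      X: "A (zm g0 w) \<noteq> 0" "\<omega> * A (zp g0 w) / A (zm g0 w) = exp (three_exponentials.L phase b (1 / g0 ^ 3) w)"
      using ex[of g0] g0 w(1) by auto
    interpret E: three_exponentials phase b m \<rho> 8 "1 / g0 ^ 3" by (rule te)
    have "A (\<omega> * z) = A z \<or> A (\<omega> * z) = \<omega> * A z" for z
      using \<open>p * q = 0\<close> airy_linear[of p "\<omega> * q" z] airy_linear[of p q z] unfolding A_def airy_rotate[OF omega_cube(1)]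
      by (auto simp: mult.assoc)
    hence "norm (A (\<omega> * zm g0 w)) = norm (A (zm g0 w))" by (metis mult_1 norm_cis norm_mult)
    hence "norm (\<omega> * A (zp g0 w) / A (zm g0 w)) = 1"
      unfolding zpm(1) norm_divide norm_mult[of \<omega> "A _"] norm_cis using X(1) by simp
    hence "Re (E.L w) = 0" unfolding X(2) by simp
    hence "E.\<mu> * (\<rho> / 2) \<le> E.\<mu> * (\<rho> / 2 / 32) + 8" using E.Re_L[OF w(1)] unfolding w(2,3) by linarith
    moreover have "64 \<le> E.\<mu> * \<rho>"
    proof -
      have "64 / (m * \<rho>) \<le> g0 ^ 3" using cube[of g0] g0(4) by linarith
      thus ?thesis using m \<rho>(1) by (simp add: E.\<mu>_def field_simps)
    qed
    ultimately show False by (simp add: algebra_simps)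
  qed
  \<comment> \<open>The bounds of the locale involve only the slope m and the bound 8 for
    \<open>b\<close>, neither \<open>b\<close> itself nor h.\<close>
  define C where "C = 3 * three_exponentials.bound m 8 + three_exponentials.core_bound m 8"
  define e0 where "e0 = 1 / g0 ^ 6"
  have e0: "0 < e0" using g0(1) by (simp add: e0_def)
  have "\<bar>eigenvalue_count r eps - Re (phase (\<omega> * r) + phase (\<omega>' * r) - 2 * phase r) / (2 * pi * sqrt eps)\<bar> \<le> C"
    if eps: "0 < eps" "eps < e0" and r: "0 < r" "r \<le> \<rho> / 2" for eps r
  proof -
    \<comment> \<open>Then g^2 = eps^(-1/3) is the Airy scale and 1 / g^3 = sqrt eps is h.\<close>
    define g where "g = 1 / root 6 eps"
    have g: "0 < g" using eps by (simp add: g_def)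
    have g6: "g ^ 6 * eps = 1" using eps by (simp add: g_def power_divide)
    have gg0: "g0 \<le> g"
    proof (rule ccontr)
      assume "\<not> g0 \<le> g"
      hence "g ^ 6 \<le> g0 ^ 6" using g by (intro power_mono) auto
      moreover have "g0 ^ 6 * eps < 1" using eps g0(1) by (simp add: e0_def field_simps)
      moreover have "g ^ 6 * eps \<le> g0 ^ 6 * eps" using \<open>g ^ 6 \<le> g0 ^ 6\<close> eps by (intro mult_right_mono) auto
      ultimately show False using g6 by linarith
    qed
    have h: "1 / g ^ 3 = sqrt eps"
    proof (rule real_sqrt_unique[symmetric])
      show "(1 / g ^ 3)\<^sup>2 = eps" using g6 g by (simp add: power_divide field_simps flip: power_mult)
    qed (use g in simp)
    obtain b where te: "three_exponentials phase b m \<rho> 8 (1 / g ^ 3)" and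
      X: "\<And>w. w \<in> ball 0 \<rho> \<Longrightarrow> A (zp g w) \<noteq> 0 \<and> A (zm g w) \<noteq> 0 \<and>
        \<omega> * A (zp g w) / A (zm g w) = exp (three_exponentials.L phase b (1 / g ^ 3) w)"
      using ex[of g] g gg0 g0(2) by auto
    interpret E: three_exponentials phase b m \<rho> 8 "1 / g ^ 3" by (rule te)
    have small: "24 * (E.K * (1 / g ^ 3)) < \<rho>"
    proof -
      have "25 * K / \<rho> \<le> g ^ 3" using cube[OF gg0] g0(3) by linarith
      hence "25 * K \<le> g ^ 3 * \<rho>" using \<rho>(1) by (simp add: field_simps)
      hence "24 * K < g ^ 3 * \<rho>" using \<open>0 < K\<close> by linarith
      moreover have "E.K = K" by (simp add: E.K_def K_def)
      ultimately show ?thesis using g by (simp add: field_simps)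
    qed
    have iff: "node + \<zeta> \<in> eigenvalues eps \<longleftrightarrow> E.H \<zeta> = 0" if "\<zeta> \<in> ball 0 r" for \<zeta>
    proof -
      define w1 where "w1 = cis (- pi / 6) * \<zeta>"
      define w2 where "w2 = cis (- 5 * pi / 6) * \<zeta>"
      have w: "w1 \<in> ball 0 \<rho>" "w2 \<in> ball 0 \<rho>" using that r by (auto simp: w1_def w2_def norm_mult)
      define z1 where "z1 = zm g w1"
      define z2 where "z2 = zp g w2"
      have A: "A z1 \<noteq> 0" "A z2 \<noteq> 0" using X[OF w(1)] X[OF w(2)] by (auto simp: z1_def z2_def)
      have k: "(g\<^sup>2) ^ 3 * eps = 1" using g6 by (simp flip: power_mult)
      have "node + \<zeta> \<in> eigenvalues eps \<longleftrightarrow> airy 1 0 z1 * airy 0 1 z2 - airy 1 0 z2 * airy 0 1 z1 = 0"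
      proof -
        have "- \<i> * of_real (g\<^sup>2) * (1 - (node + \<zeta>)) = z1" "- \<i> * of_real (g\<^sup>2) * (- 1 - (node + \<zeta>)) = z2"
          unfolding z1_def z2_def zm_def zp_def w1_def w2_def by (rule wave_points)+
        thus ?thesis unfolding eigenvalues_iff[OF k eps(1)] by (simp only: right_minus_eq)
      qed
      also have "\<dots> \<longleftrightarrow> \<omega> * A z1 * A z2 + A z1 * A (\<omega>' * z2) + \<omega>' * A (\<omega> * z1) * A z2 = 0"
        unfolding A_def airy_determinant using pq omega_cube(5) by simp
      \<comment> \<open>With this factor the product term becomes \<omega> \<omega>' = 1 and the
        other two become the ratio of \<open>airy_ratio\<close> at w1 and its inverse at w2.\<close>
      also have "\<dots> \<longleftrightarrow> \<omega>' * (\<omega> * A z1 * A z2 + A z1 * A (\<omega>' * z2) + \<omega>' * A (\<omega> * z1) * A z2) / (A z1 * A z2) = 0"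
        using A by simp
      also have "\<omega>' * (\<omega> * A z1 * A z2 + A z1 * A (\<omega>' * z2) + \<omega>' * A (\<omega> * z1) * A z2) / (A z1 * A z2)
          = \<omega> * \<omega>' + (\<omega>' * \<omega>') * (A (\<omega> * z1) / A z1) + \<omega>' * (A (\<omega>' * z2) / A z2)"
        using A by (simp add: field_simps)
      also have "\<omega>' * \<omega>' = \<omega>"
      proof -
        have "\<omega>' * \<omega>' = \<omega>' * (\<omega> * \<omega>)" using omega_cube(2) by (simp add: power2_eq_square)
        thus ?thesis using omega_cube(3) by (simp only: mult.assoc[symmetric] mult.commute[of \<omega>' \<omega>] mult_1)
      qed
      also have "\<omega> * (A (\<omega> * z1) / A z1) = exp (E.L w1)"
        using X[OF w(1)] unfolding z1_def zpm(1)[symmetric] by simp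
      also have "\<omega>' * (A (\<omega>' * z2) / A z2) = exp (- E.L w2)"
      proof -
        have "\<omega>' = 1 / \<omega>" using omega_cube(3) by (simp add: field_simps)
        moreover have "exp (- E.L w2) = 1 / (\<omega> * A (zp g w2) / A (zm g w2))"
          using X[OF w(2)] by (simp add: exp_minus inverse_eq_divide)
        ultimately show ?thesis unfolding z2_def zpm(2)[symmetric] by simp
      qed
      finally show ?thesis unfolding omega_cube(3) by (simp only: E.H_def w1_def w2_def)
    qed
    have "eigenvalues eps \<inter> ball node r = (\<lambda>\<zeta>. node + \<zeta>) ` {\<zeta> \<in> ball 0 r. E.H \<zeta> = 0}"
    proof (intro equalityI subsetI)
      fix lam assume lam: "lam \<in> eigenvalues eps \<inter> ball node r"
      hence "lam - node \<in> ball 0 r" by (simp add: dist_norm norm_minus_commute)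
      moreover from this have "E.H (lam - node) = 0" using iff[of "lam - node"] lam by simp
      ultimately show "lam \<in> (\<lambda>\<zeta>. node + \<zeta>) ` {\<zeta> \<in> ball 0 r. E.H \<zeta> = 0}" by (intro image_eqI[of _ _ "lam - node"]) auto
    qed (use iff in \<open>auto simp: dist_norm\<close>)
    hence "eigenvalue_count r eps = card {\<zeta> \<in> ball 0 r. E.H \<zeta> = 0}"
      unfolding eigenvalue_count_def by (simp add: card_image)
    thus ?thesis using E.zero_count[OF small r] unfolding C_def h[symmetric] by simp
  qed
  thus ?thesis using \<rho>(1,2) e0 by blast
qed

section \<open>The counting formulas\<close>

text \<open>\<open>f\<close> takes the principal root of x - lam, \<open>phase\<close> that of arm -
  w; the two must be matched. For the angle 5 pi/6 the product may cross the cut. If the argument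
  lies in the upper half plane, then Re t Im t > 0 for the candidate root t, and Im t > 0 forces Re
  t > 0.\<close>

lemma csqrt_rotate:
  assumes w: "norm w < arm / 4"
  shows "csqrt (cis (pi / 6) * (of_real arm - w)) = cis (pi / 12) * csqrt (of_real arm - w)"
    and "0 < Im (cis (5 * pi / 6) * (of_real arm - w)) \<Longrightarrow>
      csqrt (cis (5 * pi / 6) * (of_real arm - w)) = cis (5 * pi / 12) * csqrt (of_real arm - w)"
proof -
  define x where "x = Re (csqrt (of_real arm - w))"
  define y where "y = Im (csqrt (of_real arm - w))"
  have xy: "9/10 < x" "\<bar>y\<bar> < x / 6" using csqrt_sector[OF w] by (simp_all add: x_def y_def)
  define c where "c = cos (pi / 12)"
  define s where "s = sin (pi / 12)"
  have "cos (pi / 3) \<le> c" unfolding c_def by (intro cos_monotone_0_pi_le) auto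
  hence c: "1 / 2 \<le> c" by (simp add: cos_60)
  have "s \<le> sin (pi / 6)" unfolding s_def by (intro sin_monotone_2pi_le) auto
  hence s: "s \<le> 1 / 2" "0 \<le> s" unfolding s_def by (simp_all add: sin_30 sin_ge_zero)
  have cs: "cos (5 * pi / 12) = s" "sin (5 * pi / 12) = c"
  proof -
    have "5 * pi / 12 = pi / 2 - pi / 12" by simp
    thus "cos (5 * pi / 12) = s" "sin (5 * pi / 12) = c" unfolding s_def c_def by (simp_all only: cos_diff sin_diff) simp_all
  qed
  have pos: "0 < c * x - \<bar>s * y\<bar>"
  proof -
    have "\<bar>s * y\<bar> \<le> 1 / 2 * (x / 6)" unfolding abs_mult using s xy by (intro mult_mono) auto
    moreover have "1 / 2 * x \<le> c * x" using c xy by (intro mult_right_mono) auto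
    ultimately show ?thesis using xy by linarith
  qed
  have sq: "(cis \<alpha> * csqrt (of_real arm - w))\<^sup>2 = cis (2 * \<alpha>) * (of_real arm - w)" for \<alpha>
    by (simp add: power_mult_distrib Complex.DeMoivre)
  have a: "2 * (pi / 12) = pi / 6" "2 * (5 * pi / 12) = 5 * pi / 6" by simp_all
  have "0 < Re (cis (pi / 12) * csqrt (of_real arm - w))"
    unfolding times_complex.sel cis.sel x_def[symmetric] y_def[symmetric] c_def[symmetric] s_def[symmetric] using pos by linarith
  thus "csqrt (cis (pi / 6) * (of_real arm - w)) = cis (pi / 12) * csqrt (of_real arm - w)"
    using csqrt_unique[OF sq[of "pi / 12"]] unfolding a by blast
  assume im: "0 < Im (cis (5 * pi / 6) * (of_real arm - w))"
  define t where "t = cis (5 * pi / 12) * csqrt (of_real arm - w)"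
  have "Im t = s * y + c * x" unfolding t_def times_complex.sel cis.sel cs x_def y_def ..
  hence "0 < Im t" using pos by linarith
  moreover have t2: "t\<^sup>2 = cis (5 * pi / 6) * (of_real arm - w)" using sq[of "5 * pi / 12"] unfolding a t_def .
  have "0 < 2 * Re t * Im t" using im unfolding t2[symmetric] Im_power2 .
  ultimately have "0 < Re t" by (simp add: zero_less_mult_iff)
  thus "csqrt (cis (5 * pi / 6) * (of_real arm - w)) = cis (5 * pi / 12) * csqrt (of_real arm - w)"
    using csqrt_unique[OF t2] unfolding t_def by blast
qed

lemma f_eq:
  assumes "Im lam < 0"
  shows "f lam = exp (- \<i> * of_real pi / 4) * (2 / 3 * ((1 - lam) * csqrt (1 - lam) - (- 1 - lam) * csqrt (- 1 - lam)))"
proof -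
  define G where "G z = exp (- \<i> * of_real pi / 4) * (2 / 3 * ((z - lam) * csqrt (z - lam)))" for z
  have "((\<lambda>x. exp (- \<i> * of_real pi / 4) * csqrt (of_real x - lam)) has_integral G (of_real 1) - G (of_real (- 1))) {-1..1}"
  proof (rule fundamental_theorem_of_calculus)
    fix x :: real
    define z where "z = of_real x - lam"
    have slit: "z \<notin> \<real>\<^sub>\<le>\<^sub>0" using assms by (auto simp: z_def complex_nonpos_Reals_iff)
    hence n: "csqrt z \<noteq> 0" by auto
    have "(G has_field_derivative exp (- \<i> * of_real pi / 4) * (2 / 3 * (csqrt z + z * (1 / (2 * csqrt z))))) (at (of_real x))"
      unfolding G_def[abs_def] z_def using slit[unfolded z_def] by (auto intro!: derivative_eq_intros)
    moreover have "z * (1 / (2 * csqrt z)) = csqrt z / 2"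
    proof -
      have "u * (1 / (2 * v)) = v / 2" if "v \<noteq> 0" "v * v = u" for u v :: complex
        using that(1) unfolding that(2)[symmetric] by simp
      moreover have "csqrt z * csqrt z = z" using power2_csqrt[of z] by (simp add: power2_eq_square)
      ultimately show ?thesis using n by blast
    qed
    moreover have "2 / 3 * (v + v / 2) = v" for v :: complex by simp
    ultimately have "(G has_field_derivative exp (- \<i> * of_real pi / 4) * csqrt (of_real x - lam)) (at (of_real x))"
      by (simp only: z_def)
    thus "((\<lambda>x. G (of_real x)) has_vector_derivative exp (- \<i> * of_real pi / 4) * csqrt (of_real x - lam)) (at x within {-1..1})"
      by (rule has_vector_derivative_real_field)
  qed simp
  hence "f lam = G (of_real 1) - G (of_real (- 1))" unfolding f_def by (rule integral_unique)
  thus ?thesis by (simp add: G_def right_diff_distrib)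
qed

text \<open>At lam = node - i \<delta> the endpoint distances are rotations of arm - \<omega>'
  \<delta> and arm - \<omega> \<delta>. Together with the factor exp (- i pi/4) the rotations of the
  3/2 powers amount to 1 and -1, so the difference of the antiderivative at the endpoints becomes a
  sum.\<close>

lemma f_below_node:
  assumes d: "0 < \<delta>" "\<delta> < arm / 4"
  shows "f (node - \<i> * of_real \<delta>) = (phase (\<omega> * of_real \<delta>) + phase (\<omega>' * of_real \<delta>)) / 2"
proof -
  define lam where "lam = node - \<i> * of_real \<delta>"
  have node: "node = Complex 0 (- 1 / sqrt 3)" by (simp add: node_def complex_eq_iff Re_divide_of_real Im_divide_of_real)
  have lam: "lam = Complex 0 (- 1 / sqrt 3 - \<delta>)" by (simp add: lam_def node complex_eq_iff)
  have im: "Im lam < 0"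
  proof -
    have "Im lam = - (1 / sqrt 3 + \<delta>)" by (simp add: lam)
    moreover have "0 < 1 / sqrt 3 + \<delta>" using d by (intro add_pos_pos) auto
    ultimately show ?thesis by linarith
  qed
  have inv: "arm / 2 = 1 / sqrt 3" "arm * (sqrt 3 / 2) = 1" by (simp_all add: arm_def)
  have ang: "pi / 6 + - 2 * pi / 3 = - (pi / 2)" "5 * pi / 6 + 2 * pi / 3 = 3 * pi / 2" by (simp_all add: field_simps)
  have i32: "cis (3 * pi / 2) = - \<i>"
  proof -
    have "3 * pi / 2 = pi + pi / 2" by simp
    thus ?thesis by (simp only: cis_mult[symmetric] cis_pi cis_pi_half) simp
  qed
  have c5: "cis (5 * pi / 6) = Complex (- (sqrt 3 / 2)) (1 / 2)"
  proof -
    have "5 * pi / 6 = pi + - (pi / 6)" by simp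
    hence "cis (5 * pi / 6) = cis pi * cis (- (pi / 6))" by (simp only: cis_mult)
    also have "\<dots> = Complex (- (sqrt 3 / 2)) (1 / 2)" by (simp add: complex_eq_iff cos_30 sin_30)
    finally show ?thesis .
  qed
  have e1: "cis (pi / 6) * of_real arm = Complex 1 (1 / sqrt 3)" "cis (5 * pi / 6) * of_real arm = Complex (- 1) (1 / sqrt 3)"
    unfolding c5 using inv by (simp_all add: complex_eq_iff cos_30 sin_30 mult.commute)
  have e2: "cis (pi / 6) * (\<omega>' * of_real \<delta>) = - \<i> * of_real \<delta>" "cis (5 * pi / 6) * (\<omega> * of_real \<delta>) = - \<i> * of_real \<delta>"
    unfolding cis_mult_left ang i32 by simp_all
  have z: "1 - lam = cis (pi / 6) * (of_real arm - \<omega>' * of_real \<delta>)"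
    "- 1 - lam = cis (5 * pi / 6) * (of_real arm - \<omega> * of_real \<delta>)"
    unfolding right_diff_distrib lam e1 e2 by (simp_all add: complex_eq_iff)
  have nb: "norm (\<omega> * of_real \<delta>) < arm / 4" "norm (\<omega>' * of_real \<delta>) < arm / 4" using d by (simp_all add: norm_mult)
  have im2: "0 < Im (cis (5 * pi / 6) * (of_real arm - \<omega> * of_real \<delta>))"
    unfolding z(2)[symmetric] using im by simp
  have e: "exp (- \<i> * of_real pi / 4) = cis (- (pi / 4))" by (simp add: cis_conv_exp)
  have "exp (- \<i> * of_real pi / 4) * ((1 - lam) * csqrt (1 - lam)) =
      cis (- (pi / 4)) * (cis (pi / 6) * cis (pi / 12)) * ((of_real arm - \<omega>' * of_real \<delta>) * csqrt (of_real arm - \<omega>' * of_real \<delta>))"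
    unfolding e z(1) csqrt_rotate(1)[OF nb(2)] by (simp only: mult_ac)
  also have "cis (- (pi / 4)) * (cis (pi / 6) * cis (pi / 12)) = 1"
    unfolding cis_mult by (simp add: field_simps)
  finally have 1: "exp (- \<i> * of_real pi / 4) * ((1 - lam) * csqrt (1 - lam)) = 3 / 4 * phase (\<omega>' * of_real \<delta>)"
    by (simp add: phase_def)
  have "exp (- \<i> * of_real pi / 4) * ((- 1 - lam) * csqrt (- 1 - lam)) =
      cis (- (pi / 4)) * (cis (5 * pi / 6) * cis (5 * pi / 12)) * ((of_real arm - \<omega> * of_real \<delta>) * csqrt (of_real arm - \<omega> * of_real \<delta>))"
    unfolding e z(2) csqrt_rotate(2)[OF nb(1) im2] by (simp only: mult_ac)
  also have "cis (- (pi / 4)) * (cis (5 * pi / 6) * cis (5 * pi / 12)) = - 1"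
  proof -
    have "- (pi / 4) + (5 * pi / 6 + 5 * pi / 12) = pi" by (simp add: field_simps)
    thus ?thesis unfolding cis_mult by simp
  qed
  finally have 2: "exp (- \<i> * of_real pi / 4) * ((- 1 - lam) * csqrt (- 1 - lam)) = - (3 / 4) * phase (\<omega> * of_real \<delta>)"
    by (simp add: phase_def)
  have "f lam = 2 / 3 * (exp (- \<i> * of_real pi / 4) * ((1 - lam) * csqrt (1 - lam)) - exp (- \<i> * of_real pi / 4) * ((- 1 - lam) * csqrt (- 1 - lam)))"
    unfolding f_eq[OF im] by (simp only: right_diff_distrib mult_ac)
  moreover have "2 / 3 * (3 / 4 * u - - (3 / 4) * v) = (v + u) / 2" for u v :: complex by (simp add: field_simps)
  ultimately show ?thesis unfolding 1 2 lam_def[symmetric] by (simp only:)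
qed

lemma phase_of_real:
  assumes "0 \<le> x" "x < arm"
  shows "phase (of_real x) = of_real (4 / 3 * (arm - x) powr (3 / 2))"
proof -
  have "csqrt (of_real (arm - x)) = of_real (sqrt (arm - x))" by (rule of_real_sqrt[symmetric]) (use assms in simp)
  moreover have "(arm - x) powr (3 / 2) = (arm - x) * sqrt (arm - x)"
  proof -
    have "(arm - x) powr (1 + 1 / 2) = (arm - x) powr 1 * (arm - x) powr (1 / 2)" by (rule powr_add)
    thus ?thesis using assms by (simp add: powr_half_sqrt)
  qed
  ultimately show ?thesis by (simp add: phase_def)
qed

text \<open>The derivative of the left side is 2 (sqrt arm - v) with v^2 = arm - z. Since (sqrt arm
  - v) (sqrt arm + v) = z and the second factor has modulus at least 1, it is at most 2 |z|.\<close>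

lemma phase_quadratic:
  assumes "norm w < arm / 4"
  shows "norm (phase w - phase 0 + of_real (2 * sqrt arm) * w) \<le> 2 * (norm w)\<^sup>2"
proof -
  have arm0: "0 < arm" using arm_bounds by simp
  have c0: "csqrt (of_real arm) = of_real (sqrt arm)" by (rule of_real_sqrt[symmetric]) (use arm0 in simp)
  have "norm ((phase w + of_real (2 * sqrt arm) * w) - (phase 0 + of_real (2 * sqrt arm) * 0)) \<le> 2 * norm w * norm (w - 0)"
  proof (rule field_differentiable_bound[OF convex_cball])
    fix z :: complex assume z: "z \<in> cball 0 (norm w)"
    have zn: "norm z < arm / 4" using z assms by simp
    have "((\<lambda>w. phase w + of_real (2 * sqrt arm) * w) has_field_derivative
        - 2 * csqrt (of_real arm - z) + of_real (2 * sqrt arm)) (at z)"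
      using phase_has_derivative[OF zn] by (auto intro!: derivative_eq_intros)
    thus "((\<lambda>w. phase w + of_real (2 * sqrt arm) * w) has_field_derivative
        - 2 * csqrt (of_real arm - z) + of_real (2 * sqrt arm)) (at z within cball 0 (norm w))"
      by (rule has_field_derivative_at_within)
    define v where "v = csqrt (of_real arm - z)"
    have "v * v = of_real arm - z" using power2_csqrt[of "of_real arm - z"] by (simp add: v_def power2_eq_square)
    moreover have "of_real (sqrt arm) * of_real (sqrt arm) = (of_real arm :: complex)"
      unfolding of_real_mult[symmetric] using arm0 by simp
    ultimately have "(of_real (sqrt arm) - v) * (of_real (sqrt arm) + v) = z" by (simp add: algebra_simps)
    hence prod: "norm (of_real (sqrt arm) - v) * norm (of_real (sqrt arm) + v) = norm z" by (metis norm_mult)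
    have "9/10 < Re v" using csqrt_sector(1)[OF zn] by (simp only: v_def)
    moreover have "1 \<le> sqrt arm" using arm_bounds by simp
    moreover have "Re (of_real (sqrt arm) + v) = sqrt arm + Re v" by simp
    ultimately have "1 \<le> norm (of_real (sqrt arm) + v)" using complex_Re_le_cmod[of "of_real (sqrt arm) + v"] by linarith
    hence "norm (of_real (sqrt arm) - v) * 1 \<le> norm z" unfolding prod[symmetric] by (intro mult_left_mono) auto
    moreover have e: "- 2 * v + of_real (2 * sqrt arm) = 2 * (of_real (sqrt arm) - v)" by (simp add: algebra_simps)
    ultimately show "norm (- 2 * csqrt (of_real arm - z) + of_real (2 * sqrt arm)) \<le> 2 * norm w"
      using z unfolding v_def[symmetric] e norm_mult by simp
  qed auto
  thus ?thesis by (simp add: power2_eq_square algebra_simps)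
qed

text \<open>The linear parts add up to - 2 sqrt arm (\<omega> + \<omega>' - 2) r = 6 sqrt arm r; the
  quadratic errors are 2 r^2 from each rotation and 4 r^2 from the doubled term.\<close>

lemma phase_combination:
  assumes r: "0 \<le> r" "r < arm / 4"
  shows "\<bar>Re (phase (\<omega> * of_real r) + phase (\<omega>' * of_real r) - 2 * phase (of_real r)) - 6 * sqrt arm * r\<bar> \<le> 8 * r\<^sup>2"
proof -
  define q where "q w = phase w - phase 0 + of_real (2 * sqrt arm) * w" for w
  define k where "k = complex_of_real (2 * sqrt arm)"
  have q: "norm (q w) \<le> 2 * r\<^sup>2" if "norm w = r" for w
    using phase_quadratic[of w] that r by (simp only: q_def)
  have s: "\<omega> + \<omega>' = - 1" unfolding omega_eq by (simp add: complex_eq_iff)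
  have "phase (\<omega> * of_real r) + phase (\<omega>' * of_real r) - 2 * phase (of_real r)
      = q (\<omega> * of_real r) + q (\<omega>' * of_real r) - 2 * q (of_real r) - k * ((\<omega> + \<omega>') * of_real r) + 2 * k * of_real r"
    unfolding q_def k_def[symmetric] by (simp add: algebra_simps)
  also have "\<dots> = q (\<omega> * of_real r) + q (\<omega>' * of_real r) - 2 * q (of_real r) + of_real (6 * sqrt arm * r)"
    unfolding s k_def by (simp add: algebra_simps)
  finally have eq: "phase (\<omega> * of_real r) + phase (\<omega>' * of_real r) - 2 * phase (of_real r) - of_real (6 * sqrt arm * r)
      = q (\<omega> * of_real r) + q (\<omega>' * of_real r) - 2 * q (of_real r)"
    by simp
  have "norm (q (\<omega> * of_real r) + q (\<omega>' * of_real r) - 2 * q (of_real r))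
      \<le> norm (q (\<omega> * of_real r)) + norm (q (\<omega>' * of_real r)) + 2 * norm (q (of_real r))"
    using norm_triangle_ineq4[of "q (\<omega> * of_real r) + q (\<omega>' * of_real r)" "2 * q (of_real r)"]
      norm_triangle_ineq[of "q (\<omega> * of_real r)" "q (\<omega>' * of_real r)"] by (simp add: norm_mult)
  also have "\<dots> \<le> 8 * r\<^sup>2"
    using q[of "\<omega> * of_real r"] q[of "\<omega>' * of_real r"] q[of "of_real r"] r by (simp add: norm_mult)
  finally have "\<bar>Re (phase (\<omega> * of_real r) + phase (\<omega>' * of_real r) - 2 * phase (of_real r) - of_real (6 * sqrt arm * r))\<bar> \<le> 8 * r\<^sup>2"
    unfolding eq using abs_Re_le_cmod order_trans by blast
  thus ?thesis unfolding minus_complex.sel Re_complex_of_real .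
qed

theorem mainTheorem6:
  shows "(\<exists>\<delta>\<^sub>0>0. \<forall>\<delta>::real. 0 < \<delta> \<and> \<delta> < \<delta>\<^sub>0 \<longrightarrow>
           (\<lambda>\<epsilon>::real. of_nat (eigenvalue_count \<delta> \<epsilon>)
              - of_real (\<epsilon> powr (-1/2) / pi)
                * (f (node - \<i> * of_real \<delta>)
                   - of_real (4/3 * (2 / sqrt 3 - \<delta>) powr (3/2))))
             \<in> O[at_right 0](\<lambda>_. 1 :: complex))
       \<and> (\<forall>\<theta>::real. \<theta> > 1/3 * (3/4) powr (3/4) \<longrightarrow>
           (\<lambda>\<epsilon>::real. real (eigenvalue_count (\<epsilon> powr (1/2) * ln (\<epsilon> powr (-\<theta>))) \<epsilon>)
              - 2 powr (1/2) * 3 powr (3/4) / pi * ln (\<epsilon> powr (-\<theta>)))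
             \<in> O[at_right 0](\<lambda>_. 1))"
proof -
  obtain \<rho> C e0 where \<rho>: "0 < \<rho>" "\<rho> \<le> arm / 4" and e0: "0 < e0" and
    count: "\<And>\<epsilon> r. 0 < \<epsilon> \<Longrightarrow> \<epsilon> < e0 \<Longrightarrow> 0 < r \<Longrightarrow> r \<le> \<rho> / 2 \<Longrightarrow>
      \<bar>eigenvalue_count r \<epsilon> - Re (phase (\<omega> * r) + phase (\<omega>' * r) - 2 * phase r) / (2 * pi * sqrt \<epsilon>)\<bar> \<le> C"
    using eigenvalue_count_uniform by blast
  have ev0: "eventually (\<lambda>\<epsilon>::real. 0 < \<epsilon> \<and> \<epsilon> < e0 \<and> \<epsilon> < 1) (at_right 0)"
    unfolding eventually_at_right_field using e0 by (intro exI[of _ "min e0 1"]) auto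
  have fixed: "(\<lambda>\<epsilon>::real. of_nat (eigenvalue_count \<delta> \<epsilon>) - of_real (\<epsilon> powr (-1/2) / pi)
      * (f (node - \<i> * of_real \<delta>) - of_real (4/3 * (2 / sqrt 3 - \<delta>) powr (3/2)))) \<in> O[at_right 0](\<lambda>_. 1 :: complex)"
    if \<delta>: "0 < \<delta>" "\<delta> < \<rho> / 2" for \<delta>
  proof (rule bigoI[where c = C])
    define Y where "Y = phase (\<omega> * of_real \<delta>) + phase (\<omega>' * of_real \<delta>) - 2 * phase (of_real \<delta>)"
    have d4: "0 < \<delta>" "\<delta> < arm / 4" "\<delta> < arm" using \<delta> \<rho> arm_bounds by linarith+
    have "f (node - \<i> * of_real \<delta>) - of_real (4/3 * (2 / sqrt 3 - \<delta>) powr (3/2)) = Y / 2"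
      unfolding f_below_node[OF d4(1,2)] arm_def[symmetric] using phase_of_real[of \<delta>] d4 by (simp add: Y_def diff_divide_distrib add_divide_distrib)
    moreover have "Y = of_real (Re Y)"
      using phase_sym[of \<delta>] phase_real[of \<delta>] d4 unfolding Y_def by (intro of_real_Re[symmetric] Reals_diff Reals_mult) auto
    ultimately have Y: "f (node - \<i> * of_real \<delta>) - of_real (4/3 * (2 / sqrt 3 - \<delta>) powr (3/2)) = of_real (Re Y / 2)"
      by simp
    show "\<forall>\<^sub>F \<epsilon> in at_right 0. norm (of_nat (eigenvalue_count \<delta> \<epsilon>) - of_real (\<epsilon> powr (-1/2) / pi)
      * (f (node - \<i> * of_real \<delta>) - of_real (4/3 * (2 / sqrt 3 - \<delta>) powr (3/2)))) \<le> C * norm (1 :: complex)"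
      using ev0
    proof eventually_elim
      case (elim \<epsilon>)
      have "\<epsilon> powr (-1/2) / pi * (Re Y / 2) = Re Y / (2 * pi * sqrt \<epsilon>)"
      proof -
        have "\<epsilon> powr (- (1/2)) = 1 / sqrt \<epsilon>" using elim by (simp add: powr_minus powr_half_sqrt inverse_eq_divide)
        thus ?thesis by simp
      qed
      moreover have "of_nat n - of_real a * of_real b = (of_real (real n - a * b) :: complex)" for n a b by simp
      ultimately have "of_nat (eigenvalue_count \<delta> \<epsilon>) - of_real (\<epsilon> powr (-1/2) / pi) * of_real (Re Y / 2)
          = (of_real (eigenvalue_count \<delta> \<epsilon> - Re Y / (2 * pi * sqrt \<epsilon>)) :: complex)" by metis
      thus ?case unfolding Y using count[of \<epsilon> \<delta>] elim \<delta> by (simp only: norm_of_real Y_def) simp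
    qed
  qed
  have shrinking: "(\<lambda>\<epsilon>::real. real (eigenvalue_count (\<epsilon> powr (1/2) * ln (\<epsilon> powr (-\<theta>))) \<epsilon>)
      - 2 powr (1/2) * 3 powr (3/4) / pi * ln (\<epsilon> powr (-\<theta>))) \<in> O[at_right 0](\<lambda>_. 1)"
    if "1/3 * (3/4) powr (3/4) < \<theta>" for \<theta> :: real
  proof (rule bigoI[where c = "C + 2"])
    have "0 < 1/3 * (3/4::real) powr (3/4)" by simp
    hence \<theta>: "0 < \<theta>" using that by linarith
    have const: "2 powr (1/2) * 3 powr (3/4) = 3 * sqrt arm"
    proof -
      have "3 powr (1/4 + 3/4) = 3 powr (1/4) * (3::real) powr (3/4)" by (rule powr_add)
      hence "3 = 3 powr (1/4) * (3::real) powr (3/4)" by simp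
      moreover have "sqrt (sqrt 3) = (3::real) powr (1/4)" by (simp add: powr_powr flip: powr_half_sqrt)
      moreover have "sqrt arm = sqrt 2 / sqrt (sqrt 3)" by (simp add: arm_def real_sqrt_divide)
      moreover have "2 powr (1/2) = sqrt 2" by (simp add: powr_half_sqrt)
      moreover have "(3::real) powr (1/4) \<noteq> 0" by simp
      ultimately show ?thesis by (metis (no_types, opaque_lifting) mult.assoc mult.commute nonzero_mult_div_cancel_left times_divide_eq_right)
    qed
    \<comment> \<open>This limit puts the shrinking radius below \<rho> / 2. The next one bounds the
      quadratic error r^2 / sqrt eps that remains after the expansion of
      \<open>phase\<close>.\<close>
    have "((\<lambda>x::real. sqrt x * (- \<theta> * ln x)) \<longlongrightarrow> 0) (at_right 0)" by real_asymp
    hence ev1: "eventually (\<lambda>x::real. sqrt x * (- \<theta> * ln x) < \<rho> / 2) (at_right 0)"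
      using \<rho>(1) by (intro order_tendstoD(2)) auto
    have "((\<lambda>x::real. sqrt x * (ln x)\<^sup>2) \<longlongrightarrow> 0) (at_right 0)" by real_asymp
    hence "((\<lambda>x::real. \<theta>\<^sup>2 * (sqrt x * (ln x)\<^sup>2)) \<longlongrightarrow> 0) (at_right 0)" by (rule tendsto_mult_right_zero)
    hence "((\<lambda>x::real. sqrt x * (- \<theta> * ln x)\<^sup>2) \<longlongrightarrow> 0) (at_right 0)" by (simp add: power_mult_distrib mult_ac)
    hence ev2: "eventually (\<lambda>x::real. sqrt x * (- \<theta> * ln x)\<^sup>2 < 1) (at_right 0)"
      by (intro order_tendstoD(2)) auto
    show "\<forall>\<^sub>F \<epsilon> in at_right 0. norm (real (eigenvalue_count (\<epsilon> powr (1/2) * ln (\<epsilon> powr (-\<theta>))) \<epsilon>)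
      - 2 powr (1/2) * 3 powr (3/4) / pi * ln (\<epsilon> powr (-\<theta>))) \<le> (C + 2) * norm (1 :: real)"
      using ev0 ev1 ev2
    proof eventually_elim
      case (elim \<epsilon>)
      define l where "l = - \<theta> * ln \<epsilon>"
      define r where "r = sqrt \<epsilon> * l"
      have \<epsilon>: "0 < \<epsilon>" "\<epsilon> < e0" "\<epsilon> < 1" using elim by auto
      have l: "0 < l" using \<theta> \<epsilon> by (simp add: l_def mult_pos_neg)
      have r: "0 < r" "r \<le> \<rho> / 2" using elim(2) mult_pos_pos[OF _ l, of "sqrt \<epsilon>"] \<epsilon>(1) unfolding r_def l_def by auto
      hence r4: "r < arm / 4" using \<rho> by linarith
      have ln: "ln (\<epsilon> powr (-\<theta>)) = l" using \<epsilon> by (simp add: l_def ln_powr)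
      have reqn: "\<epsilon> powr (1/2) * ln (\<epsilon> powr (-\<theta>)) = r" unfolding ln r_def using \<epsilon> by (simp add: powr_half_sqrt)
      define Y where "Y = Re (phase (\<omega> * r) + phase (\<omega>' * r) - 2 * phase r)"
      have Yb: "\<bar>Y - 6 * sqrt arm * r\<bar> \<le> 8 * r\<^sup>2" unfolding Y_def using r(1) r4 by (intro phase_combination) auto
      have main: "6 * sqrt arm * r / (2 * pi * sqrt \<epsilon>) = 2 powr (1/2) * 3 powr (3/4) / pi * l"
        unfolding const r_def using \<epsilon> by (simp add: field_simps)
      have den: "0 < 2 * pi * sqrt \<epsilon>" using \<epsilon> by simp
      have "\<bar>Y / (2 * pi * sqrt \<epsilon>) - 6 * sqrt arm * r / (2 * pi * sqrt \<epsilon>)\<bar> = \<bar>Y - 6 * sqrt arm * r\<bar> / (2 * pi * sqrt \<epsilon>)"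
        using den by (simp only: diff_divide_distrib[symmetric] abs_divide abs_of_pos)
      also have "\<dots> \<le> 8 * r\<^sup>2 / (2 * pi * sqrt \<epsilon>)" using Yb den by (intro divide_right_mono) auto
      also have "\<dots> = 4 / pi * (sqrt \<epsilon> * l\<^sup>2)"
      proof -
        have "r\<^sup>2 = sqrt \<epsilon> * (sqrt \<epsilon> * l\<^sup>2)" by (simp add: r_def power2_eq_square)
        thus ?thesis using \<epsilon> by (simp add: field_simps)
      qed
      also have "\<dots> \<le> 4 / pi * 1" using elim by (intro mult_left_mono) (auto simp: l_def)
      also have "\<dots> \<le> 2" using pi_gt3 by (simp add: field_simps)
      finally have "\<bar>Y / (2 * pi * sqrt \<epsilon>) - 2 powr (1/2) * 3 powr (3/4) / pi * l\<bar> \<le> 2" unfolding main .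
      moreover have "\<bar>eigenvalue_count r \<epsilon> - Y / (2 * pi * sqrt \<epsilon>)\<bar> \<le> C"
        unfolding Y_def by (rule count[OF \<epsilon>(1,2) r(1,2)])
      ultimately show ?case unfolding reqn unfolding ln real_norm_def by (simp only: abs_one mult_1_right)
    qed
  qed
  show ?thesis
  proof (intro conjI exI[of _ "\<rho> / 2"] allI impI)
    show "0 < \<rho> / 2" using \<rho> by simp
  qed (use fixed shrinking in blast)+
qed

end
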